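(* Let $[p_1,\dots,p_9,q]\in\mathbb{X}_{3,10}$ be a generic configuration of $10$ points of $\mathbb{P}^2(\mathbb{C})$ in general position, and let $C_0$ and $C$ be smooth cubic curves with $p_1,\dots,p_8,p_9\in C_0$ and $p_1,\dots,p_8,q\in C$. Then $$[p_1,\dots,p_9,q].T_{89}=[p_1,\dots,p_7,\bar p_8,\bar p_9,\bar q],$$ where $\bar p_8,\bar p_9\in C_0$ and $\bar q\in C$ are determined by: (1) the nine points $p_1,\dots,p_8,\bar p_9\in C_0$ are the base points of a pencil of cubic curves; (2) $\bar p_8+\bar p_9=p_8+p_9$ under the addition of $C_0$; (3) $\bar p_9+\bar q=p_8+q$ under the addition of $C$. In particular, $\bar p_9$ is the ninth point of the intersection $C_0\cap C$.
   Context: $\mathbb{X}_{3,10}$ is the space of $10$-tuples of points of $\mathbb{P}^2(\mathbb{C})$ in general position (distinct, no three collinear) modulo the diagonal $PGL_3(\mathbb{C})$-action. The Weyl group $W_{3,10}=\langle s_0,\dots,s_9\rangle$ acts birationally on the right on $\mathbb{X}_{3,10}$ ($[P].(ab)=([P].a).b$): $s_k$ ($1\le k\le9$) swaps the $k$-th and $(k+1)$-th points; for distinct $i,j,k$, $s_{ijk}$ is the standard Cremona transformation with respect to the $i$-th, $j$-th, $k$-th points: in homogeneous coordinates where these are the coordinate points, it fixes them and replaces every other point $(x_1:x_2:x_3)$ by $(x_1^{-1}:x_2^{-1}:x_3^{-1})$ (with $s_0=s_{123}$); $s_{89}$ swaps the 8th and 9th points. Define $T_{89}=s_{128}s_{348}s_{567}s_{348}s_{128}s_{89}$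 (an element of $\langle s_0,\dots,s_8\rangle\cong W(E_8^{(1)})$, the translation by the root $\varepsilon_8-\varepsilon_9$). For points $p,q,p',q'$ on a smooth cubic $D$, "$p+q=p'+q'$ under the addition of $D$" means that the third intersection point of $D$ with the line through $p,q$ coincides with the third intersection point of $D$ with the line through $p',q'$. *)

theory Defs
  imports "HOL-Analysis.Analysis"
begin

text \<open>Points of P^2(C) are represented by nonzero vectors of complex^3 (homogeneous
coordinates); configurations of points are functions nat => complex^3, of which only
the indices 1..n matter.\<close>

type_synonym pt = "complex ^ 3"
type_synonym cfg = "nat \<Rightarrow> complex ^ 3"

definition proj_eq :: "pt \<Rightarrow> pt \<Rightarrow> bool" where
  "proj_eq u v \<longleftrightarrow> u \<noteq> 0 \<and> v \<noteq> 0 \<and> (\<exists>c. c \<noteq> 0 \<and> u = c *s v)"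

definition det3 :: "pt \<Rightarrow> pt \<Rightarrow> pt \<Rightarrow> complex" where
  "det3 u v w =
     u$1 * (v$2 * w$3 - v$3 * w$2) - u$2 * (v$1 * w$3 - v$3 * w$1) + u$3 * (v$1 * w$2 - v$2 * w$1)"

text \<open>General position: distinct and no three collinear (for n >= 3 both follow from
non-vanishing of all 3x3 minors of distinct triples).\<close>
definition gen_pos :: "nat \<Rightarrow> cfg \<Rightarrow> bool" where
  "gen_pos n P \<longleftrightarrow> (\<forall>i\<in>{1..n}. \<forall>j\<in>{1..n}. \<forall>k\<in>{1..n}.
      i \<noteq> j \<and> j \<noteq> k \<and> i \<noteq> k \<longrightarrow> det3 (P i) (P j) (P k) \<noteq> 0)"

definition cfg_equiv :: "nat \<Rightarrow> cfg \<Rightarrow> cfg \<Rightarrow> bool" where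
  "cfg_equiv n P Q \<longleftrightarrow> (\<exists>A :: complex^3^3. invertible A \<and> (\<forall>m\<in>{1..n}. proj_eq (A *v P m) (Q m)))"

text \<open>Standard Cremona transformation s_ijk: [P].s_ijk = [Q].  In the coordinates
y = A^-1 x in which P i, P j, P k are the coordinate points, these are fixed and every
other point gets its coordinates inverted (which requires its coordinates to be nonzero).\<close>
definition cremona_rel :: "nat \<Rightarrow> nat \<Rightarrow> nat \<Rightarrow> nat \<Rightarrow> cfg \<Rightarrow> cfg \<Rightarrow> bool" where
  "cremona_rel n i j k P Q \<longleftrightarrow> (\<exists>A :: complex^3^3. invertible A \<and>
      proj_eq (A *v axis 1 1) (P i) \<and> proj_eq (A *v axis 2 1) (P j) \<and> proj_eq (A *v axis 3 1) (P k) \<and>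
      (\<forall>m\<in>{1..n} - {i, j, k}. \<forall>l. (matrix_inv A *v P m) $ l \<noteq> 0) \<and>
      cfg_equiv n
        (\<lambda>m. if m = i then axis 1 1 else if m = j then axis 2 1 else if m = k then axis 3 1
             else (\<chi> l. inverse ((matrix_inv A *v P m) $ l)))
        Q)"

definition swap89 :: "cfg \<Rightarrow> cfg" where
  "swap89 P = (\<lambda>m. if m = 8 then P 9 else if m = 9 then P 8 else P m)"

definition T89_rel :: "cfg \<Rightarrow> cfg \<Rightarrow> bool" where
  "T89_rel P Q \<longleftrightarrow> (\<exists>P1 P2 P3 P4 P5.
      cremona_rel 10 1 2 8 P P1 \<and> cremona_rel 10 3 4 8 P1 P2 \<and> cremona_rel 10 5 6 7 P2 P3 \<and>
      cremona_rel 10 3 4 8 P3 P4 \<and> cremona_rel 10 1 2 8 P4 P5 \<and> cfg_equiv 10 (swap89 P5) Q)"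

definition mons3 :: "(nat \<times> nat \<times> nat) set" where
  "mons3 = {(a, b, c). a + b + c = 3}"

definition cubic_eval :: "(nat \<times> nat \<times> nat \<Rightarrow> complex) \<Rightarrow> pt \<Rightarrow> complex" where
  "cubic_eval F x = (\<Sum>(a, b, c)\<in>mons3. F (a, b, c) * x$1 ^ a * x$2 ^ b * x$3 ^ c)"

definition cubic_d1 :: "(nat \<times> nat \<times> nat \<Rightarrow> complex) \<Rightarrow> pt \<Rightarrow> complex" where
  "cubic_d1 F x = (\<Sum>(a, b, c)\<in>mons3. of_nat a * F (a, b, c) * x$1 ^ (a - 1) * x$2 ^ b * x$3 ^ c)"

definition cubic_d2 :: "(nat \<times> nat \<times> nat \<Rightarrow> complex) \<Rightarrow> pt \<Rightarrow> complex" where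
  "cubic_d2 F x = (\<Sum>(a, b, c)\<in>mons3. of_nat b * F (a, b, c) * x$1 ^ a * x$2 ^ (b - 1) * x$3 ^ c)"

definition cubic_d3 :: "(nat \<times> nat \<times> nat \<Rightarrow> complex) \<Rightarrow> pt \<Rightarrow> complex" where
  "cubic_d3 F x = (\<Sum>(a, b, c)\<in>mons3. of_nat c * F (a, b, c) * x$1 ^ a * x$2 ^ b * x$3 ^ (c - 1))"

definition on_curve :: "(nat \<times> nat \<times> nat \<Rightarrow> complex) \<Rightarrow> pt \<Rightarrow> bool" where
  "on_curve F x \<longleftrightarrow> x \<noteq> 0 \<and> cubic_eval F x = 0"

definition smooth_cubic :: "(nat \<times> nat \<times> nat \<Rightarrow> complex) \<Rightarrow> bool" where
  "smooth_cubic F \<longleftrightarrow> (\<exists>m\<in>mons3. F m \<noteq> 0) \<and>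
     (\<forall>x. on_curve F x \<longrightarrow> \<not> (cubic_d1 F x = 0 \<and> cubic_d2 F x = 0 \<and> cubic_d3 F x = 0))"

text \<open>r is the third intersection point of the curve F = 0 with the line through the
distinct points p, q of the curve (counted with multiplicity): F(s p + t q) = s t (alpha s + beta t)
and r = beta p - alpha q.\<close>
definition third_point :: "(nat \<times> nat \<times> nat \<Rightarrow> complex) \<Rightarrow> pt \<Rightarrow> pt \<Rightarrow> pt \<Rightarrow> bool" where
  "third_point F p q r \<longleftrightarrow> p \<noteq> 0 \<and> q \<noteq> 0 \<and> \<not> proj_eq p q \<and>
     (\<exists>\<alpha> \<beta>. (\<alpha>, \<beta>) \<noteq> (0, 0) \<and>
        (\<forall>s t. cubic_eval F (s *s p + t *s q) = s * t * (\<alpha> * s + \<beta> * t)) \<and>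
        proj_eq r (\<beta> *s p - \<alpha> *s q))"

definition cubic_sum_eq :: "(nat \<times> nat \<times> nat \<Rightarrow> complex) \<Rightarrow> pt \<Rightarrow> pt \<Rightarrow> pt \<Rightarrow> pt \<Rightarrow> bool" where
  "cubic_sum_eq F p q p' q' \<longleftrightarrow> (\<exists>r. third_point F p q r \<and> third_point F p' q' r)"

definition pencil_base_points :: "pt list \<Rightarrow> bool" where
  "pencil_base_points pts \<longleftrightarrow> (\<exists>G H.
     (\<forall>a b. (\<forall>m\<in>mons3. a * G m + b * H m = 0) \<longrightarrow> a = 0 \<and> b = 0) \<and>
     (\<forall>x. x \<noteq> 0 \<longrightarrow> ((cubic_eval G x = 0 \<and> cubic_eval H x = 0) \<longleftrightarrow> (\<exists>p\<in>set pts. proj_eq x p))))"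

text \<open>Polynomial functions in the homogeneous coordinates of the 10 points; used to
express "generic" (holding on a nonempty Zariski-open set).\<close>
inductive_set cfg_poly :: "(cfg \<Rightarrow> complex) set" where
  const: "(\<lambda>P. c) \<in> cfg_poly"
| coord: "i \<in> {1..10} \<Longrightarrow> (\<lambda>P. P i $ l) \<in> cfg_poly"
| add: "f \<in> cfg_poly \<Longrightarrow> g \<in> cfg_poly \<Longrightarrow> (\<lambda>P. f P + g P) \<in> cfg_poly"
| mult: "f \<in> cfg_poly \<Longrightarrow> g \<in> cfg_poly \<Longrightarrow> (\<lambda>P. f P * g P) \<in> cfg_poly"

end

(*
The points are followed on a member F of the pencil of cubics through p_1, ..., p_8. For a smooth
cubic the composite of the five Cremona maps acts by the translation p_8 - b, where b is the ninth
base point, but no group law is needed. With K the conic through p_1, ..., p_4 and a = p_8, the first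
two maps together are the cubic map R = (l_3 K, l_4 K, [12x] l_3 l_4), l_i = [i x a]. The key identity
says that the chord involution x -> y = third point of the line a x on the member of the pencil
through x satisfies [a b x] [a j x] m_j(R x) = [b j y] up to a factor not depending on j, where m_j is
a linear form. Hence the coordinates of the second configuration in the basis of its points 5, 6, 7
are [b j y] / [a j y], up to constants depending only on j. The configuration p_1, ..., p_7, b,
bar p_8, bar q (where b = bar p_9) has the same chord points y with a and b exchanged, so its
coordinates are the inverses, and this is precisely the relation s_567 between the two middle
configurations.
*)

theory Submission
  imports Defs
begin

section \<open>Brackets and quadratic transformations\<close>

text \<open>The five maps are never composed: \<open>quad_related\<close> is symmetric, so the two
  middle configurations are computed from both ends and only compared. Two obstacles shape the rest.
  First, points 1, 2, 3, 4 and 8 of a middle configuration are not images of points of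
  \<open>P\<close> but of contracted curves; evaluating \<open>cubic_map\<close> at another point of
  the contracted curve lets the one chord identity serve every index. For index 8 that point must
  lie on the conic through P 1, ..., P 4 and a (or b), and its chord point must be the same for a
  and for b. The coresidual of the four points on the cubic through P 9 achieves both, since conics
  through four points of a cubic cut it further in pairs collinear with one fixed point. Second,
  genericity means one polynomial in the ten points, so b and all derived points need polynomial
  formulas instead of mere existence, and the polynomial needs a place where it does not vanish;
  hence the explicit ninth base point and the numerical example.\<close>

lemma det3_comb:
  "det3 (x1 *s u + y1 *s v + z1 *s w) (x2 *s u + y2 *s v + z2 *s w) (x3 *s u + y3 *s v + z3 *s w)
   = (x1 * (y2 * z3 - z2 * y3) - y1 * (x2 * z3 - z2 * x3) + z1 * (x2 * y3 - y2 * x3)) * det3 u v w"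
  by (simp add: det3_def algebra_simps)

lemma det3_cramer:
  "det3 u v w *s x = det3 x v w *s u + det3 u x w *s v + det3 u v x *s w"
  by (simp add: vec_eq_iff forall_3 det3_def algebra_simps)

lemma det3_coords:
  assumes "det3 u v w \<noteq> 0"
  shows "x = (det3 x v w / det3 u v w) *s u + (det3 u x w / det3 u v w) *s v + (det3 u v x / det3 u v w) *s w"
proof -
  have "x = inverse (det3 u v w) *s (det3 u v w *s x)"
    using assms by (simp add: vector_smult_assoc)
  also have "\<dots> = inverse (det3 u v w) *s (det3 x v w *s u + det3 u x w *s v + det3 u v x *s w)"
    by (subst det3_cramer) (rule refl)
  finally show ?thesis
    by (simp add: vector_add_ldistrib vector_smult_assoc divide_inverse mult.commute)
qed

lemma det3_smult: "det3 (c *s u) v w = c * det3 u v w" "det3 u (c *s v) w = c * det3 u v w"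
  "det3 u v (c *s w) = c * det3 u v w"
  by (simp_all add: det3_def algebra_simps)

lemma det3_add: "det3 (u + u') v w = det3 u v w + det3 u' v w" "det3 u (v + v') w = det3 u v w + det3 u v' w"
  "det3 u v (w + w') = det3 u v w + det3 u v w'"
  by (simp_all add: det3_def algebra_simps)

lemma det3_same [simp]: "det3 u u v = 0" "det3 u v u = 0" "det3 v u u = 0"
  by (simp_all add: det3_def algebra_simps)

lemma det3_zero [simp]: "det3 0 u v = 0" "det3 u 0 v = 0" "det3 u v 0 = 0"
  by (simp_all add: det3_def)

lemma det3_swap: "det3 v u w = - det3 u v w" "det3 u w v = - det3 u v w" "det3 w v u = - det3 u v w"
  by (simp_all add: det3_def algebra_simps)

lemma det3_nz_perm:
  "det3 u v w \<noteq> 0 \<Longrightarrow> det3 v u w \<noteq> 0 \<and> det3 u w v \<noteq> 0 \<and> det3 v w u \<noteq> 0 \<and> det3 w u v \<noteq> 0 \<and> det3 w v u \<noteq> 0"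
  by (simp add: det3_def algebra_simps)

lemma proj_eq_sym: "proj_eq u v \<Longrightarrow> proj_eq v u"
  unfolding proj_eq_def
proof (elim conjE exE, intro conjI)
  fix c assume "c \<noteq> 0" "u = c *s v"
  then have "inverse c \<noteq> 0 \<and> v = inverse c *s u" by (simp add: vector_smult_assoc)
  then show "\<exists>c. c \<noteq> 0 \<and> v = c *s u" by blast
qed auto

definition cols :: "pt \<Rightarrow> pt \<Rightarrow> pt \<Rightarrow> complex^3^3" where
  "cols u v w = (\<chi> r c. if c = 1 then u $ r else if c = 2 then v $ r else w $ r)"

lemma cols_mult: "cols u v w *v x = x $ 1 *s u + x $ 2 *s v + x $ 3 *s w"
  by (simp add: vec_eq_iff cols_def matrix_vector_mult_def sum_3 mult.commute)

lemma det_cols: "det (cols u v w) = det3 u v w"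
  by (simp add: det_3 cols_def det3_def algebra_simps)

lemma invertible_cols: "det3 u v w \<noteq> 0 \<Longrightarrow> invertible (cols u v w)"
  by (simp add: invertible_det_nz det_cols)

text \<open>A form of the relation of s_ijk that is symmetric in P and Q and free of matrices: the barycentric coordinates
of P m and Q m in the two triangles of reference have products in a ratio d1 : d2 : d3 independent of m.\<close>
definition quad_related :: "nat \<Rightarrow> nat \<Rightarrow> nat \<Rightarrow> cfg \<Rightarrow> cfg \<Rightarrow> bool" where
  "quad_related i j k P Q \<longleftrightarrow> det3 (P i) (P j) (P k) \<noteq> 0 \<and> det3 (Q i) (Q j) (Q k) \<noteq> 0 \<and>
     (\<exists>d1 d2 d3. d1 \<noteq> 0 \<and> d2 \<noteq> 0 \<and> d3 \<noteq> 0 \<and>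
       (\<forall>m\<in>{1..10} - {i, j, k}. \<exists>s. s \<noteq> 0 \<and>
          det3 (P m) (P j) (P k) * det3 (Q m) (Q j) (Q k) = s * d1 \<and>
          det3 (P i) (P m) (P k) * det3 (Q i) (Q m) (Q k) = s * d2 \<and>
          det3 (P i) (P j) (P m) * det3 (Q i) (Q j) (Q m) = s * d3))"

lemma quad_relatedI:
  assumes "det3 (P i) (P j) (P k) \<noteq> 0" "det3 (Q i) (Q j) (Q k) \<noteq> 0" "d1 \<noteq> 0" "d2 \<noteq> 0" "d3 \<noteq> 0"
    and "\<And>m. m \<in> {1..10} - {i, j, k} \<Longrightarrow> \<exists>s. s \<noteq> 0 \<and>
          det3 (P m) (P j) (P k) * det3 (Q m) (Q j) (Q k) = s * d1 \<and>
          det3 (P i) (P m) (P k) * det3 (Q i) (Q m) (Q k) = s * d2 \<and>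
          det3 (P i) (P j) (P m) * det3 (Q i) (Q j) (Q m) = s * d3"
  shows "quad_related i j k P Q"
  unfolding quad_related_def
  by (rule conjI[OF assms(1)], rule conjI[OF assms(2)], rule exI[of _ d1], rule exI[of _ d2], rule exI[of _ d3])
     (intro conjI ballI assms)

text \<open>This lets the last two maps be followed backwards from the end configuration.\<close>

lemma quad_related_sym: "quad_related i j k P Q \<Longrightarrow> quad_related i j k Q P"
  unfolding quad_related_def by (simp only: mult.commute[of "det3 (Q _) _ _"] simp_thms)

lemma proj_eq_smult: "c \<noteq> 0 \<Longrightarrow> v \<noteq> 0 \<Longrightarrow> proj_eq (c *s v) v"
  by (auto simp: proj_eq_def)

lemma proj_eq_refl: "v \<noteq> 0 \<Longrightarrow> proj_eq v v"
  using proj_eq_smult[of 1 v] by simp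

text \<open>In the triangle P i, P j, P k the coordinates of P m are its brackets a1, a2, a3 up to a
  common factor, and the hypothesis makes 1/a1, 1/a2, 1/a3 proportional to b1/d1, b2/d2, b3/d3, with
  b1, b2, b3 the brackets of Q m.\<close>

lemma quad_related_imp_cremona_rel:
  assumes q: "quad_related i j k P Q" and ijk: "i \<noteq> j" "i \<noteq> k" "j \<noteq> k"
  shows "cremona_rel 10 i j k P Q"
proof -
  from q obtain d1 d2 d3 where D: "det3 (P i) (P j) (P k) \<noteq> 0" and D': "det3 (Q i) (Q j) (Q k) \<noteq> 0"
    and d: "d1 \<noteq> 0" "d2 \<noteq> 0" "d3 \<noteq> 0"
    and ex: "\<forall>m\<in>{1..10} - {i, j, k}. \<exists>s. s \<noteq> 0 \<and>
          det3 (P m) (P j) (P k) * det3 (Q m) (Q j) (Q k) = s * d1 \<and>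
          det3 (P i) (P m) (P k) * det3 (Q i) (Q m) (Q k) = s * d2 \<and>
          det3 (P i) (P j) (P m) * det3 (Q i) (Q j) (Q m) = s * d3"
    unfolding quad_related_def by auto
  define D where "D = det3 (P i) (P j) (P k)"
  define E where "E = det3 (Q i) (Q j) (Q k)"
  have DE: "D \<noteq> 0" "E \<noteq> 0" using D D' by (simp_all add: D_def E_def)
  define A where "A = cols (P i) (P j) (P k)"
  \<comment> \<open>Scaling the columns by d1, d2, d3 cancels the denominators that inversion
    leaves.\<close>
  define B where "B = cols (d1 *s Q i) (d2 *s Q j) (d3 *s Q k)"
  have iA: "invertible A" and iB: "invertible B"
    using D D' d by (simp_all add: A_def B_def invertible_cols det3_smult)
  have nzP: "P i \<noteq> 0" "P j \<noteq> 0" "P k \<noteq> 0" using D by auto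
  have nzQ: "Q i \<noteq> 0" "Q j \<noteq> 0" "Q k \<noteq> 0" using D' by auto
  have Aax: "A *v axis 1 1 = P i" "A *v axis 2 1 = P j" "A *v axis 3 1 = P k"
    and Bax: "B *v axis 1 1 = d1 *s Q i" "B *v axis 2 1 = d2 *s Q j" "B *v axis 3 1 = d3 *s Q k"
    by (simp_all add: A_def B_def cols_mult axis_def)
  have "matrix_inv A ** A = mat 1"
    using iA unfolding invertible_def matrix_inv_def by (rule someI2_ex) blast
  then have inv: "matrix_inv A *v (A *v x) = x" for x
    by (simp add: matrix_vector_mul_assoc)
  have main: "(\<forall>l. (matrix_inv A *v P m) $ l \<noteq> 0) \<and>
       proj_eq (B *v (\<chi> l. inverse ((matrix_inv A *v P m) $ l))) (Q m)" if m: "m \<in> {1..10} - {i, j, k}" for m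
  proof -
    define a1 a2 a3 where a: "a1 = det3 (P m) (P j) (P k)" "a2 = det3 (P i) (P m) (P k)" "a3 = det3 (P i) (P j) (P m)"
    define b1 b2 b3 where b': "b1 = det3 (Q m) (Q j) (Q k)" "b2 = det3 (Q i) (Q m) (Q k)" "b3 = det3 (Q i) (Q j) (Q m)"
    from bspec[OF ex m] obtain s where s: "s \<noteq> 0" and
      e: "a1 * b1 = s * d1" "a2 * b2 = s * d2" "a3 * b3 = s * d3"
      unfolding a b' by blast
    have nz: "a1 \<noteq> 0" "a2 \<noteq> 0" "a3 \<noteq> 0" using e s d by auto
    have "P m = A *v vector [a1 / D, a2 / D, a3 / D]"
      unfolding A_def cols_mult using det3_coords[OF D, of "P m"] by (simp add: a D_def)
    then have c: "matrix_inv A *v P m = vector [a1 / D, a2 / D, a3 / D]" by (simp add: inv)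
    have b: "b1 = s * d1 / a1" "b2 = s * d2 / a2" "b3 = s * d3 / a3"
      using e nz by (simp_all add: field_simps)
    have Q: "Q m = (b1 / E) *s Q i + (b2 / E) *s Q j + (b3 / E) *s Q k"
      using det3_coords[OF D', of "Q m"] by (simp add: b' E_def)
    have Qm: "Q m = (s / (D * E)) *s (B *v (\<chi> l. inverse ((matrix_inv A *v P m) $ l)))"
      unfolding c Q b using DE nz by (simp add: B_def cols_mult vec_eq_iff field_simps)
    have "Q m \<noteq> 0" using b'(1) b(1) s d nz by auto
    then have "B *v (\<chi> l. inverse ((matrix_inv A *v P m) $ l)) \<noteq> 0" using Qm by auto
    then have "proj_eq (Q m) (B *v (\<chi> l. inverse ((matrix_inv A *v P m) $ l)))"
      using s DE \<open>B *v _ \<noteq> 0\<close> by (subst Qm) (rule proj_eq_smult, simp_all)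
    then have "proj_eq (B *v (\<chi> l. inverse ((matrix_inv A *v P m) $ l))) (Q m)"
      by (rule proj_eq_sym)
    moreover have "\<forall>l. (matrix_inv A *v P m) $ l \<noteq> 0"
      using nz DE by (simp add: c forall_3)
    ultimately show ?thesis by blast
  qed
  show ?thesis
    unfolding cremona_rel_def
  proof (intro exI[of _ A] conjI iA)
    show "cfg_equiv 10
     (\<lambda>m. if m = i then axis 1 1 else if m = j then axis 2 1 else if m = k then axis 3 1
          else \<chi> l. inverse ((matrix_inv A *v P m) $ l)) Q"
      unfolding cfg_equiv_def
    proof (intro exI[of _ B] conjI iB ballI)
      fix m :: nat assume m: "m \<in> {1..10}"
      show "proj_eq (B *v (if m = i then axis 1 1 else if m = j then axis 2 1 else if m = k then axis 3 1
          else \<chi> l. inverse ((matrix_inv A *v P m) $ l))) (Q m)"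
      proof (cases "m \<in> {i, j, k}")
        case True
        then show ?thesis using ijk d nzQ by (auto simp: Bax proj_eq_smult)
      next
        case False
        then have "m \<noteq> i" "m \<noteq> j" "m \<noteq> k" by auto
        with main[of m] m False show ?thesis by simp
      qed
    qed
    show "\<forall>m\<in>{1..10} - {i, j, k}. \<forall>l. (matrix_inv A *v P m) $ l \<noteq> 0"
      using main by blast
  qed (simp_all only: Aax proj_eq_refl nzP not_False_eq_True)
qed

section \<open>Cubic forms and the chord construction\<close>

lemma mons3_eq: "mons3 = {(3,0,0),(0,3,0),(0,0,3),(2,1,0),(2,0,1),(1,2,0),(0,2,1),(1,0,2),(0,1,2),(1,1,1)}"
proof (rule set_eqI)
  fix m :: "nat \<times> nat \<times> nat"
  obtain a b c where m: "m = (a, b, c)" by (cases m)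
  have "a = 0 \<or> a = 1 \<or> a = 2 \<or> a = 3 \<or> a > 3" "b = 0 \<or> b = 1 \<or> b = 2 \<or> b = 3 \<or> b > 3" by linarith+
  then show "m \<in> mons3 \<longleftrightarrow> m \<in> {(3,0,0),(0,3,0),(0,0,3),(2,1,0),(2,0,1),(1,2,0),(0,2,1),(1,0,2),(0,1,2),(1,1,1)}"
    unfolding m mons3_def by (elim disjE; simp; linarith?)
qed

lemma cubic_eval_expand:
  "cubic_eval F x = F (3,0,0) * x$1^3 + F (0,3,0) * x$2^3 + F (0,0,3) * x$3^3
     + F (2,1,0) * x$1^2 * x$2 + F (2,0,1) * x$1^2 * x$3 + F (1,2,0) * x$1 * x$2^2
     + F (0,2,1) * x$2^2 * x$3 + F (1,0,2) * x$1 * x$3^2 + F (0,1,2) * x$2 * x$3^2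
     + F (1,1,1) * x$1 * x$2 * x$3"
  unfolding cubic_eval_def mons3_eq by (simp add: algebra_simps)

definition is_cubic :: "(pt \<Rightarrow> complex) \<Rightarrow> bool" where
  "is_cubic F \<longleftrightarrow> (\<exists>c. F = cubic_eval c)"

definition ternary_cubic :: "(complex \<Rightarrow> complex \<Rightarrow> complex \<Rightarrow> complex) \<Rightarrow> bool" where
  "ternary_cubic f \<longleftrightarrow> (\<exists>c1 c2 c3 c4 c5 c6 c7 c8 c9 c10. \<forall>X Y Z. f X Y Z =
     c1 * X^3 + c2 * Y^3 + c3 * Z^3 + c4 * X^2 * Y + c5 * X^2 * Z + c6 * X * Y^2
     + c7 * Y^2 * Z + c8 * X * Z^2 + c9 * Y * Z^2 + c10 * X * Y * Z)"

lemma ternary_cubicE: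
  assumes "ternary_cubic f"
  obtains c1 c2 c3 c4 c5 c6 c7 c8 c9 c10 where "\<And>X Y Z. f X Y Z =
     c1 * X^3 + c2 * Y^3 + c3 * Z^3 + c4 * X^2 * Y + c5 * X^2 * Z + c6 * X * Y^2
     + c7 * Y^2 * Z + c8 * X * Z^2 + c9 * Y * Z^2 + c10 * X * Y * Z"
  using assms unfolding ternary_cubic_def by (elim exE) (rule that, elim allE, assumption)

lemma ternary_cubic_add:
  assumes "ternary_cubic f" "ternary_cubic g" shows "ternary_cubic (\<lambda>X Y Z. f X Y Z + g X Y Z)"
proof -
  from assms(1) obtain a1 a2 a3 a4 a5 a6 a7 a8 a9 a10 where 1: "\<And>X Y Z. f X Y Z =
     a1 * X^3 + a2 * Y^3 + a3 * Z^3 + a4 * X^2 * Y + a5 * X^2 * Z + a6 * X * Y^2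
     + a7 * Y^2 * Z + a8 * X * Z^2 + a9 * Y * Z^2 + a10 * X * Y * Z"
    by (rule ternary_cubicE) (rule that)
  from assms(2) obtain b1 b2 b3 b4 b5 b6 b7 b8 b9 b10 where 2: "\<And>X Y Z. g X Y Z =
     b1 * X^3 + b2 * Y^3 + b3 * Z^3 + b4 * X^2 * Y + b5 * X^2 * Z + b6 * X * Y^2
     + b7 * Y^2 * Z + b8 * X * Z^2 + b9 * Y * Z^2 + b10 * X * Y * Z"
    by (rule ternary_cubicE) (rule that)
  show ?thesis
    unfolding ternary_cubic_def 1 2
    by (rule exI[of _ "a1+b1"], rule exI[of _ "a2+b2"], rule exI[of _ "a3+b3"], rule exI[of _ "a4+b4"],
        rule exI[of _ "a5+b5"], rule exI[of _ "a6+b6"], rule exI[of _ "a7+b7"], rule exI[of _ "a8+b8"],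
        rule exI[of _ "a9+b9"], rule exI[of _ "a10+b10"]) (simp add: distrib_right)
qed

lemma ternary_cubic_prod:
  "ternary_cubic (\<lambda>X Y Z. c * (X * u1 + Y * v1 + Z * w1) * (X * u2 + Y * v2 + Z * w2) * (X * u3 + Y * v3 + Z * w3))"
  unfolding ternary_cubic_def
  by (rule exI[of _ "c * u1 * u2 * u3"], rule exI[of _ "c * v1 * v2 * v3"], rule exI[of _ "c * w1 * w2 * w3"],
      rule exI[of _ "c * (u1 * u2 * v3+u1 * v2 * u3+v1 * u2 * u3)"], rule exI[of _ "c * (u1 * u2 * w3+u1 * w2 * u3+w1 * u2 * u3)"],
      rule exI[of _ "c * (v1 * v2 * u3+v1 * u2 * v3+u1 * v2 * v3)"], rule exI[of _ "c * (v1 * v2 * w3+v1 * w2 * v3+w1 * v2 * v3)"],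
      rule exI[of _ "c * (w1 * w2 * u3+w1 * u2 * w3+u1 * w2 * w3)"], rule exI[of _ "c * (w1 * w2 * v3+w1 * v2 * w3+v1 * w2 * w3)"],
      rule exI[of _ "c * (u1 * v2 * w3+u1 * w2 * v3+v1 * u2 * w3+v1 * w2 * u3+w1 * u2 * v3+w1 * v2 * u3)"])
    (simp add: algebra_simps power2_eq_square power3_eq_cube)

text \<open>After substitution every monomial is a product of three linear forms in X, Y, Z, so
  \<open>ternary_cubic_prod\<close> covers all ten terms.\<close>

lemma is_cubic_coords:
  assumes "is_cubic F"
  shows "ternary_cubic (\<lambda>X Y Z. F (X *s u + Y *s v + Z *s w))"
proof -
  from assms obtain c where F: "F = cubic_eval c" unfolding is_cubic_def by blast
  note p = ternary_cubic_prod[of _ "u$i" "v$i" "w$i" "u$j" "v$j" "w$j" "u$k" "v$k" "w$k" for i j k]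
  show ?thesis
    unfolding F cubic_eval_expand power3_eq_cube power2_eq_square vector_add_component vector_smult_component
      mult.assoc[symmetric]
    by (intro ternary_cubic_add p)
qed

lemma is_cubic_line:
  assumes F: "is_cubic F" and "F p = 0" "F q = 0"
  obtains a b where "\<And>s t. F (s *s p + t *s q) = s * t * (a * s + b * t)"
proof -
  \<comment> \<open>The third basis vector 0 turns the coordinate expansion into one on the line; F
    p = F q = 0 removes the cubes.\<close>
  from is_cubic_coords[OF F, of p q 0] obtain c1 c2 c3 c4 c5 c6 c7 c8 c9 c10 where 1: "\<And>X Y Z. F (X *s p + Y *s q + Z *s 0) =
     c1 * X^3 + c2 * Y^3 + c3 * Z^3 + c4 * X^2 * Y + c5 * X^2 * Z + c6 * X * Y^2
     + c7 * Y^2 * Z + c8 * X * Z^2 + c9 * Y * Z^2 + c10 * X * Y * Z"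
    by (rule ternary_cubicE) (rule that)
  have "c1 = 0" "c2 = 0" using 1[of 1 0 0] 1[of 0 1 0] assms by simp_all
  then have "F (s *s p + t *s q) = s * t * (c4 * s + c6 * t)" for s t
    using 1[of s t 0] by (simp add: power2_eq_square algebra_simps)
  then show ?thesis by (rule that)
qed

text \<open>The coefficients of s^2 t and of s t^2 in F (s a + t x), provided that F a = 0.\<close>
definition polar1 :: "(pt \<Rightarrow> complex) \<Rightarrow> pt \<Rightarrow> pt \<Rightarrow> complex" where
  "polar1 F a x = (F (a + x) - F (a - x)) / 2 - F x"

definition polar2 :: "(pt \<Rightarrow> complex) \<Rightarrow> pt \<Rightarrow> pt \<Rightarrow> complex" where
  "polar2 F a x = (F (a + x) + F (a - x)) / 2"

text \<open>A total function, polynomial in its data, in place of the relation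
  \<open>third_point\<close>; the genericity conditions are built from it.\<close>

definition third :: "(pt \<Rightarrow> complex) \<Rightarrow> pt \<Rightarrow> pt \<Rightarrow> pt" where
  "third F p q = polar2 F p q *s p - polar1 F p q *s q"

lemma polar_line:
  assumes "\<And>s t. F (s *s p + t *s q) = s * t * (a * s + b * t)"
  shows "polar1 F p q = a" "polar2 F p q = b"
proof -
  have "F (p + q) = a + b" "F (p - q) = b - a" "F q = 0"
    using assms[of 1 1] assms[of 1 "-1"] assms[of 0 1] by (simp_all add: algebra_simps)
  then show "polar1 F p q = a" "polar2 F p q = b" by (simp_all add: polar1_def polar2_def field_simps)
qed

lemma line_expand:
  assumes "is_cubic F" "F p = 0" "F q = 0"
  shows "F (s *s p + t *s q) = s * t * (polar1 F p q * s + polar2 F p q * t)"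
  using is_cubic_line[OF assms] polar_line by metis

lemma third_F:
  assumes "is_cubic F" "F p = 0" "F q = 0"
  shows "F (third F p q) = 0"
  using line_expand[OF assms, of "polar2 F p q" "- polar1 F p q"] by (simp add: third_def algebra_simps)

text \<open>Collinearity of the three points is symmetric; only the scalar has to be found, by
  substituting r into the expansion on the line p q. The condition on \<open>polar2\<close> keeps r
  from being a multiple of q.\<close>

lemma third_rot:
  assumes F: "is_cubic F" "F p = 0" "F q = 0" and b: "polar2 F p q \<noteq> 0" and r: "third F p q = c *s r" and c: "c \<noteq> 0"
  shows "third F q r = - (polar2 F p q ^ 3 / c ^ 2) *s p"
proof -
  define A B where AB: "A = polar1 F p q" "B = polar2 F p q"
  have r': "r = (B / c) *s p - (A / c) *s q"
    using r c unfolding third_def AB[symmetric] by (simp add: vec_eq_iff field_simps)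
  have L: "F (s *s q + t *s r) = s * t * ((B^2 / c) * s + (- A * B^2 / c^2) * t)" for s t
  proof -
    have "s *s q + t *s r = (t * B / c) *s p + (s - t * A / c) *s q"
      unfolding r' by (simp add: vec_eq_iff algebra_simps)
    then have "F (s *s q + t *s r) = (t * B / c) * (s - t * A / c) * (A * (t * B / c) + B * (s - t * A / c))"
      by (simp only: line_expand[OF F] AB)
    also have "\<dots> = s * t * ((B^2 / c) * s + (- A * B^2 / c^2) * t)"
      using c by (simp add: field_simps power2_eq_square)
    finally show ?thesis .
  qed
  have "third F q r = (- A * B^2 / c^2) *s q - (B^2 / c) *s r"
    unfolding third_def polar_line[OF L] ..
  also have "\<dots> = - (B ^ 3 / c ^ 2) *s p"
    unfolding r' using c by (simp add: vec_eq_iff field_simps power2_eq_square power3_eq_cube)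
  finally show ?thesis by (simp add: AB)
qed

section \<open>Binary forms\<close>

text \<open>Binary forms as functions, graded by degree. Splitting off one variable at a time is not
  unique, but it is all that division by a linear factor needs.\<close>

inductive binary_form :: "nat \<Rightarrow> (complex \<Rightarrow> complex \<Rightarrow> complex) \<Rightarrow> bool" where
  binary_form_const: "binary_form 0 (\<lambda>X Y. c)"
| binary_form_Suc: "binary_form n f \<Longrightarrow> binary_form n g \<Longrightarrow> binary_form (Suc n) (\<lambda>X Y. X * f X Y + Y * g X Y)"

inductive_cases binary_form_0E: "binary_form 0 f"
inductive_cases binary_form_SucE: "binary_form (Suc n) f"

lemma binary_form_scale: "binary_form n f \<Longrightarrow> binary_form n (\<lambda>X Y. c * f X Y)"
proof (induction rule: binary_form.induct)
  case (binary_form_const d) show ?case by (rule binary_form.binary_form_const)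
next
  case (binary_form_Suc n f g)
  from binary_form.binary_form_Suc[OF binary_form_Suc.IH] show ?case by (simp add: algebra_simps)
qed

lemma binary_form_zero: "binary_form n (\<lambda>X Y. 0)"
proof (induction n)
  case 0 show ?case by (rule binary_form_const)
next
  case (Suc n) from binary_form_Suc[OF Suc Suc] show ?case by simp
qed

lemma binary_form_add: "binary_form n f \<Longrightarrow> binary_form n g \<Longrightarrow> binary_form n (\<lambda>X Y. f X Y + g X Y)"
proof (induction arbitrary: g rule: binary_form.induct)
  case (binary_form_const c)
  then show ?case by (elim binary_form_0E) (auto intro: binary_form.binary_form_const)
next
  case (binary_form_Suc n f h)
  from binary_form_Suc.prems obtain f' h' where g: "g = (\<lambda>X Y. X * f' X Y + Y * h' X Y)" "binary_form n f'" "binary_form n h'"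
    by (elim binary_form_SucE)
  from binary_form.binary_form_Suc[OF binary_form_Suc.IH(1)[OF g(2)] binary_form_Suc.IH(2)[OF g(3)]]
  show ?case unfolding g(1) by (simp add: algebra_simps)
qed

lemma binary_form_diff: "binary_form n f \<Longrightarrow> binary_form n g \<Longrightarrow> binary_form n (\<lambda>X Y. f X Y - g X Y)"
  using binary_form_add[of n f "\<lambda>X Y. (-1) * g X Y"] binary_form_scale[of n g "-1"] by simp

lemma binary_form_X: "binary_form n f \<Longrightarrow> binary_form (Suc n) (\<lambda>X Y. X * f X Y)"
  using binary_form_Suc[OF _ binary_form_zero, of n f] by simp

lemma binary_form_Y: "binary_form n f \<Longrightarrow> binary_form (Suc n) (\<lambda>X Y. Y * f X Y)"
  using binary_form_Suc[OF binary_form_zero, of n f] by simp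

lemma binary_form_mult: "binary_form m f \<Longrightarrow> binary_form n g \<Longrightarrow> binary_form (m + n) (\<lambda>X Y. f X Y * g X Y)"
proof (induction rule: binary_form.induct)
  case (binary_form_const c)
  then show ?case using binary_form_scale by simp
next
  case (binary_form_Suc m f h)
  have "binary_form (Suc (m + n)) (\<lambda>X Y. X * (f X Y * g X Y) + Y * (h X Y * g X Y))"
    by (rule binary_form.binary_form_Suc[OF binary_form_Suc.IH(1)[OF binary_form_Suc.prems] binary_form_Suc.IH(2)[OF binary_form_Suc.prems]])
  then show ?case by (simp add: algebra_simps)
qed

lemma binary_form_mult': "binary_form m f \<Longrightarrow> binary_form n g \<Longrightarrow> k = m + n \<Longrightarrow> binary_form k (\<lambda>X Y. f X Y * g X Y)"
  using binary_form_mult by simp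

lemma binary_form_linear: "binary_form 1 (\<lambda>X Y. c * X + d * Y)"
  using binary_form_Suc[OF binary_form_const[of c] binary_form_const[of d]] by (simp add: mult.commute)

lemma binary_form_linear': "binary_form 1 (\<lambda>X Y. c * X - d * Y)"
  using binary_form_linear[of c "-d"] by simp

lemma binary_form_2E:
  assumes "binary_form 2 f" obtains c0 c1 c2 where "\<And>X Y. f X Y = c0 * X^2 + c1 * X * Y + c2 * Y^2"
proof -
  obtain g h where f: "f = (\<lambda>X Y. X * g X Y + Y * h X Y)" and g: "binary_form (Suc 0) g" and h: "binary_form (Suc 0) h"
    by (rule binary_form_SucE[OF assms[unfolded numeral_2_eq_2]]) (rule that)
  from g obtain g1 g2 where g1: "g = (\<lambda>X Y. X * g1 + Y * g2)" by (auto elim!: binary_form_SucE binary_form_0E)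
  from h obtain ninth_param1 h2 where ninth_param1: "h = (\<lambda>X Y. X * ninth_param1 + Y * h2)" by (auto elim!: binary_form_SucE binary_form_0E)
  show ?thesis
    by (rule that[of g1 "g2 + ninth_param1" h2]) (simp add: f g1 ninth_param1 algebra_simps power2_eq_square)
qed

lemma binary_form_3E:
  assumes "binary_form 3 f" obtains c0 c1 c2 c3 where "\<And>X Y. f X Y = c0 * X^3 + c1 * X^2 * Y + c2 * X * Y^2 + c3 * Y^3"
proof -
  have "binary_form (Suc 2) f" using assms by simp
  then obtain g h where f: "f = (\<lambda>X Y. X * g X Y + Y * h X Y)" and g: "binary_form 2 g" and h: "binary_form 2 h"
    by (rule binary_form_SucE) (rule that)
  from g obtain g0 g1 g2 where g1: "\<And>X Y. g X Y = g0 * X^2 + g1 * X * Y + g2 * Y^2" by (rule binary_form_2E) (rule that)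
  from h obtain ninth_param0 ninth_param1 h2 where ninth_param1: "\<And>X Y. h X Y = ninth_param0 * X^2 + ninth_param1 * X * Y + h2 * Y^2" by (rule binary_form_2E) (rule that)
  show ?thesis
    by (rule that[of g0 "g1 + ninth_param0" "g2 + ninth_param1" h2]) (simp add: f g1 ninth_param1 algebra_simps power2_eq_square power3_eq_cube)
qed

text \<open>Synthetic division: modulo a Y - b X with b nonzero, X equals (a / b) Y, so only a
  multiple of \<open>Y ^ Suc m\<close> remains.\<close>

lemma binary_form_div_aux:
  assumes "b \<noteq> 0"
  shows "binary_form n f \<Longrightarrow> n = Suc m \<Longrightarrow> \<exists>g c. binary_form m g \<and> (\<forall>X Y. f X Y = (a * Y - b * X) * g X Y + c * Y ^ Suc m)"
proof (induction arbitrary: m rule: binary_form.induct)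
  case (binary_form_Suc n f g)
  then have m: "m = n" by simp
  show ?case
  proof (cases n)
    case 0
    from binary_form_Suc.hyps 0 obtain c d where fg: "f = (\<lambda>X Y. c)" "g = (\<lambda>X Y. d)" by (auto elim!: binary_form_0E)
    show ?thesis unfolding m 0
      by (rule exI[of _ "\<lambda>X Y. - c / b"], rule exI[of _ "d + a * c / b"])
         (use assms in \<open>auto simp: fg field_simps intro: binary_form.binary_form_const\<close>)
  next
    case (Suc k)
    from binary_form_Suc.IH(1)[OF Suc] obtain f' c where f': "binary_form k f'" "\<And>X Y. f X Y = (a * Y - b * X) * f' X Y + c * Y ^ Suc k" by auto
    from binary_form_Suc.IH(2)[OF Suc] obtain g' d where g': "binary_form k g'" "\<And>X Y. g X Y = (a * Y - b * X) * g' X Y + d * Y ^ Suc k" by auto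
    have P: "binary_form k (\<lambda>X Y. Y ^ k)" for k
    proof (induction k)
      case 0 then show ?case using binary_form_const by simp
    next
      case (Suc k) from binary_form_Y[OF Suc] show ?case by simp
    qed
    have 1: "binary_form (Suc k) (\<lambda>X Y. X * f' X Y + Y * g' X Y + (- c / b) * Y ^ Suc k)"
      by (intro binary_form_add binary_form_scale binary_form.binary_form_Suc f' g' P)
    show ?thesis unfolding m Suc
      by (rule exI[of _ "\<lambda>X Y. X * f' X Y + Y * g' X Y + (- c / b) * Y ^ Suc k"], rule exI[of _ "d + a * c / b"])
         (use assms 1 in \<open>auto simp: f' g' field_simps\<close>)
  qed
qed simp

lemma binary_form_swap: "binary_form n f \<Longrightarrow> binary_form n (\<lambda>X Y. f Y X)"
proof (induction rule: binary_form.induct)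
  case (binary_form_const d) show ?case by (rule binary_form.binary_form_const)
next
  case (binary_form_Suc n f g)
  from binary_form.binary_form_Suc[OF binary_form_Suc.IH(2,1)] show ?case by (simp add: algebra_simps)
qed

lemma binary_form_div:
  assumes f: "binary_form (Suc n) f" "f a b = 0" and ab: "a \<noteq> 0 \<or> b \<noteq> 0"
  obtains g where "binary_form n g" "\<And>X Y. f X Y = (a * Y - b * X) * g X Y"
proof (cases "b = 0")
  case False
  from binary_form_div_aux[OF False f(1) refl, of a] obtain g c where g: "binary_form n g" "\<And>X Y. f X Y = (a * Y - b * X) * g X Y + c * Y ^ Suc n" by auto
  with f(2) False have "c = 0" by (simp add: mult.commute)
  with g show ?thesis by (intro that[of g]) auto
next
  \<comment> \<open>The divisor is a multiple of Y; exchanging the variables makes its second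
    parameter nonzero.\<close>
  case True
  with ab have a: "a \<noteq> 0" by simp
  from binary_form_div_aux[OF a binary_form_swap[OF f(1)] refl, of b] obtain g c where
    g: "binary_form n g" "\<And>X Y. f Y X = (b * Y - a * X) * g X Y + c * Y ^ Suc n" by auto
  have "c = 0" using g(2)[where X = b and Y = a] f(2) True a by simp
  with g show ?thesis
    by (intro that[of "\<lambda>X Y. - g Y X"]) (use binary_form_scale[OF binary_form_swap[OF g(1)], of "-1"] in \<open>auto simp: algebra_simps\<close>)
qed

text \<open>Coordinates have a = (0 : 0 : 1), and l is the line through b and j. The right-hand side
  is the value of l at the chord point. It is only linear in Z, and its two coefficients are binary
  forms, so vanishing at b and j forces divisibility by the lines joining these points to a.\<close>

lemma node_cubic_divide:
  assumes T: "binary_form 1 T0" "binary_form 1 T1" and B: "binary_form 2 B0" "binary_form 2 B1" and C: "binary_form 3 C0" "binary_form 3 C1"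
    and F0: "\<And>X Y Z. F0 X Y Z = Z^2 * T0 X Y + Z * B0 X Y + C0 X Y"
    and F1: "\<And>X Y Z. F1 X Y Z = Z^2 * T1 X Y + Z * B1 X Y + C1 X Y"
    and b: "F0 xb yb zb = 0" "F1 xb yb zb = 0" and j: "F0 xj yj zj = 0" "F1 xj yj zj = 0"
    and l: "l1 * xb + l2 * yb + l3 * zb = 0" "l1 * xj + l2 * yj + l3 * zj = 0"
    and nz: "xb * yj - yb * xj \<noteq> 0"
  obtains q c where "binary_form 2 q" "binary_form 3 c"
    "\<And>X Y Z. (xb * Y - yb * X) * (xj * Y - yj * X) * (Z * q X Y + c X Y)
       = l3 * (F0 X Y Z * (B1 X Y + 2 * Z * T1 X Y) - F1 X Y Z * (B0 X Y + 2 * Z * T0 X Y))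
         - (T1 X Y * F0 X Y Z - T0 X Y * F1 X Y Z) * (l1 * X + l2 * Y + l3 * Z)"
proof -
  define A where "A = (\<lambda>X Y. T1 X Y * B0 X Y - T0 X Y * B1 X Y)"
  define D where "D = (\<lambda>X Y. T1 X Y * C0 X Y - T0 X Y * C1 X Y)"
  define E where "E = (\<lambda>X Y. C0 X Y * B1 X Y - C1 X Y * B0 X Y)"
  \<comment> \<open>\<open>U\<close> and \<open>V\<close> are the coefficients of Z and of 1 on the
    right-hand side; those of Z^3 and Z^2 cancel.\<close>
  define U where "U = (\<lambda>X Y. l3 * D X Y - A X Y * (l1 * X + l2 * Y))"
  define V where "V = (\<lambda>X Y. l3 * E X Y - D X Y * (l1 * X + l2 * Y))"
  have A: "binary_form 3 A" unfolding A_def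
    by (intro binary_form_diff binary_form_mult'[OF T(2) B(1)] binary_form_mult'[OF T(1) B(2)]) simp_all
  have D: "binary_form 4 D" unfolding D_def
    by (intro binary_form_diff binary_form_mult'[OF T(2) C(1)] binary_form_mult'[OF T(1) C(2)]) simp_all
  have E: "binary_form 5 E" unfolding E_def
    by (intro binary_form_diff binary_form_mult'[OF C(1) B(2)] binary_form_mult'[OF C(2) B(1)]) simp_all
  have U: "binary_form 4 U" unfolding U_def
    by (intro binary_form_diff binary_form_scale D binary_form_mult'[OF A binary_form_linear]) simp_all
  have V: "binary_form 5 V" unfolding V_def
    by (intro binary_form_diff binary_form_scale E binary_form_mult'[OF D binary_form_linear]) simp_all
  \<comment> \<open>At a common zero of F0 and F1, elimination expresses D and E by A and z; on the
    line l = 0 both coefficients then vanish.\<close>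
  have zero: "U x y = 0 \<and> V x y = 0" if p: "F0 x y z = 0" "F1 x y z = 0" "l1 * x + l2 * y + l3 * z = 0" for x y z
  proof -
    have 1: "D x y = - z * A x y" "E x y = z^2 * A x y"
      using p(1,2) unfolding A_def D_def E_def F0 F1 by algebra+
    have 2: "l1 * x + l2 * y = - l3 * z" using p(3) by algebra
    show ?thesis unfolding U_def V_def 1 2 by algebra
  qed
  have nzb: "xb \<noteq> 0 \<or> yb \<noteq> 0" and nzj: "xj \<noteq> 0 \<or> yj \<noteq> 0" using nz by auto
  have split: "\<exists>g. binary_form n g \<and> (\<forall>X Y. f X Y = (xb * Y - yb * X) * (xj * Y - yj * X) * g X Y)"
    if f: "binary_form (Suc (Suc n)) f" "f xb yb = 0" "f xj yj = 0" for f n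
  proof -
    from binary_form_div[OF f(1,2) nzb] obtain g where g: "binary_form (Suc n) g" "\<And>X Y. f X Y = (xb * Y - yb * X) * g X Y" by blast
    have "g xj yj = 0" using g(2)[of xj yj] f(3) nz by auto
    from binary_form_div[OF g(1) this nzj] obtain h where "binary_form n h" "\<And>X Y. g X Y = (xj * Y - yj * X) * h X Y" by blast
    with g(2) show ?thesis by (auto simp: mult.assoc)
  qed
  from split[of 2 U] U zero[OF b l(1)] zero[OF j l(2)] obtain q where q: "binary_form 2 q" "\<And>X Y. U X Y = (xb * Y - yb * X) * (xj * Y - yj * X) * q X Y"
    by auto
  from split[of 3 V] V zero[OF b l(1)] zero[OF j l(2)] obtain c where c: "binary_form 3 c" "\<And>X Y. V X Y = (xb * Y - yb * X) * (xj * Y - yj * X) * c X Y"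
    by auto
  show ?thesis
  proof (rule that[OF q(1) c(1)])
    fix X Y Z
    have "(xb * Y - yb * X) * (xj * Y - yj * X) * (Z * q X Y + c X Y) = Z * U X Y + V X Y"
      unfolding q(2) c(2) by algebra
    also have "\<dots> = l3 * (F0 X Y Z * (B1 X Y + 2 * Z * T1 X Y) - F1 X Y Z * (B0 X Y + 2 * Z * T0 X Y))
         - (T1 X Y * F0 X Y Z - T0 X Y * F1 X Y Z) * (l1 * X + l2 * Y + l3 * Z)"
      unfolding U_def V_def A_def D_def E_def F0 F1 by algebra
    finally show "(xb * Y - yb * X) * (xj * Y - yj * X) * (Z * q X Y + c X Y)
       = l3 * (F0 X Y Z * (B1 X Y + 2 * Z * T1 X Y) - F1 X Y Z * (B0 X Y + 2 * Z * T0 X Y))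
         - (T1 X Y * F0 X Y Z - T0 X Y * F1 X Y Z) * (l1 * X + l2 * Y + l3 * Z)" .
  qed
qed

text \<open>Vanishing at the first two coordinate points makes c divisible by X Y. The part of K
  free of Z is k3 X Y, so subtracting a linear multiple of K removes c. What is left is Z times a
  quadratic form vanishing at the third and fourth points, hence a multiple of the product of the
  lines joining them to the node.\<close>

lemma node_cubic_span:
  assumes q: "binary_form 2 q" and c: "binary_form 3 c"
    and z: "c 1 0 = 0" "c 0 1 = 0" "z3 * q x3 y3 + c x3 y3 = 0" "z4 * q x4 y4 + c x4 y4 = 0"
    and K: "\<And>X Y Z. K X Y Z = Z * (k1 * X + k2 * Y) + k3 * X * Y"
    and k: "k3 \<noteq> 0" "K x3 y3 z3 = 0" "K x4 y4 z4 = 0"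
    and nz: "z3 \<noteq> 0" "z4 \<noteq> 0" "x3 * y4 - y3 * x4 \<noteq> 0"
  obtains m1 m2 m3 where "\<And>X Y Z. Z * q X Y + c X Y = m1 * ((x3 * Y - y3 * X) * K X Y Z)
     + m2 * ((x4 * Y - y4 * X) * K X Y Z) + m3 * (Z * (x3 * Y - y3 * X) * (x4 * Y - y4 * X))"
proof -
  from c obtain c0 c1 c2 c3 where c': "\<And>X Y. c X Y = c0 * X^3 + c1 * X^2 * Y + c2 * X * Y^2 + c3 * Y^3"
    by (rule binary_form_3E) (rule that)
  have c0: "c0 = 0" "c3 = 0" using z(1,2) by (simp_all add: c')
  define r where "r = (\<lambda>X Y. q X Y - (c1 / k3 * X + c2 / k3 * Y) * (k1 * X + k2 * Y))"
  have r: "binary_form 2 r" unfolding r_def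
    by (intro binary_form_diff q binary_form_mult'[OF binary_form_linear binary_form_linear]) simp
  have main: "Z * q X Y + c X Y = (c1 / k3 * X + c2 / k3 * Y) * K X Y Z + Z * r X Y" for X Y Z
    unfolding r_def K c' c0 using k(1) by (simp add: field_simps power2_eq_square power3_eq_cube)
  have r3: "r x3 y3 = 0" and r4: "r x4 y4 = 0"
    using main[of z3 x3 y3] main[of z4 x4 y4] z(3,4) k(2,3) nz by simp_all
  have n3: "x3 \<noteq> 0 \<or> y3 \<noteq> 0" and n4: "x4 \<noteq> 0 \<or> y4 \<noteq> 0" using nz by auto
  from binary_form_div[OF r[unfolded numeral_2_eq_2] r3 n3] obtain g where g: "binary_form (Suc 0) g" "\<And>X Y. r X Y = (x3 * Y - y3 * X) * g X Y"
    by blast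
  have "g x4 y4 = 0" using g(2)[of x4 y4] r4 nz by auto
  from binary_form_div[OF g(1) this n4] obtain h where h: "binary_form 0 h" "\<And>X Y. g X Y = (x4 * Y - y4 * X) * h X Y" by blast
  from h(1) obtain m where m: "h = (\<lambda>X Y. m)" by (rule binary_form_0E)
  define d where "d = x3 * y4 - y3 * x4"
  have d: "d \<noteq> 0" using nz d_def by simp
  show ?thesis
  proof (rule that[of "(c1 / k3 * x4 + c2 / k3 * y4) / d" "- (c1 / k3 * x3 + c2 / k3 * y3) / d" m])
    fix X Y Z
    \<comment> \<open>The two lines from the node to the third and fourth points span all lines
      through the node.\<close>
    have lin: "c1 / k3 * X + c2 / k3 * Y = (c1 / k3 * x4 + c2 / k3 * y4) / d * (x3 * Y - y3 * X)
       + - (c1 / k3 * x3 + c2 / k3 * y3) / d * (x4 * Y - y4 * X)"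
    proof -
      have gen: "(u * v - w * z) / d = u / d * v + - w / d * z" for u v w z
        by (simp add: diff_divide_distrib)
      have "(c1 / k3 * X + c2 / k3 * Y) * d = (c1 / k3 * x4 + c2 / k3 * y4) * (x3 * Y - y3 * X)
        - (c1 / k3 * x3 + c2 / k3 * y3) * (x4 * Y - y4 * X)"
        unfolding d_def by (simp add: algebra_simps)
      then have "c1 / k3 * X + c2 / k3 * Y = ((c1 / k3 * x4 + c2 / k3 * y4) * (x3 * Y - y3 * X)
        - (c1 / k3 * x3 + c2 / k3 * y3) * (x4 * Y - y4 * X)) / d"
        by (rule iffD2[OF nonzero_eq_divide_eq[OF d]])
      also have "\<dots> = (c1 / k3 * x4 + c2 / k3 * y4) / d * (x3 * Y - y3 * X)
       + - (c1 / k3 * x3 + c2 / k3 * y3) / d * (x4 * Y - y4 * X)"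
        using gen .
      finally show ?thesis .
    qed
    show "Z * q X Y + c X Y = (c1 / k3 * x4 + c2 / k3 * y4) / d * ((x3 * Y - y3 * X) * K X Y Z)
     + - (c1 / k3 * x3 + c2 / k3 * y3) / d * ((x4 * Y - y4 * X) * K X Y Z) + m * (Z * (x3 * Y - y3 * X) * (x4 * Y - y4 * X))"
      unfolding main lin g(2) h(2) m by (simp only: algebra_simps)
  qed
qed

section \<open>The pencil of cubics and its chord involution\<close>

text \<open>Two of the three line pairs through P 1, ..., P 4 are used, here and in
  \<open>conic1\<close>; they span the pencil of conics through these points.\<close>

definition conic0 :: "cfg \<Rightarrow> pt \<Rightarrow> complex" where
  "conic0 P x = det3 (P 1) (P 2) x * det3 (P 3) (P 4) x"

definition conic1 :: "cfg \<Rightarrow> pt \<Rightarrow> complex" where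
  "conic1 P x = det3 (P 1) (P 3) x * det3 (P 2) (P 4) x"

text \<open>The member through a of the pencil of conics through P 1, ..., P 4.\<close>
definition conic_thru :: "cfg \<Rightarrow> pt \<Rightarrow> pt \<Rightarrow> complex" where
  "conic_thru P a x = conic1 P a * conic0 P x - conic0 P a * conic1 P x"

text \<open>Three cubics with a double point at a that pass through P 1, ..., P 4, in the basis for
  which points 3, 4 and 8 of \<open>cremona348\<close> become the coordinate points.\<close>

definition cubic_map :: "cfg \<Rightarrow> pt \<Rightarrow> pt \<Rightarrow> pt" where
  "cubic_map P a x = vector [det3 (P 3) x a * conic_thru P a x, det3 (P 4) x a * conic_thru P a x,
                      det3 (P 1) (P 2) x * det3 (P 3) x a * det3 (P 4) x a]"

text \<open>The third intersection point of the line a x with the member F0 x * F1 - F1 x * F0 of the pencil through x.\<close>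
definition chord_map :: "(pt \<Rightarrow> complex) \<Rightarrow> (pt \<Rightarrow> complex) \<Rightarrow> pt \<Rightarrow> pt \<Rightarrow> pt" where
  "chord_map F0 F1 a x = (F0 x * polar2 F1 a x - F1 x * polar2 F0 a x) *s a - (polar1 F1 a x * F0 x - polar1 F0 a x * F1 x) *s x"

lemma det3_basis:
  "det3 u v (X *s u + Y *s v + Z *s w) = Z * det3 u v w"
  "det3 u (x *s u + y *s v + z *s w) (X *s u + Y *s v + Z *s w) = (y * Z - z * Y) * det3 u v w"
  "det3 v (x *s u + y *s v + z *s w) (X *s u + Y *s v + Z *s w) = (z * X - x * Z) * det3 u v w"
  "det3 w (x *s u + y *s v + z *s w) (X *s u + Y *s v + Z *s w) = (x * Y - y * X) * det3 u v w"
  "det3 (x *s u + y *s v + z *s w) (X *s u + Y *s v + Z *s w) w = (x * Y - y * X) * det3 u v w"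
  "det3 u (x *s u + y *s v + z *s w) w = y * det3 u v w"
  "det3 v (x *s u + y *s v + z *s w) w = - x * det3 u v w"
  by (simp_all add: det3_def algebra_simps)

lemma conic_thru_coords:
  assumes P: "P 1 = u" "P 2 = v" "P 3 = x3 *s u + y3 *s v + z3 *s w" "P 4 = x4 *s u + y4 *s v + z4 *s w"
  defines "d \<equiv> x3 * y4 - y3 * x4"
  shows "conic_thru P w (X *s u + Y *s v + Z *s w) = det3 u v w ^ 4 *
     (Z * ((- y3 * x4 * (y3 * z4 - z3 * y4) - d * y3 * z4) * X
         + (y3 * x4 * (x3 * z4 - z3 * x4) - d * z3 * x4) * Y) + d * z3 * z4 * X * Y)"
  unfolding conic_thru_def conic0_def conic1_def P det3_basis det3_comb d_def
  by (simp add: algebra_simps power4_eq_xxxx)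

lemma conic_thru_base [simp]: "conic_thru P a (P 1) = 0" "conic_thru P a (P 2) = 0" "conic_thru P a (P 3) = 0" "conic_thru P a (P 4) = 0" "conic_thru P a a = 0"
  by (simp_all add: conic_thru_def conic0_def conic1_def)

text \<open>With all three basis points on the cubic no cubes occur. As w is the third basis vector,
  \<open>polar2\<close> is the derivative in Z and \<open>polar1\<close> half of the second
  derivative.\<close>

lemma cubic_coords_node:
  assumes F: "is_cubic F" "F u = 0" "F v = 0" "F w = 0"
  obtains T B C where "binary_form 1 T" "binary_form 2 B" "binary_form 3 C"
    "\<And>X Y Z. F (X *s u + Y *s v + Z *s w) = Z^2 * T X Y + Z * B X Y + C X Y"
    "\<And>X Y Z. polar1 F w (X *s u + Y *s v + Z *s w) = T X Y"
    "\<And>X Y Z. polar2 F w (X *s u + Y *s v + Z *s w) = B X Y + 2 * Z * T X Y"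
proof -
  from is_cubic_coords[OF F(1), of u v w] obtain c1 c2 c3 c4 c5 c6 c7 c8 c9 c10 where
    1: "\<And>X Y Z. F (X *s u + Y *s v + Z *s w) =
     c1 * X^3 + c2 * Y^3 + c3 * Z^3 + c4 * X^2 * Y + c5 * X^2 * Z + c6 * X * Y^2
     + c7 * Y^2 * Z + c8 * X * Z^2 + c9 * Y * Z^2 + c10 * X * Y * Z"
    by (rule ternary_cubicE) (rule that)
  have c: "c1 = 0" "c2 = 0" "c3 = 0" using 1[of 1 0 0] 1[of 0 1 0] 1[of 0 0 1] F(2-) by simp_all
  define T where "T = (\<lambda>X Y. c8 * X + c9 * Y)"
  define B where "B = (\<lambda>X Y. X * (c5 * X + c10 * Y) + Y * (0 * X + c7 * Y))"
  define C where "C = (\<lambda>X Y. X * (Y * (c4 * X + c6 * Y)))"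
  have T: "binary_form 1 T" unfolding T_def by (rule binary_form_linear)
  have B: "binary_form 2 B" unfolding B_def using binary_form_Suc[OF binary_form_linear[of c5 c10] binary_form_linear[of 0 c7]] by (simp add: numeral_2_eq_2)
  have C: "binary_form 3 C" unfolding C_def using binary_form_X[OF binary_form_Y[OF binary_form_linear[of c4 c6]]] by (simp add: numeral_3_eq_3)
  have F1: "F (X *s u + Y *s v + Z *s w) = Z^2 * T X Y + Z * B X Y + C X Y" for X Y Z
    unfolding 1 c T_def B_def C_def by algebra
  have p: "w + (X *s u + Y *s v + Z *s w) = X *s u + Y *s v + (1 + Z) *s w"
    and m: "w - (X *s u + Y *s v + Z *s w) = (- X) *s u + (- Y) *s v + (1 - Z) *s w" for X Y Z
    by (simp_all add: vec_eq_iff algebra_simps)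
  have neg: "T (- X) (- Y) = - T X Y" "B (- X) (- Y) = B X Y" "C (- X) (- Y) = - C X Y" for X Y
    unfolding T_def B_def C_def by algebra+
  show ?thesis
  proof (rule that[OF T B C F1])
    fix X Y Z
    show "polar1 F w (X *s u + Y *s v + Z *s w) = T X Y"
      unfolding polar1_def p m F1 neg by (simp add: field_simps power2_eq_square)
    show "polar2 F w (X *s u + Y *s v + Z *s w) = B X Y + 2 * Z * T X Y"
      unfolding polar2_def p m F1 neg by (simp add: field_simps power2_eq_square)
  qed
qed

text \<open>Cubics with a double point at a that pass through P 1, ..., P 4 are linear forms in the cubic map. The right hand
side is a quintic form in x that is divisible by the equations of the lines a b and a pj; the quotient is such a cubic.\<close>
lemma cubic_map_chord_map:
  assumes F0: "is_cubic F0" and F1: "is_cubic F1"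
    and z: "\<And>x. x \<in> {P 1, P 2, P 3, P 4, a, b, pj} \<Longrightarrow> F0 x = 0 \<and> F1 x = 0"
    and nz: "det3 (P 1) (P 2) a \<noteq> 0" "det3 (P 1) (P 2) (P 3) \<noteq> 0" "det3 (P 1) (P 2) (P 4) \<noteq> 0"
      "det3 (P 3) (P 4) a \<noteq> 0" "det3 a b pj \<noteq> 0"
      "\<And>k. k \<in> {1, 2, 3, 4} \<Longrightarrow> det3 a b (P k) \<noteq> 0 \<and> det3 a pj (P k) \<noteq> 0"
  obtains m1 m2 m3 where "\<And>x. det3 a b x * det3 a pj x * (m1 * cubic_map P a x $ 1 + m2 * cubic_map P a x $ 2 + m3 * cubic_map P a x $ 3)
      = det3 b pj (chord_map F0 F1 a x)"
proof -
  define u v D where uvD: "u = P 1" "v = P 2" "D = det3 (P 1) (P 2) a"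
  have D: "D \<noteq> 0" "det3 u v a = D" using nz(1) uvD by simp_all
  have co: "\<exists>X Y Z. x = X *s u + Y *s v + Z *s a" for x
    using det3_coords[of u v a x] D by blast
  obtain x3 y3 z3 where p3: "P 3 = x3 *s u + y3 *s v + z3 *s a" using co by blast
  obtain x4 y4 z4 where p4: "P 4 = x4 *s u + y4 *s v + z4 *s a" using co by blast
  obtain xj yj zj where pj: "pj = xj *s u + yj *s v + zj *s a" using co by blast
  obtain xb yb zb where polar2': "b = xb *s u + yb *s v + zb *s a" using co by blast
  have uv: "u = 1 *s u + 0 *s v + 0 *s a" "v = 0 *s u + 1 *s v + 0 *s a" by simp_all
  have n: "z3 \<noteq> 0" "z4 \<noteq> 0" "x3 * y4 - y3 * x4 \<noteq> 0" "xb * yj - yb * xj \<noteq> 0"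
    using nz(2-5) D unfolding p3 p4 pj polar2' uvD(1,2)[symmetric] det3_basis by simp_all
  obtain T0 B0 C0 where f0: "binary_form 1 T0" "binary_form 2 B0" "binary_form 3 C0"
    "\<And>X Y Z. F0 (X *s u + Y *s v + Z *s a) = Z^2 * T0 X Y + Z * B0 X Y + C0 X Y"
    "\<And>X Y Z. polar1 F0 a (X *s u + Y *s v + Z *s a) = T0 X Y"
    "\<And>X Y Z. polar2 F0 a (X *s u + Y *s v + Z *s a) = B0 X Y + 2 * Z * T0 X Y"
    by (rule cubic_coords_node[OF F0, of u v a]) (use z uvD in \<open>auto intro: that\<close>)
  obtain T1 B1 C1 where f1: "binary_form 1 T1" "binary_form 2 B1" "binary_form 3 C1"
    "\<And>X Y Z. F1 (X *s u + Y *s v + Z *s a) = Z^2 * T1 X Y + Z * B1 X Y + C1 X Y"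
    "\<And>X Y Z. polar1 F1 a (X *s u + Y *s v + Z *s a) = T1 X Y"
    "\<And>X Y Z. polar2 F1 a (X *s u + Y *s v + Z *s a) = B1 X Y + 2 * Z * T1 X Y"
    by (rule cubic_coords_node[OF F1, of u v a]) (use z uvD in \<open>auto intro: that\<close>)
  define f where "f = (\<lambda>X Y Z. F0 (X *s u + Y *s v + Z *s a))"
  define g where "g = (\<lambda>X Y Z. F1 (X *s u + Y *s v + Z *s a))"
  define l1 l2 l3 where l: "l1 = yb * zj - zb * yj" "l2 = zb * xj - xb * zj" "l3 = xb * yj - yb * xj"
  have fz: "f 1 0 0 = 0 \<and> g 1 0 0 = 0" "f 0 1 0 = 0 \<and> g 0 1 0 = 0" "f x3 y3 z3 = 0 \<and> g x3 y3 z3 = 0"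
    "f x4 y4 z4 = 0 \<and> g x4 y4 z4 = 0" "f xj yj zj = 0 \<and> g xj yj zj = 0" "f xb yb zb = 0 \<and> g xb yb zb = 0"
    unfolding f_def g_def p3[symmetric] p4[symmetric] pj[symmetric] polar2'[symmetric] uv[symmetric]
    by (rule z, simp add: uvD)+
  obtain q c where q: "binary_form 2 q" and c: "binary_form 3 c"
    and qc: "\<And>X Y Z. (xb * Y - yb * X) * (xj * Y - yj * X) * (Z * q X Y + c X Y)
       = l3 * (f X Y Z * (B1 X Y + 2 * Z * T1 X Y) - g X Y Z * (B0 X Y + 2 * Z * T0 X Y))
         - (T1 X Y * f X Y Z - T0 X Y * g X Y Z) * (l1 * X + l2 * Y + l3 * Z)"
  proof (rule node_cubic_divide[OF f0(1) f1(1) f0(2) f1(2) f0(3) f1(3), of f g xb yb zb xj yj zj l1 l2 l3])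
    show "f X Y Z = Z^2 * T0 X Y + Z * B0 X Y + C0 X Y" "g X Y Z = Z^2 * T1 X Y + Z * B1 X Y + C1 X Y" for X Y Z
      by (simp_all only: f_def g_def f0 f1)
    show "l1 * xb + l2 * yb + l3 * zb = 0" "l1 * xj + l2 * yj + l3 * zj = 0" unfolding l by algebra+
  qed (use fz n that in blast)+
  have zero: "Z * q X Y + c X Y = 0" if "f X Y Z = 0 \<and> g X Y Z = 0" "xb * Y - yb * X \<noteq> 0" "xj * Y - yj * X \<noteq> 0" for X Y Z
    using qc[of Y X Z] that by simp
  \<comment> \<open>\<open>zero\<close> needs both line factors to be nonzero, which the position of
    b and pj relative to P 1, ..., P 4 grants.\<close>
  have nk: "xb * Y - yb * X \<noteq> 0 \<and> xj * Y - yj * X \<noteq> 0" if "X *s u + Y *s v + Z *s a \<in> {P 1, P 2, P 3, P 4}" for X Y Z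
  proof -
    have "det3 a b (X *s u + Y *s v + Z *s a) \<noteq> 0 \<and> det3 a pj (X *s u + Y *s v + Z *s a) \<noteq> 0"
      using that nz(6) by auto
    then show ?thesis unfolding pj polar2' det3_basis by auto
  qed
  define d where "d = x3 * y4 - y3 * x4"
  define k1 k2 k3 where k: "k1 = D ^ 4 * (- y3 * x4 * (y3 * z4 - z3 * y4) - d * y3 * z4)"
     "k2 = D ^ 4 * (y3 * x4 * (x3 * z4 - z3 * x4) - d * z3 * x4)" "k3 = D ^ 4 * (d * z3 * z4)"
  define K where "K = (\<lambda>X Y Z. conic_thru P a (X *s u + Y *s v + Z *s a))"
  have K: "K X Y Z = Z * (k1 * X + k2 * Y) + k3 * X * Y" for X Y Z
    unfolding K_def conic_thru_coords[of P, OF uvD(1,2)[symmetric] p3 p4] k d_def D(2) by (simp add: algebra_simps)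
  obtain m1 m2 m3 where m: "\<And>X Y Z. Z * q X Y + c X Y = m1 * ((x3 * Y - y3 * X) * K X Y Z)
     + m2 * ((x4 * Y - y4 * X) * K X Y Z) + m3 * (Z * (x3 * Y - y3 * X) * (x4 * Y - y4 * X))"
  proof (rule node_cubic_span[OF q c _ _ _ _ K])
    show "c 1 0 = 0" using zero[of 1 0 0] nk[of 1 0 0] fz uvD by simp
    show "c 0 1 = 0" using zero[of 0 1 0] nk[of 0 1 0] fz uvD by simp
    show "z3 * q x3 y3 + c x3 y3 = 0" using zero[of x3 y3 z3] nk[of x3 y3 z3] fz p3 by simp
    show "z4 * q x4 y4 + c x4 y4 = 0" using zero[of x4 y4 z4] nk[of x4 y4 z4] fz p4 by simp
    show "k3 \<noteq> 0" using n D by (simp add: k d_def)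
    show "K x3 y3 z3 = 0" "K x4 y4 z4 = 0" unfolding K_def p3[symmetric] p4[symmetric] by simp_all
  qed (use n that in auto)
  show ?thesis
  \<comment> \<open>The components of \<open>cubic_map\<close> carry factors D, D, D^3, the two
    brackets one D each, and the right-hand side one D.\<close>
  proof (rule that[of "m1 / D ^ 2" "m2 / D ^ 2" "m3 / D ^ 4"])
    fix x
    obtain X Y Z where x: "x = X *s u + Y *s v + Z *s a" using co by blast
    define E where "E = F0 x * polar2 F1 a x - F1 x * polar2 F0 a x"
    define S where "S = polar1 F1 a x * F0 x - polar1 F0 a x * F1 x"
    have J: "chord_map F0 F1 a x = (- S * X) *s u + (- S * Y) *s v + (E - S * Z) *s a"
      unfolding chord_map_def E_def[symmetric] S_def[symmetric] unfolding x by (simp add: vec_eq_iff algebra_simps)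
    have R: "cubic_map P a x $ 1 = D * ((x3 * Y - y3 * X) * K X Y Z)" "cubic_map P a x $ 2 = D * ((x4 * Y - y4 * X) * K X Y Z)"
       "cubic_map P a x $ 3 = D ^ 3 * (Z * (x3 * Y - y3 * X) * (x4 * Y - y4 * X))"
      unfolding cubic_map_def x K_def p3 p4 uvD(1,2)[symmetric] det3_basis D(2)
      by (simp_all add: power3_eq_cube)
    have "det3 b pj (chord_map F0 F1 a x) = D * (l3 * E - S * (l1 * X + l2 * Y + l3 * Z))"
      unfolding J pj polar2' det3_comb D(2) l by (simp add: algebra_simps)
    also have "\<dots> = D * ((xb * Y - yb * X) * (xj * Y - yj * X) * (Z * q X Y + c X Y))"
      unfolding qc E_def S_def unfolding x f0(5,6) f1(5,6) f_def g_def by simp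
    also have "\<dots> = (D * (xb * Y - yb * X)) * (D * (xj * Y - yj * X)) * (m1 / D ^ 2 * (D * ((x3 * Y - y3 * X) * K X Y Z)) + m2 / D ^ 2 * (D * ((x4 * Y - y4 * X) * K X Y Z))
       + m3 / D ^ 4 * (D ^ 3 * (Z * (x3 * Y - y3 * X) * (x4 * Y - y4 * X))))"
      unfolding m using D(1) by (simp add: field_simps power2_eq_square power3_eq_cube power4_eq_xxxx)
    also have "\<dots> = det3 a b x * det3 a pj x * (m1 / D ^ 2 * cubic_map P a x $ 1 + m2 / D ^ 2 * cubic_map P a x $ 2 + m3 / D ^ 4 * cubic_map P a x $ 3)"
      unfolding R unfolding x pj polar2' det3_basis D(2) by (simp add: mult_ac)
    finally show "det3 a b x * det3 a pj x * (m1 / D ^ 2 * cubic_map P a x $ 1 + m2 / D ^ 2 * cubic_map P a x $ 2 + m3 / D ^ 4 * cubic_map P a x $ 3)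
      = det3 b pj (chord_map F0 F1 a x)" by simp
  qed
qed

section \<open>The transformations through the eighth point\<close>

text \<open>Inverses of the barycentric coordinates, multiplied by the product of the three brackets
  to clear denominators.\<close>

definition cremona128 :: "cfg \<Rightarrow> cfg" where
  "cremona128 P m = (if m = 1 then vector [1, 0, 0] else if m = 2 then vector [0, 1, 0] else if m = 8 then vector [0, 0, 1]
     else vector [det3 (P 1) (P m) (P 8) * det3 (P 1) (P 2) (P m),
                  det3 (P m) (P 2) (P 8) * det3 (P 1) (P 2) (P m),
                  det3 (P m) (P 2) (P 8) * det3 (P 1) (P m) (P 8)])"

text \<open>A point of the plane that cubic_map sends to the m-th point: for m = 1, ..., 4 this is any point
of the line through P 8 that is contracted to it, and x8 is to lie on the conic contracted to the eighth point.\<close>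
definition xhat :: "cfg \<Rightarrow> pt \<Rightarrow> nat \<Rightarrow> pt" where
  "xhat P x8 m = (if m = 1 then P 2 + P 8 else if m = 2 then P 1 + P 8 else if m = 3 then P 4 + P 8
     else if m = 4 then P 3 + P 8 else if m = 8 then x8 else P m)"

definition cremona348 :: "cfg \<Rightarrow> pt \<Rightarrow> cfg" where
  "cremona348 P x8 m = cubic_map P (P 8) (xhat P x8 m)"

lemma det3_explicit:
  "det3 x (vector [0, 1, 0]) (vector [0, 0, 1]) = x $ 1"
  "det3 (vector [1, 0, 0]) x (vector [0, 0, 1]) = x $ 2"
  "det3 (vector [1, 0, 0]) (vector [0, 1, 0]) x = x $ 3"
  by (simp_all add: det3_def)

lemma indices_10: "{1..10::nat} = {1, 2, 3, 4, 5, 6, 7, 8, 9, 10}"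
  by (simp add: atLeastAtMost_upt set_upt[symmetric] upt_rec del: set_upt) auto

lemma quad_related_cremona128:
  assumes D: "det3 (P 1) (P 2) (P 8) \<noteq> 0"
    and nz: "\<And>m. m \<in> {3, 4, 5, 6, 7, 9, 10} \<Longrightarrow>
      det3 (P 1) (P 2) (P m) \<noteq> 0 \<and> det3 (P m) (P 2) (P 8) \<noteq> 0 \<and> det3 (P 1) (P m) (P 8) \<noteq> 0"
  shows "quad_related 1 2 8 P (cremona128 P)"
proof -
  have e: "cremona128 P 1 = vector [1, 0, 0]" "cremona128 P 2 = vector [0, 1, 0]" "cremona128 P 8 = vector [0, 0, 1]"
    by (simp_all add: cremona128_def)
  have "\<exists>s. s \<noteq> 0 \<and>
          det3 (P m) (P 2) (P 8) * det3 (cremona128 P m) (cremona128 P 2) (cremona128 P 8) = s * 1 \<and>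
          det3 (P 1) (P m) (P 8) * det3 (cremona128 P 1) (cremona128 P m) (cremona128 P 8) = s * 1 \<and>
          det3 (P 1) (P 2) (P m) * det3 (cremona128 P 1) (cremona128 P 2) (cremona128 P m) = s * 1"
    if m: "m \<in> {1..10} - {1, 2, 8}" for m
  proof -
    have m': "m \<in> {3, 4, 5, 6, 7, 9, 10}" using m unfolding indices_10 by auto
    then have "cremona128 P m = vector [det3 (P 1) (P m) (P 8) * det3 (P 1) (P 2) (P m),
                  det3 (P m) (P 2) (P 8) * det3 (P 1) (P 2) (P m),
                  det3 (P m) (P 2) (P 8) * det3 (P 1) (P m) (P 8)]"
      by (auto simp: cremona128_def)
    then show ?thesis unfolding e det3_explicit
      by (intro exI[of _ "det3 (P m) (P 2) (P 8) * det3 (P 1) (P m) (P 8) * det3 (P 1) (P 2) (P m)"])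
        (use nz[OF m'] in simp)
  qed
  moreover have "det3 (cremona128 P 1) (cremona128 P 2) (cremona128 P 8) \<noteq> 0" unfolding e by (simp add: det3_def)
  ultimately show ?thesis
    using D by (intro quad_relatedI[of _ _ _ _ _ 1 1 1]) simp_all
qed

text \<open>The brackets of \<open>cremona128 P m\<close> in the triangle 3, 4, 8 are, up to
  constants, Z l4, Z l3 and K, where Z is the line P 1 P 2, l3 and l4 are the lines from P 8 to P 3
  and P 4, and K is the conic. Against the components l3 K, l4 K, Z l3 l4 of
  \<open>cubic_map\<close>, all three products are constant multiples of Z l3 l4 K.\<close>

lemma quad_related_cremona348:
  assumes gp: "\<And>i j k. i \<in> {1, 2, 3, 4, 8} \<Longrightarrow> j \<in> {1, 2, 3, 4, 8} \<Longrightarrow> k \<in> {1, 2, 3, 4, 8} \<Longrightarrow> i \<noteq> j \<Longrightarrow> j \<noteq> k \<Longrightarrow> i \<noteq> k \<Longrightarrow> det3 (P i) (P j) (P k) \<noteq> 0"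
    and nz: "\<And>m. m \<in> {5, 6, 7, 9, 10} \<Longrightarrow>
      det3 (P 1) (P 2) (P m) \<noteq> 0 \<and> det3 (P 3) (P m) (P 8) \<noteq> 0 \<and> det3 (P 4) (P m) (P 8) \<noteq> 0 \<and> conic_thru P (P 8) (P m) \<noteq> 0"
    and x8: "conic_thru P (P 8) x8 = 0" "det3 (P 1) (P 2) x8 \<noteq> 0" "det3 (P 3) x8 (P 8) \<noteq> 0" "det3 (P 4) x8 (P 8) \<noteq> 0"
  shows "quad_related 3 4 8 (cremona128 P) (cremona348 P x8)"
proof -
  define u v a D where uvD: "u = P 1" "v = P 2" "a = P 8" "D = det3 (P 1) (P 2) (P 8)"
  have D: "D \<noteq> 0" "det3 u v a = D" using gp[of 1 2 8] uvD by simp_all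
  have co: "\<exists>X Y Z. x = X *s u + Y *s v + Z *s a" for x
    using det3_coords[of u v a x] D by blast
  obtain x3 y3 z3 where p3: "P 3 = x3 *s u + y3 *s v + z3 *s a" using co by blast
  obtain x4 y4 z4 where p4: "P 4 = x4 *s u + y4 *s v + z4 *s a" using co by blast
  define d where "d = x3 * y4 - y3 * x4"
  note uvD' = uvD(1,2,3)[symmetric]
  have dp: "det3 (X *s u + Y *s v + Z *s a) v a = X * D" "det3 u (X *s u + Y *s v + Z *s a) a = Y * D"
    "det3 u v (X *s u + Y *s v + Z *s a) = Z * D" for X Y Z
    using D(2) by (simp_all add: det3_add det3_smult)
  have n: "x3 \<noteq> 0" "y3 \<noteq> 0" "z3 \<noteq> 0" "x4 \<noteq> 0" "y4 \<noteq> 0" "z4 \<noteq> 0" "d \<noteq> 0" "y3 * z4 - z3 * y4 \<noteq> 0" "z3 * x4 - x3 * z4 \<noteq> 0"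
    using gp[of 3 2 8] gp[of 1 3 8] gp[of 1 2 3] gp[of 4 2 8] gp[of 1 4 8] gp[of 1 2 4] gp[of 3 4 8] gp[of 1 3 4] gp[of 2 3 4]
    unfolding p3 p4 uvD' dp det3_basis D(2) d_def by simp_all
  define k1 k2 where k: "k1 = y3 * y4 * (z3 * x4 - x3 * z4)" "k2 = x3 * x4 * (y3 * z4 - z3 * y4)"
  have K: "conic_thru P a (X *s u + Y *s v + Z *s a) = D ^ 4 * (Z * (k1 * X + k2 * Y) + d * z3 * z4 * X * Y)" for X Y Z
    unfolding conic_thru_coords[of P, OF uvD(1,2)[symmetric] p3 p4] D(2) k d_def by (simp add: algebra_simps)
  have R: "cubic_map P a (X *s u + Y *s v + Z *s a) = vector [D * (x3 * Y - y3 * X) * (D ^ 4 * (Z * (k1 * X + k2 * Y) + d * z3 * z4 * X * Y)),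
     D * (x4 * Y - y4 * X) * (D ^ 4 * (Z * (k1 * X + k2 * Y) + d * z3 * z4 * X * Y)), D ^ 3 * Z * (x3 * Y - y3 * X) * (x4 * Y - y4 * X)]" for X Y Z
    unfolding cubic_map_def K p3 p4 uvD' det3_basis D(2) by (simp add: vec_eq_iff forall_3 power3_eq_cube)
  have C: "cremona128 P m = vector [D\<^sup>2 * Y * Z, D\<^sup>2 * X * Z, D\<^sup>2 * X * Y]"
    if "P m = X *s u + Y *s v + Z *s a" "m \<in> {3, 4, 5, 6, 7, 9, 10}" for m X Y Z
  proof -
    have "m \<noteq> 1" "m \<noteq> 2" "m \<noteq> 8" using that(2) by auto
    then show ?thesis using that(1) unfolding cremona128_def uvD' by (simp add: dp power2_eq_square mult_ac)
  qed
  note C3 = C[OF p3, simplified] and C4 = C[OF p4, simplified]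
  have C8: "cremona128 P 8 = vector [0, 0, 1]" by (simp add: cremona128_def)
  \<comment> \<open>The lines from P 8 to P 4 and to P 3 and the conic are contracted to the three
    coordinate points; r3, r4, r8 are the scalars at the chosen points of these curves.\<close>
  define r3 where "r3 = - (D ^ 5 * d * (x4 * y4 * z3 * d))"
  define r4 where "r4 = D ^ 5 * d * (x3 * y3 * z4 * d)"
  obtain X8 Y8 Z8 where x8c: "x8 = X8 *s u + Y8 *s v + Z8 *s a" using co by blast
  define r8 where "r8 = D ^ 3 * Z8 * (x3 * Y8 - y3 * X8) * (x4 * Y8 - y4 * X8)"
  have E3: "cremona348 P x8 3 = vector [r3, 0, 0]"
  proof -
    have "cremona348 P x8 3 = cubic_map P a (x4 *s u + y4 *s v + (z4 + 1) *s a)"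
      by (simp add: cremona348_def xhat_def p4 uvD' vector_sadd_rdistrib add.assoc)
    also have "\<dots> = vector [r3, 0, 0]"
      unfolding R by (simp add: vec_eq_iff forall_3 r3_def k d_def eval_nat_numeral) (simp add: algebra_simps)?
    finally show ?thesis .
  qed
  have E4: "cremona348 P x8 4 = vector [0, r4, 0]"
  proof -
    have "cremona348 P x8 4 = cubic_map P a (x3 *s u + y3 *s v + (z3 + 1) *s a)"
      by (simp add: cremona348_def xhat_def p3 uvD' vector_sadd_rdistrib add.assoc)
    also have "\<dots> = vector [0, r4, 0]"
      unfolding R by (simp add: vec_eq_iff forall_3 r4_def k d_def eval_nat_numeral) (simp add: algebra_simps)?
    finally show ?thesis .
  qed
  have E8: "cremona348 P x8 8 = vector [0, 0, r8]"
  proof -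
    have "D ^ 4 * (Z8 * (k1 * X8 + k2 * Y8) + d * z3 * z4 * X8 * Y8) = 0"
      using x8(1) unfolding x8c uvD' K .
    moreover have "cremona348 P x8 8 = cubic_map P a x8" by (simp add: cremona348_def xhat_def uvD')
    ultimately show ?thesis
      unfolding x8c R r8_def by (simp only: mult_zero_right)
  qed
  have r: "r3 \<noteq> 0" "r4 \<noteq> 0" "r8 \<noteq> 0"
  proof -
    show "r3 \<noteq> 0" "r4 \<noteq> 0" using n D by (simp_all add: r3_def r4_def)
    show "r8 \<noteq> 0" using x8(2-4) D unfolding x8c uvD' p3 p4 det3_basis dp r8_def D(2) by simp
  qed
  have dets: "det3 x (vector [0, r4, 0]) (vector [0, 0, r8]) = x $ 1 * (r4 * r8)"
    "det3 (vector [r3, 0, 0]) x (vector [0, 0, r8]) = x $ 2 * (r3 * r8)"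
    "det3 (vector [r3, 0, 0]) (vector [0, r4, 0]) x = x $ 3 * (r3 * r4)" for x
    by (simp_all add: det3_def)
  \<comment> \<open>The constants that remain once the common factor is taken out of the three
    products.\<close>
  define d1 d2 d3 where dd: "d1 = D ^ 3 * z4 * r4 * r8" "d2 = - (D ^ 3 * z3 * r3 * r8)" "d3 = - (D ^ 3 * r3 * r4)"
  have "\<exists>s. s \<noteq> 0 \<and>
          det3 (cremona128 P m) (cremona128 P 4) (cremona128 P 8) * det3 (cremona348 P x8 m) (cremona348 P x8 4) (cremona348 P x8 8) = s * d1 \<and>
          det3 (cremona128 P 3) (cremona128 P m) (cremona128 P 8) * det3 (cremona348 P x8 3) (cremona348 P x8 m) (cremona348 P x8 8) = s * d2 \<and>
          det3 (cremona128 P 3) (cremona128 P 4) (cremona128 P m) * det3 (cremona348 P x8 3) (cremona348 P x8 4) (cremona348 P x8 m) = s * d3"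
    if m: "m \<in> {1..10} - {3, 4, 8}" for m
  proof -
    consider "m = 1" | "m = 2" | "m \<in> {5, 6, 7, 9, 10}" using m unfolding indices_10 by blast
    then show ?thesis
    proof cases
      \<comment> \<open>Points 1 and 2 of \<open>cremona128 P\<close> are coordinate points and not
        values of the bracket formula, so they are compared separately with the images of the
        contracted lines.\<close>
      case 1
      have "cremona348 P x8 1 = cubic_map P a (0 *s u + 1 *s v + 1 *s a)" by (simp add: cremona348_def xhat_def uvD' del: One_nat_def)
      then have R1: "cremona348 P x8 1 = vector [D ^ 5 * x3 * k2, D ^ 5 * x4 * k2, D ^ 3 * x3 * x4]"
        unfolding R by (simp add: vec_eq_iff forall_3 eval_nat_numeral)
      have c: "cremona128 P 1 = vector [1, 0, 0]" by (simp add: cremona128_def)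
      show ?thesis unfolding 1 E3 E4 E8 dets C3 C4 C8 R1 c
        by (rule exI[of _ "D ^ 4 * x3 * x4 * k2"]) (use n D in \<open>simp add: det3_def dd k eval_nat_numeral, simp add: algebra_simps\<close>)
    next
      case 2
      have "cremona348 P x8 2 = cubic_map P a (1 *s u + 0 *s v + 1 *s a)" by (simp add: cremona348_def xhat_def uvD' del: One_nat_def)
      then have R1: "cremona348 P x8 2 = vector [- (D ^ 5 * y3 * k1), - (D ^ 5 * y4 * k1), D ^ 3 * y3 * y4]"
        unfolding R by (simp add: vec_eq_iff forall_3 eval_nat_numeral)
      have c: "cremona128 P 2 = vector [0, 1, 0]" by (simp add: cremona128_def)
      show ?thesis unfolding 2 E3 E4 E8 dets C3 C4 C8 R1 c
        by (rule exI[of _ "D ^ 4 * y3 * y4 * k1"]) (use n D in \<open>simp add: det3_def dd k eval_nat_numeral, simp add: algebra_simps\<close>)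
    next
      case 3
      obtain X Y Z where p: "P m = X *s u + Y *s v + Z *s a" using co by blast
      define KK where "KK = D ^ 4 * (Z * (k1 * X + k2 * Y) + d * z3 * z4 * X * Y)"
      have R1: "cremona348 P x8 m = vector [D * (x3 * Y - y3 * X) * KK, D * (x4 * Y - y4 * X) * KK, D ^ 3 * Z * (x3 * Y - y3 * X) * (x4 * Y - y4 * X)]"
        using 3 unfolding cremona348_def uvD' by (auto simp: xhat_def p R KK_def)
      have c: "cremona128 P m = vector [D\<^sup>2 * Y * Z, D\<^sup>2 * X * Z, D\<^sup>2 * X * Y]" by (rule C[OF p]) (use 3 in auto)
      have nz': "Z \<noteq> 0" "x3 * Y - y3 * X \<noteq> 0" "x4 * Y - y4 * X \<noteq> 0" "KK \<noteq> 0"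
        using nz[OF 3] D unfolding p uvD' p3 p4 det3_basis dp K D(2) KK_def by simp_all
      have A: "det3 (cremona128 P m) (cremona128 P 4) (cremona128 P 8) = D ^ 4 * Z * z4 * (x4 * Y - y4 * X)"
          "det3 (cremona128 P 3) (cremona128 P m) (cremona128 P 8) = - (D ^ 4 * Z * z3 * (x3 * Y - y3 * X))"
          "det3 (cremona128 P 3) (cremona128 P 4) (cremona128 P m) = - (D ^ 2 * KK)"
        unfolding c C3 C4 C8 KK_def det3_def k d_def
        by (simp_all add: eval_nat_numeral) (simp_all add: algebra_simps)
      show ?thesis unfolding A unfolding E3 E4 E8 dets R1
        by (rule exI[of _ "D ^ 2 * Z * (x3 * Y - y3 * X) * (x4 * Y - y4 * X) * KK"])
           (use nz' D in \<open>simp add: dd eval_nat_numeral\<close>)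
    qed
  qed
  moreover have "det3 (cremona128 P 3) (cremona128 P 4) (cremona128 P 8) \<noteq> 0"
    using n D unfolding C3 C4 C8 det3_def d_def by (simp add: algebra_simps)
  moreover have "det3 (cremona348 P x8 3) (cremona348 P x8 4) (cremona348 P x8 8) \<noteq> 0"
    unfolding E3 E4 E8 dets using r by simp
  moreover have "d1 \<noteq> 0" "d2 \<noteq> 0" "d3 \<noteq> 0" using n D r by (simp_all add: dd)
  ultimately show ?thesis
    by (intro quad_relatedI[of _ _ _ _ _ d1 d2 d3])
qed

section \<open>Both halves of the translation\<close>

text \<open>One end of the translation, used twice: for P with partner b, and for the end
  configuration with the roles of P 8 and b exchanged. The pencil F0, F1 and the chord points y8,
  y9, y10 are common to both uses. Points 9 and 10 lie on different members of the pencil.\<close>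

locale cremona_half =
  fixes P :: cfg and b :: pt and F0 F1 :: "pt \<Rightarrow> complex" and x8 y8 y9 y10 :: pt
  assumes cub: "is_cubic F0" "is_cubic F1"
    and base: "\<And>i. i \<in> {1, 2, 3, 4, 5, 6, 7, 8} \<Longrightarrow> F0 (P i) = 0 \<and> F1 (P i) = 0"
    and baseb: "F0 b = 0" "F1 b = 0"
    and F9: "F0 (P 9) = 0" "F1 (P 9) \<noteq> 0" and F10: "F1 (P 10) = 0" "F0 (P 10) \<noteq> 0"
    and gp: "\<And>i j k. i \<in> {1, 2, 3, 4, 5, 6, 7, 8} \<Longrightarrow> j \<in> {1, 2, 3, 4, 5, 6, 7, 8} \<Longrightarrow> k \<in> {1, 2, 3, 4, 5, 6, 7, 8} \<Longrightarrow>
        i \<noteq> j \<Longrightarrow> j \<noteq> k \<Longrightarrow> i \<noteq> k \<Longrightarrow> det3 (P i) (P j) (P k) \<noteq> 0"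
    and gb: "\<And>i j. i \<in> {1, 2, 3, 4, 5, 6, 7, 8} \<Longrightarrow> j \<in> {1, 2, 3, 4, 5, 6, 7, 8} \<Longrightarrow> i \<noteq> j \<Longrightarrow> det3 b (P i) (P j) \<noteq> 0"
    and g9: "\<And>m. m \<in> {9, 10} \<Longrightarrow> det3 (P 1) (P 2) (P m) \<noteq> 0 \<and> (\<forall>i\<in>{1, 2, 3, 4}. det3 (P 8) (P i) (P m) \<noteq> 0)"
    and gK: "\<And>m. m \<in> {5, 6, 7, 9, 10} \<Longrightarrow> conic_thru P (P 8) (P m) \<noteq> 0"
    and gR: "det3 (cubic_map P (P 8) (P 5)) (cubic_map P (P 8) (P 6)) (cubic_map P (P 8) (P 7)) \<noteq> 0"
    and gA: "\<And>i. i \<in> {1, 2, 3, 4} \<Longrightarrow> polar1 F1 (P 8) (P i) * polar2 F0 (P 8) (P i) - polar1 F0 (P 8) (P i) * polar2 F1 (P 8) (P i) \<noteq> 0"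
    and x8: "F0 x8 = 0" "F1 x8 \<noteq> 0" "conic_thru P (P 8) x8 = 0" "det3 (P 1) (P 2) x8 \<noteq> 0"
       "det3 (P 3) x8 (P 8) \<noteq> 0" "det3 (P 4) x8 (P 8) \<noteq> 0"
    and y8: "\<exists>c. c \<noteq> 0 \<and> third F0 (P 8) x8 = c *s y8"
    and y9: "\<exists>c. c \<noteq> 0 \<and> third F0 (P 8) (P 9) = c *s y9"
    and y10: "\<exists>c. c \<noteq> 0 \<and> third F1 (P 8) (P 10) = c *s y10"
    and gy: "\<And>j y. j \<in> {5, 6, 7} \<Longrightarrow> y \<in> {y8, y9, y10} \<Longrightarrow> det3 (P 8) (P j) y \<noteq> 0 \<and> det3 b (P j) y \<noteq> 0"
begin

text \<open>Indices 1 and 2 trade places, as do 3 and 4: the line contracted to point 1 joins P 8 to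
  P 2, and members of the pencil meet it again in P 2. Neither P 8 nor b occurs here, so both halves
  have the same chord points.\<close>

definition chord_pt :: "nat \<Rightarrow> pt" where
  "chord_pt m = (if m = 1 then P 2 else if m = 2 then P 1 else if m = 3 then P 4 else if m = 4 then P 3
     else if m = 8 then y8 else if m = 9 then y9 else y10)"

lemma quad1: "quad_related 1 2 8 P (cremona128 P)"
proof (rule quad_related_cremona128)
  show "det3 (P 1) (P 2) (P 8) \<noteq> 0" by (rule gp) auto
  fix m :: nat assume "m \<in> {3, 4, 5, 6, 7, 9, 10}"
  then consider "m \<in> {3, 4, 5, 6, 7}" | "m \<in> {9, 10}" by auto
  then show "det3 (P 1) (P 2) (P m) \<noteq> 0 \<and> det3 (P m) (P 2) (P 8) \<noteq> 0 \<and> det3 (P 1) (P m) (P 8) \<noteq> 0"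
  proof cases
    case 1 then show ?thesis by (intro conjI gp) auto
  next
    case 2
    from g9[OF 2] have "det3 (P 1) (P 2) (P m) \<noteq> 0" "det3 (P 8) (P 2) (P m) \<noteq> 0" "det3 (P 8) (P 1) (P m) \<noteq> 0" by blast+
    then show ?thesis using det3_nz_perm by blast
  qed
qed

lemma quad2: "quad_related 3 4 8 (cremona128 P) (cremona348 P x8)"
proof (rule quad_related_cremona348)
  fix m :: nat assume m: "m \<in> {5, 6, 7, 9, 10}"
  then consider "m \<in> {5, 6, 7}" | "m \<in> {9, 10}" by auto
  then have "det3 (P 1) (P 2) (P m) \<noteq> 0 \<and> det3 (P 3) (P m) (P 8) \<noteq> 0 \<and> det3 (P 4) (P m) (P 8) \<noteq> 0"
  proof cases
    case 1 then show ?thesis by (intro conjI gp) auto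
  next
    case 2
    from g9[OF 2] have "det3 (P 1) (P 2) (P m) \<noteq> 0" "det3 (P 8) (P 3) (P m) \<noteq> 0" "det3 (P 8) (P 4) (P m) \<noteq> 0" by blast+
    then show ?thesis using det3_nz_perm by blast
  qed
  with gK[OF m] show "det3 (P 1) (P 2) (P m) \<noteq> 0 \<and> det3 (P 3) (P m) (P 8) \<noteq> 0 \<and> det3 (P 4) (P m) (P 8) \<noteq> 0
      \<and> conic_thru P (P 8) (P m) \<noteq> 0" by blast
qed (use gp x8 in auto)

text \<open>The member through P i + P 8 also has P 8 and P i on this line, so the chord point is P
  i. The scalar is, up to sign, the determinant of the coefficients of the two members on the line,
  nonzero by \<open>gA\<close>.\<close>

lemma chord_map_base:
  assumes i: "i \<in> {1, 2, 3, 4}"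
  shows "\<exists>s. s \<noteq> 0 \<and> chord_map F0 F1 (P 8) (P i + P 8) = s *s P i"
proof -
  define a where "a = P 8"
  define p where "p = P i"
  have z: "F0 a = 0" "F1 a = 0" "F0 p = 0" "F1 p = 0" using base[of 8] base[of i] i by (auto simp: a_def p_def)
  have vals: "F (p + a) = polar1 F a p + polar2 F a p \<and> polar1 F a (p + a) = polar1 F a p \<and> polar2 F a (p + a) = 2 * polar1 F a p + polar2 F a p"
    if F: "is_cubic F" "F a = 0" "F p = 0" for F
  proof -
    note L = line_expand[OF F]
    have 1: "F (p + a) = polar1 F a p + polar2 F a p" using L[of 1 1] by (simp add: add.commute)
    have "a + (p + a) = 2 *s a + 1 *s p" "a - (p + a) = 0 *s a + (-1) *s p"
      by (simp_all add: vec_eq_iff)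
    then have 2: "F (a + (p + a)) = 2 * (2 * polar1 F a p + polar2 F a p)" "F (a - (p + a)) = 0"
      by (simp_all only: L) simp_all
    have "polar1 F a (p + a) = polar1 F a p" "polar2 F a (p + a) = 2 * polar1 F a p + polar2 F a p"
      unfolding polar1_def[of F a "p + a"] polar2_def[of F a "p + a"] 2 1 by (simp_all add: field_simps)
    with 1 show ?thesis by blast
  qed
  define s where "s = - (polar1 F1 a p * polar2 F0 a p - polar1 F0 a p * polar2 F1 a p)"
  have "chord_map F0 F1 a (p + a) = s *s p"
    unfolding chord_map_def using vals[OF cub(1) z(1,3)] vals[OF cub(2) z(2,4)]
    by (simp add: s_def vec_eq_iff algebra_simps)
  moreover have "s \<noteq> 0" using gA[OF i] unfolding s_def a_def p_def by simp
  ultimately show ?thesis unfolding a_def p_def by blast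
qed

lemma chord_map_curve:
  "F0 x = 0 \<Longrightarrow> chord_map F0 F1 a x = (- F1 x) *s third F0 a x"
  "F1 x = 0 \<Longrightarrow> chord_map F0 F1 a x = F0 x *s third F1 a x"
  by (simp_all add: chord_map_def third_def vec_eq_iff algebra_simps)

text \<open>Turns the chord relation around: as y is not a multiple of a, the coefficient of x in it
  is nonzero and can be divided by.\<close>

lemma third_decomp:
  assumes "c \<noteq> 0" "third F a x = c *s y" "det3 a p y \<noteq> 0"
  shows "\<exists>e r. r \<noteq> 0 \<and> x = e *s a + r *s y"
proof -
  have e: "polar2 F a x *s a - polar1 F a x *s x = c *s y" using assms(2) by (simp add: third_def)
  have "polar1 F a x \<noteq> 0"
  proof
    assume "polar1 F a x = 0"
    then have "polar2 F a x *s a = c *s y" using e by simp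
    then have "det3 a p (c *s y) = 0" by (simp flip: \<open>polar2 F a x *s a = c *s y\<close> add: det3_smult)
    then show False using assms by (simp add: det3_smult)
  qed
  moreover have "polar1 F a x *s x = polar2 F a x *s a - c *s y" using e by (simp add: algebra_simps)
  ultimately have "x = (polar2 F a x / polar1 F a x) *s a + (- c / polar1 F a x) *s y"
    by (simp add: vec_eq_iff field_simps)
  moreover have "- c / polar1 F a x \<noteq> 0" using assms(1) \<open>polar1 F a x \<noteq> 0\<close> by simp
  ultimately show ?thesis by blast
qed

lemma xhat_chord_pt:
  assumes m: "m \<in> {1, 2, 3, 4, 8, 9, 10}"
  shows "\<exists>s r e. s \<noteq> 0 \<and> r \<noteq> 0 \<and> chord_map F0 F1 (P 8) (xhat P x8 m) = s *s chord_pt m \<and> xhat P x8 m = e *s P 8 + r *s chord_pt m"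
proof -
  have *: ?thesis if "s \<noteq> 0" "chord_map F0 F1 (P 8) (xhat P x8 m) = s *s chord_pt m" "\<exists>e r. r \<noteq> 0 \<and> xhat P x8 m = e *s P 8 + r *s chord_pt m" for s
    using that by blast
  have one: "\<exists>e r. r \<noteq> 0 \<and> p + q = e *s q + r *s p" for p q :: pt
    by (rule exI[of _ 1], rule exI[of _ 1]) (simp add: add.commute)
  have low: ?thesis if "i \<in> {1, 2, 3, 4}" "xhat P x8 m = P i + P 8" "chord_pt m = P i" for i
  proof -
    from chord_map_base[OF that(1)] obtain s where "s \<noteq> 0" "chord_map F0 F1 (P 8) (P i + P 8) = s *s P i" by blast
    then show ?thesis by (intro *) (simp_all only: that one not_False_eq_True)
  qed
  have high0: ?thesis if "xhat P x8 m = x" "chord_pt m = y" "F0 x = 0" "F1 x \<noteq> 0" "\<exists>c. c \<noteq> 0 \<and> third F0 (P 8) x = c *s y" "y \<in> {y8, y9, y10}" for x y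
  proof -
    from that(5) obtain c where c: "c \<noteq> 0" "third F0 (P 8) x = c *s y" by blast
    have "chord_map F0 F1 (P 8) x = (- F1 x * c) *s y" using chord_map_curve(1)[OF that(3), of "P 8"] c by simp
    moreover have "\<exists>e r. r \<noteq> 0 \<and> x = e *s P 8 + r *s y"
      using third_decomp[OF c] gy[of 5 y] that(6) by blast
    moreover have "- F1 x * c \<noteq> 0" using c that(4) by simp
    ultimately show ?thesis unfolding that(1)[symmetric] that(2)[symmetric] by (intro *)
  qed
  have high1: ?thesis if "xhat P x8 m = x" "chord_pt m = y" "F1 x = 0" "F0 x \<noteq> 0" "\<exists>c. c \<noteq> 0 \<and> third F1 (P 8) x = c *s y" "y \<in> {y8, y9, y10}" for x y
  proof -
    from that(5) obtain c where c: "c \<noteq> 0" "third F1 (P 8) x = c *s y" by blast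
    have "chord_map F0 F1 (P 8) x = (F0 x * c) *s y" using chord_map_curve(2)[OF that(3), of "P 8"] c by simp
    moreover have "\<exists>e r. r \<noteq> 0 \<and> x = e *s P 8 + r *s y"
      using third_decomp[OF c] gy[of 5 y] that(6) by blast
    moreover have "F0 x * c \<noteq> 0" using c that(4) by simp
    ultimately show ?thesis unfolding that(1)[symmetric] that(2)[symmetric] by (intro *)
  qed
  from m consider "m = 1" | "m = 2" | "m = 3" | "m = 4" | "m = 8" | "m = 9" | "m = 10" by blast
  then show ?thesis
  proof cases
    case 1 show ?thesis by (rule low[of 2]) (simp_all add: 1 xhat_def chord_pt_def)
  next
    case 2 show ?thesis by (rule low[of 1]) (simp_all add: 2 xhat_def chord_pt_def)
  next
    case 3 show ?thesis by (rule low[of 4]) (simp_all add: 3 xhat_def chord_pt_def)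
  next
    case 4 show ?thesis by (rule low[of 3]) (simp_all add: 4 xhat_def chord_pt_def)
  next
    case 5 show ?thesis by (rule high0[of x8 y8]) (use 5 x8 y8 in \<open>simp_all add: xhat_def chord_pt_def\<close>)
  next
    case 6 show ?thesis by (rule high0[of "P 9" y9]) (use 6 F9 y9 in \<open>simp_all add: xhat_def chord_pt_def\<close>)
  next
    case 7 show ?thesis by (rule high1[of "P 10" y10]) (use 7 F10 y10 in \<open>simp_all add: xhat_def chord_pt_def\<close>)
  qed
qed

lemma chord_pt_nz:
  assumes "m \<in> {1, 2, 3, 4, 8, 9, 10}" "j \<in> {5, 6, 7}"
  shows "det3 (P 8) (P j) (chord_pt m) \<noteq> 0" "det3 b (P j) (chord_pt m) \<noteq> 0"
proof -
  from assms(1) consider i where "i \<in> {1, 2, 3, 4}" "chord_pt m = P i" | "chord_pt m \<in> {y8, y9, y10}"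
    unfolding chord_pt_def by fastforce
  then have "det3 (P 8) (P j) (chord_pt m) \<noteq> 0 \<and> det3 b (P j) (chord_pt m) \<noteq> 0"
  proof cases
    case 1
    then have "det3 (P 8) (P j) (P i) \<noteq> 0" using assms(2) by (intro gp) auto
    moreover have "det3 b (P j) (P i) \<noteq> 0" using 1 assms(2) by (intro gb) auto
    ultimately show ?thesis using 1 by simp
  next
    case 2 then show ?thesis using gy assms(2) by blast
  qed
  then show "det3 (P 8) (P j) (chord_pt m) \<noteq> 0" "det3 b (P j) (chord_pt m) \<noteq> 0" by blast+
qed

text \<open>The linear form m_j of the chord identity. For j = 5, 6, 7 these forms turn out to be,
  up to scalars, the dual basis to points 5, 6, 7 of \<open>cremona348\<close>.\<close>

definition dual :: "nat \<Rightarrow> (pt \<Rightarrow> complex) \<Rightarrow> bool" where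
  "dual j M \<longleftrightarrow> (\<forall>x y. M (x + y) = M x + M y) \<and> (\<forall>c x. M (c *s x) = c * M x) \<and>
     (\<forall>x. det3 (P 8) b x * det3 (P 8) (P j) x * M (cubic_map P (P 8) x) = det3 b (P j) (chord_map F0 F1 (P 8) x))"

lemma dual_ex:
  assumes j: "j \<in> {5, 6, 7}"
  shows "\<exists>M. dual j M"
proof -
  have gbp: "det3 (P 8) b (P k) \<noteq> 0" if "k \<in> {1, 2, 3, 4, 5, 6, 7}" for k
  proof -
    have "det3 b (P 8) (P k) \<noteq> 0" using that by (intro gb) auto
    then show ?thesis using det3_nz_perm by blast
  qed
  obtain m1 m2 m3 where m: "\<And>x. det3 (P 8) b x * det3 (P 8) (P j) x * (m1 * cubic_map P (P 8) x $ 1 + m2 * cubic_map P (P 8) x $ 2 + m3 * cubic_map P (P 8) x $ 3)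
      = det3 b (P j) (chord_map F0 F1 (P 8) x)"
  proof (rule cubic_map_chord_map[OF cub, of P "P 8" b "P j"])
    fix x assume "x \<in> {P 1, P 2, P 3, P 4, P 8, b, P j}"
    then show "F0 x = 0 \<and> F1 x = 0" using base baseb j by auto
  next
    show "det3 (P 1) (P 2) (P 8) \<noteq> 0" "det3 (P 1) (P 2) (P 3) \<noteq> 0" "det3 (P 1) (P 2) (P 4) \<noteq> 0" "det3 (P 3) (P 4) (P 8) \<noteq> 0"
      by (intro gp; auto)+
    show "det3 (P 8) b (P j) \<noteq> 0" using gbp j by blast
    fix k :: nat assume k: "k \<in> {1, 2, 3, 4}"
    have "det3 (P 8) (P j) (P k) \<noteq> 0" by (intro gp) (use j k in auto)
    then show "det3 (P 8) b (P k) \<noteq> 0 \<and> det3 (P 8) (P j) (P k) \<noteq> 0" using gbp k by blast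
  qed (rule that)
  show ?thesis
    by (rule exI[of _ "\<lambda>v. m1 * v $ 1 + m2 * v $ 2 + m3 * v $ 3"]) (simp add: dual_def m, simp add: algebra_simps)
qed

text \<open>P k is a base point, so the chord map vanishes there, while both brackets on the left of
  the identity are nonzero.\<close>

lemma dual_zero:
  assumes "dual j M" "j \<in> {5, 6, 7}" "k \<in> {5, 6, 7}" "k \<noteq> j"
  shows "M (cremona348 P x8 k) = 0"
proof -
  have "det3 b (P 8) (P k) \<noteq> 0" using assms by (intro gb) auto
  then have 1: "det3 (P 8) b (P k) \<noteq> 0" using det3_nz_perm by blast
  have 2: "det3 (P 8) (P j) (P k) \<noteq> 0" by (intro gp) (use assms in auto)
  have "F0 (P k) = 0" "F1 (P k) = 0" using base[of k] assms(3) by auto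
  then have "chord_map F0 F1 (P 8) (P k) = 0" by (simp add: chord_map_def)
  moreover have "det3 (P 8) b (P k) * det3 (P 8) (P j) (P k) * M (cubic_map P (P 8) (P k)) = det3 b (P j) (chord_map F0 F1 (P 8) (P k))"
    using assms(1) unfolding dual_def by blast
  moreover have "cremona348 P x8 k = cubic_map P (P 8) (P k)" using assms(3) by (auto simp: cremona348_def xhat_def)
  ultimately show ?thesis using 1 2 by simp
qed

text \<open>With a = P 8, substituting x = e a + r y turns [a b x] [a j x] into r^2 [a b y] [a j y];
  the factor s / (r^2 [a b y]) does not depend on j.\<close>

lemma dual_ratio:
  assumes m: "m \<in> {1, 2, 3, 4, 8, 9, 10}"
  obtains t where "t \<noteq> 0" "\<And>j M. j \<in> {5, 6, 7} \<Longrightarrow> dual j M \<Longrightarrow>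
     M (cremona348 P x8 m) = t * (det3 b (P j) (chord_pt m) / det3 (P 8) (P j) (chord_pt m))"
proof -
  define y where "y = chord_pt m"
  obtain s r e where sr: "s \<noteq> 0" "r \<noteq> 0" "chord_map F0 F1 (P 8) (xhat P x8 m) = s *s y" "xhat P x8 m = e *s P 8 + r *s y"
    using xhat_chord_pt[OF m] unfolding y_def by blast
  have eq: "r\<^sup>2 * det3 (P 8) b y * det3 (P 8) (P j) y * M (cremona348 P x8 m) = s * det3 b (P j) y"
    if "dual j M" for j M
  proof -
    have "det3 (P 8) b (xhat P x8 m) * det3 (P 8) (P j) (xhat P x8 m) * M (cremona348 P x8 m)
       = det3 b (P j) (chord_map F0 F1 (P 8) (xhat P x8 m))"
      using that unfolding dual_def cremona348_def by blast
    then show ?thesis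
      unfolding sr(3) unfolding sr(4) det3_add det3_smult by (simp add: power2_eq_square mult_ac)
  qed
  note ynz = chord_pt_nz[OF m, folded y_def]
  obtain M where "dual 5 M" using dual_ex[of 5] by blast
  \<comment> \<open>[a b y] is nonzero because the other side of the identity is.\<close>
  then have ab: "det3 (P 8) b y \<noteq> 0" using eq[of 5 M] sr(1) ynz(2)[of 5] by auto
  show ?thesis
  proof (rule that[of "s / (r\<^sup>2 * det3 (P 8) b y)"])
    show "s / (r\<^sup>2 * det3 (P 8) b y) \<noteq> 0" using sr ab by simp
    fix j M assume j: "j \<in> {5::nat, 6, 7}" "dual j M"
    show "M (cremona348 P x8 m) = s / (r\<^sup>2 * det3 (P 8) b y) * (det3 b (P j) (chord_pt m) / det3 (P 8) (P j) (chord_pt m))"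
      using eq[OF j(2)] sr ab ynz(1)[OF j(1)] unfolding y_def[symmetric] by (simp add: field_simps)
  qed
qed

text \<open>Cramer's rule identifies the forms of \<open>dual\<close> with brackets against points
  5, 6, 7 up to scalars, so the brackets inherit the ratios.\<close>

theorem cremona_half_main:
  obtains k5 k6 k7 where "k5 \<noteq> 0" "k6 \<noteq> 0" "k7 \<noteq> 0"
    "\<And>m. m \<in> {1, 2, 3, 4, 8, 9, 10} \<Longrightarrow> \<exists>t. t \<noteq> 0 \<and>
       det3 (cremona348 P x8 m) (cremona348 P x8 6) (cremona348 P x8 7) = t * k5 * (det3 b (P 5) (chord_pt m) / det3 (P 8) (P 5) (chord_pt m)) \<and>
       det3 (cremona348 P x8 5) (cremona348 P x8 m) (cremona348 P x8 7) = t * k6 * (det3 b (P 6) (chord_pt m) / det3 (P 8) (P 6) (chord_pt m)) \<and>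
       det3 (cremona348 P x8 5) (cremona348 P x8 6) (cremona348 P x8 m) = t * k7 * (det3 b (P 7) (chord_pt m) / det3 (P 8) (P 7) (chord_pt m))"
    "det3 (cremona348 P x8 5) (cremona348 P x8 6) (cremona348 P x8 7) \<noteq> 0"
proof -
  define C where "C = cremona348 P x8"
  define D where "D = det3 (C 5) (C 6) (C 7)"
  have D: "D \<noteq> 0" using gR unfolding D_def C_def cremona348_def by (simp add: xhat_def)
  obtain M5 M6 M7 where M: "dual 5 M5" "dual 6 M6" "dual 7 M7"
    using dual_ex[of 5] dual_ex[of 6] dual_ex[of 7] by auto
  have lin: "D * M x = det3 x (C 6) (C 7) * M (C 5) + det3 (C 5) x (C 7) * M (C 6) + det3 (C 5) (C 6) x * M (C 7)"
    if "dual j M" for j M x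
  proof -
    have "M (D *s x) = M (det3 x (C 6) (C 7) *s C 5 + det3 (C 5) x (C 7) *s C 6 + det3 (C 5) (C 6) x *s C 7)"
      unfolding D_def by (subst det3_cramer) (rule refl)
    then show ?thesis using that unfolding dual_def by simp
  qed
  have z: "M5 (C 6) = 0" "M5 (C 7) = 0" "M6 (C 5) = 0" "M6 (C 7) = 0" "M7 (C 5) = 0" "M7 (C 6) = 0"
    unfolding C_def by (rule dual_zero[OF M(1)] dual_zero[OF M(2)] dual_zero[OF M(3)]; simp)+
  have e: "D * M5 x = det3 x (C 6) (C 7) * M5 (C 5)" "D * M6 x = det3 (C 5) x (C 7) * M6 (C 6)"
    "D * M7 x = det3 (C 5) (C 6) x * M7 (C 7)" for x
    using lin[OF M(1), of x] lin[OF M(2), of x] lin[OF M(3), of x] z by simp_all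
  obtain t where t: "t \<noteq> 0" "\<And>j M. j \<in> {5, 6, 7} \<Longrightarrow> dual j M \<Longrightarrow>
     M (C 1) = t * (det3 b (P j) (chord_pt 1) / det3 (P 8) (P j) (chord_pt 1))"
    using dual_ratio[of 1] unfolding C_def by blast
  \<comment> \<open>Index 1 shows that none of the forms is identically zero; with \<open>e\<close>
    each is then nonzero at its own point.\<close>
  have "M5 (C 1) \<noteq> 0" "M6 (C 1) \<noteq> 0" "M7 (C 1) \<noteq> 0"
    using t(2)[OF _ M(1)] t(2)[OF _ M(2)] t(2)[OF _ M(3)] t(1) chord_pt_nz[of 1 5] chord_pt_nz[of 1 6] chord_pt_nz[of 1 7] by auto
  then have nz: "M5 (C 5) \<noteq> 0" "M6 (C 6) \<noteq> 0" "M7 (C 7) \<noteq> 0"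
    using e[of "C 1"] D by auto
  show ?thesis
  proof (rule that[of "D / M5 (C 5)" "D / M6 (C 6)" "D / M7 (C 7)"])
    fix m :: nat assume m: "m \<in> {1, 2, 3, 4, 8, 9, 10}"
    obtain t where t: "t \<noteq> 0" "\<And>j M. j \<in> {5, 6, 7} \<Longrightarrow> dual j M \<Longrightarrow>
       M (C m) = t * (det3 b (P j) (chord_pt m) / det3 (P 8) (P j) (chord_pt m))"
      using dual_ratio[OF m] unfolding C_def by blast
    have r: "det3 (C m) (C 6) (C 7) = D / M5 (C 5) * M5 (C m)" "det3 (C 5) (C m) (C 7) = D / M6 (C 6) * M6 (C m)"
      "det3 (C 5) (C 6) (C m) = D / M7 (C 7) * M7 (C m)"
      using e[of "C m"] nz by simp_all
    show "\<exists>t. t \<noteq> 0 \<and>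
       det3 (cremona348 P x8 m) (cremona348 P x8 6) (cremona348 P x8 7) = t * (D / M5 (C 5)) * (det3 b (P 5) (chord_pt m) / det3 (P 8) (P 5) (chord_pt m)) \<and>
       det3 (cremona348 P x8 5) (cremona348 P x8 m) (cremona348 P x8 7) = t * (D / M6 (C 6)) * (det3 b (P 6) (chord_pt m) / det3 (P 8) (P 6) (chord_pt m)) \<and>
       det3 (cremona348 P x8 5) (cremona348 P x8 6) (cremona348 P x8 m) = t * (D / M7 (C 7)) * (det3 b (P 7) (chord_pt m) / det3 (P 8) (P 7) (chord_pt m))"
      unfolding C_def[symmetric] r
      using t(2)[OF _ M(1)] t(2)[OF _ M(2)] t(2)[OF _ M(3)] t(1) by (intro exI[of _ t]) (simp add: mult_ac)
  qed (use D nz in \<open>simp_all add: D_def C_def\<close>)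
qed

end

text \<open>The second half is the same computation seen from the end configuration before the
  exchange of 8 and 9; symmetry of \<open>quad_related\<close> turns it into the fourth and fifth
  maps.\<close>

lemma T89_halves:
  assumes 1: "cremona_half P b F0 F1 x8 y8 y9 y10" and 2: "cremona_half P' (P 8) F0 F1 x8' y8 y9 y10"
    and P': "P' 8 = b" "\<And>i. i \<in> {1, 2, 3, 4, 5, 6, 7} \<Longrightarrow> P' i = P i"
    and Q: "\<And>i. i \<in> {1, 2, 3, 4, 5, 6, 7} \<Longrightarrow> proj_eq (P i) (Q i)"
      "proj_eq (P' 9) (Q 8)" "proj_eq b (Q 9)" "proj_eq (P' 10) (Q 10)"
  shows "T89_rel P Q"
proof -
  interpret A: cremona_half P b F0 F1 x8 y8 y9 y10 by (rule 1)
  interpret B: cremona_half P' "P 8" F0 F1 x8' y8 y9 y10 by (rule 2)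
  obtain k5 k6 k7 where k: "k5 \<noteq> 0" "k6 \<noteq> 0" "k7 \<noteq> 0"
    "\<And>m. m \<in> {1, 2, 3, 4, 8, 9, 10} \<Longrightarrow> \<exists>t. t \<noteq> 0 \<and>
       det3 (cremona348 P x8 m) (cremona348 P x8 6) (cremona348 P x8 7) = t * k5 * (det3 b (P 5) (A.chord_pt m) / det3 (P 8) (P 5) (A.chord_pt m)) \<and>
       det3 (cremona348 P x8 5) (cremona348 P x8 m) (cremona348 P x8 7) = t * k6 * (det3 b (P 6) (A.chord_pt m) / det3 (P 8) (P 6) (A.chord_pt m)) \<and>
       det3 (cremona348 P x8 5) (cremona348 P x8 6) (cremona348 P x8 m) = t * k7 * (det3 b (P 7) (A.chord_pt m) / det3 (P 8) (P 7) (A.chord_pt m))"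
    "det3 (cremona348 P x8 5) (cremona348 P x8 6) (cremona348 P x8 7) \<noteq> 0"
    by (rule A.cremona_half_main) (rule that)
  have p: "P' 1 = P 1" "P' 2 = P 2" "P' 3 = P 3" "P' 4 = P 4" "P' 5 = P 5" "P' 6 = P 6" "P' 7 = P 7"
    by (rule P'(2), simp)+
  have chord_pt: "B.chord_pt m = A.chord_pt m" for m
    unfolding A.chord_pt_def B.chord_pt_def p ..
  obtain l5 l6 l7 where l: "l5 \<noteq> 0" "l6 \<noteq> 0" "l7 \<noteq> 0"
    "\<And>m. m \<in> {1, 2, 3, 4, 8, 9, 10} \<Longrightarrow> \<exists>t. t \<noteq> 0 \<and>
       det3 (cremona348 P' x8' m) (cremona348 P' x8' 6) (cremona348 P' x8' 7) = t * l5 * (det3 (P 8) (P 5) (A.chord_pt m) / det3 b (P 5) (A.chord_pt m)) \<and>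
       det3 (cremona348 P' x8' 5) (cremona348 P' x8' m) (cremona348 P' x8' 7) = t * l6 * (det3 (P 8) (P 6) (A.chord_pt m) / det3 b (P 6) (A.chord_pt m)) \<and>
       det3 (cremona348 P' x8' 5) (cremona348 P' x8' 6) (cremona348 P' x8' m) = t * l7 * (det3 (P 8) (P 7) (A.chord_pt m) / det3 b (P 7) (A.chord_pt m))"
    "det3 (cremona348 P' x8' 5) (cremona348 P' x8' 6) (cremona348 P' x8' 7) \<noteq> 0"
    by (rule B.cremona_half_main[unfolded chord_pt p P'(1)]) (rule that)
  have "quad_related 5 6 7 (cremona348 P x8) (cremona348 P' x8')"
  proof (rule quad_relatedI[of _ _ _ _ _ "k5 * l5" "k6 * l6" "k7 * l7"])
    fix m :: nat assume "m \<in> {1..10} - {5, 6, 7}"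
    then have m: "m \<in> {1, 2, 3, 4, 8, 9, 10}" unfolding indices_10 by blast
    from k(4)[OF m] obtain t where t: "t \<noteq> 0"
       "det3 (cremona348 P x8 m) (cremona348 P x8 6) (cremona348 P x8 7) = t * k5 * (det3 b (P 5) (A.chord_pt m) / det3 (P 8) (P 5) (A.chord_pt m))"
       "det3 (cremona348 P x8 5) (cremona348 P x8 m) (cremona348 P x8 7) = t * k6 * (det3 b (P 6) (A.chord_pt m) / det3 (P 8) (P 6) (A.chord_pt m))"
       "det3 (cremona348 P x8 5) (cremona348 P x8 6) (cremona348 P x8 m) = t * k7 * (det3 b (P 7) (A.chord_pt m) / det3 (P 8) (P 7) (A.chord_pt m))"
      by blast
    from l(4)[OF m] obtain s where s: "s \<noteq> 0"
       "det3 (cremona348 P' x8' m) (cremona348 P' x8' 6) (cremona348 P' x8' 7) = s * l5 * (det3 (P 8) (P 5) (A.chord_pt m) / det3 b (P 5) (A.chord_pt m))"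
       "det3 (cremona348 P' x8' 5) (cremona348 P' x8' m) (cremona348 P' x8' 7) = s * l6 * (det3 (P 8) (P 6) (A.chord_pt m) / det3 b (P 6) (A.chord_pt m))"
       "det3 (cremona348 P' x8' 5) (cremona348 P' x8' 6) (cremona348 P' x8' m) = s * l7 * (det3 (P 8) (P 7) (A.chord_pt m) / det3 b (P 7) (A.chord_pt m))"
      by blast
    note nz = A.chord_pt_nz[OF m]
    show "\<exists>s. s \<noteq> 0 \<and>
          det3 (cremona348 P x8 m) (cremona348 P x8 6) (cremona348 P x8 7) * det3 (cremona348 P' x8' m) (cremona348 P' x8' 6) (cremona348 P' x8' 7) = s * (k5 * l5) \<and>
          det3 (cremona348 P x8 5) (cremona348 P x8 m) (cremona348 P x8 7) * det3 (cremona348 P' x8' 5) (cremona348 P' x8' m) (cremona348 P' x8' 7) = s * (k6 * l6) \<and>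
          det3 (cremona348 P x8 5) (cremona348 P x8 6) (cremona348 P x8 m) * det3 (cremona348 P' x8' 5) (cremona348 P' x8' 6) (cremona348 P' x8' m) = s * (k7 * l7)"
      unfolding t s by (rule exI[of _ "t * s"]) (use nz[of 5] nz[of 6] nz[of 7] t(1) s(1) in simp)
  qed (use k l in simp_all)
  then have c3: "cremona_rel 10 5 6 7 (cremona348 P x8) (cremona348 P' x8')" by (rule quad_related_imp_cremona_rel) simp_all
  have c1: "cremona_rel 10 1 2 8 P (cremona128 P)" by (rule quad_related_imp_cremona_rel[OF A.quad1]) simp_all
  have c2: "cremona_rel 10 3 4 8 (cremona128 P) (cremona348 P x8)" by (rule quad_related_imp_cremona_rel[OF A.quad2]) simp_all
  have c4: "cremona_rel 10 3 4 8 (cremona348 P' x8') (cremona128 P')" by (rule quad_related_imp_cremona_rel[OF quad_related_sym[OF B.quad2]]) simp_all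
  have c5: "cremona_rel 10 1 2 8 (cremona128 P') P'" by (rule quad_related_imp_cremona_rel[OF quad_related_sym[OF B.quad1]]) simp_all
  have "proj_eq (swap89 P' m) (Q m)" if "m \<in> {1..10}" for m
  proof -
    from that consider "m \<in> {1, 2, 3, 4, 5, 6, 7}" | "m = 8" | "m = 9" | "m = 10" unfolding indices_10 by blast
    then show ?thesis
    proof cases
      case 1
      then have "swap89 P' m = P m" using P'(2)[OF 1] by (auto simp: swap89_def)
      then show ?thesis using Q(1)[OF 1] by simp
    qed (simp_all add: swap89_def P'(1) Q)
  qed
  then have "cfg_equiv 10 (swap89 P') Q"
    unfolding cfg_equiv_def by (intro exI[of _ "mat 1"]) (simp add: invertible_det_nz)
  with c1 c2 c3 c4 c5 show ?thesis unfolding T89_rel_def by blast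
qed

section \<open>The net of cubics through seven points\<close>

text \<open>Each component is the product of a line through two of the points P 5, P 6, P 7 and the conic
through P 1, ..., P 4 and the third of them; together they span the cubics through P 1, ..., P 7.\<close>
definition net :: "cfg \<Rightarrow> pt \<Rightarrow> pt" where
  "net P x = vector [det3 x (P 6) (P 7) * conic_thru P (P 5) x, det3 (P 5) x (P 7) * conic_thru P (P 6) x,
                     det3 (P 5) (P 6) x * conic_thru P (P 7) x]"

text \<open>Pull-back under \<open>net\<close> of the line joining the images of P 8 and P
  m.\<close>

definition cubic_thru :: "cfg \<Rightarrow> nat \<Rightarrow> pt \<Rightarrow> complex" where
  "cubic_thru P m x = det3 (net P x) (net P (P 8)) (net P (P m))"

text \<open>The cubic part of the ideal of four points in general position is generated by the two
  conics.\<close>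

lemma cubic_through_4:
  assumes F: "is_cubic F" "F (P 1) = 0" "F (P 2) = 0" "F (P 3) = 0" "F (P 4) = 0"
    and nz: "det3 (P 1) (P 2) (P 3) \<noteq> 0" "det3 (P 1) (P 2) (P 4) \<noteq> 0" "det3 (P 1) (P 3) (P 4) \<noteq> 0" "det3 (P 2) (P 3) (P 4) \<noteq> 0"
  obtains L0 L1 :: "pt \<Rightarrow> complex" where
    "\<And>x y. L0 (x + y) = L0 x + L0 y" "\<And>c x. L0 (c *s x) = c * L0 x"
    "\<And>x y. L1 (x + y) = L1 x + L1 y" "\<And>c x. L1 (c *s x) = c * L1 x"
    "\<And>x. F x = L1 x * conic0 P x - L0 x * conic1 P x"
proof -
  define u v w D where uvw: "u = P 1" "v = P 2" "w = P 3" "D = det3 (P 1) (P 2) (P 3)"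
  have D: "D \<noteq> 0" "det3 u v w = D" using nz uvw by simp_all
  have co: "\<exists>X Y Z. x = X *s u + Y *s v + Z *s w" for x
    using det3_coords[of u v w x] D by blast
  obtain a b c where p4: "P 4 = a *s u + b *s v + c *s w" using co by blast
  note uvw' = uvw(1,2,3)[symmetric]
  have dp: "det3 (X *s u + Y *s v + Z *s w) v w = X * D" "det3 u (X *s u + Y *s v + Z *s w) w = Y * D"
    "det3 u v (X *s u + Y *s v + Z *s w) = Z * D" "det3 u w (X *s u + Y *s v + Z *s w) = - Y * D"
    "det3 v w (X *s u + Y *s v + Z *s w) = X * D" for X Y Z
    using D(2) by (simp_all add: det3_add det3_smult det3_swap(2)[of u v w] det3_swap[of w v u]) (simp_all add: det3_def algebra_simps)
  have n: "a \<noteq> 0" "b \<noteq> 0" "c \<noteq> 0" using nz(2-4) unfolding p4 uvw' dp by simp_all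
  from is_cubic_coords[OF F(1), of u v w] obtain c1 c2 c3 c4 c5 c6 c7 c8 c9 c10 where
    1: "\<And>X Y Z. F (X *s u + Y *s v + Z *s w) =
     c1 * X^3 + c2 * Y^3 + c3 * Z^3 + c4 * X^2 * Y + c5 * X^2 * Z + c6 * X * Y^2
     + c7 * Y^2 * Z + c8 * X * Z^2 + c9 * Y * Z^2 + c10 * X * Y * Z"
    by (rule ternary_cubicE) (rule that)
  have c: "c1 = 0" "c2 = 0" "c3 = 0" using 1[of 1 0 0] 1[of 0 1 0] 1[of 0 0 1] F(2-4) uvw by simp_all
  have c10: "c10 * a * b * c = - (c4 * a^2 * b + c5 * a^2 * c + c6 * a * b^2 + c7 * b^2 * c + c8 * a * c^2 + c9 * b * c^2)"
    using F(5) unfolding p4 1 c by algebra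
  \<comment> \<open>Comparing coefficients, six monomials determine the six coefficients of L0 and
    L1; the seventh, X Y Z, then agrees because F vanishes at P 4.\<close>
  define m1 m2 l1 l3 where ml1: "m1 = c4 / c" "m2 = c6 / c" "l1 = - c5 / b" "l3 = - c8 / b"
  define l2 m3 where ml2: "l2 = c7 / a + m2" "m3 = l3 - c9 / a"
  note ml = ml1 ml2
  have e: "c4 = c * m1" "c6 = c * m2" "c5 = - b * l1" "c8 = - b * l3" "c7 = a * l2 - a * m2" "c9 = a * l3 - a * m3"
    using n by (simp_all add: ml field_simps)
  have "(a * b * c) * (c10 - (a * l1 - b * l2 - a * m1 + c * m3)) = 0" using c10 unfolding e by algebra
  then have e10: "c10 = a * l1 - b * l2 - a * m1 + c * m3" using n by simp
  define L0 where "L0 = (\<lambda>x. (m1 * det3 x v w + m2 * det3 u x w + m3 * det3 u v x) / D ^ 3)"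
  define L1 where "L1 = (\<lambda>x. (l1 * det3 x v w + l2 * det3 u x w + l3 * det3 u v x) / D ^ 3)"
  show ?thesis
  proof (rule that[of L0 L1])
    fix x
    obtain X Y Z where x: "x = X *s u + Y *s v + Z *s w" using co by blast
    have c0: "conic0 P x = D^2 * (Z * (a * Y - b * X))" "conic1 P x = D^2 * (Y * (a * Z - c * X))"
      unfolding conic0_def conic1_def p4 uvw' x dp det3_basis D(2) by (simp_all add: power2_eq_square algebra_simps)
    have L: "L0 x = (m1 * X + m2 * Y + m3 * Z) / D^2" "L1 x = (l1 * X + l2 * Y + l3 * Z) / D^2"
      unfolding L0_def L1_def x dp using D by (simp_all add: field_simps eval_nat_numeral)
    have "F x = (l1 * X + l2 * Y + l3 * Z) * (Z * (a * Y - b * X)) - (m1 * X + m2 * Y + m3 * Z) * (Y * (a * Z - c * X))"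
      unfolding x 1 c e e10 by algebra
    then show "F x = L1 x * conic0 P x - L0 x * conic1 P x" unfolding c0 L using D by simp
  qed (simp_all add: L0_def L1_def det3_add det3_smult add_divide_distrib algebra_simps)
qed

text \<open>With F = L1 conic0 - L0 conic1, vanishing at P j makes (L0, L1) at P j a multiple w_j of
  (conic0, conic1) at P j. Being linear, L0 and L1 are recovered from their values at P 5, P 6, P
  7.\<close>

lemma net_span:
  assumes F: "is_cubic F" "\<And>i. i \<in> {1, 2, 3, 4, 5, 6, 7} \<Longrightarrow> F (P i) = 0"
    and nz: "det3 (P 1) (P 2) (P 3) \<noteq> 0" "det3 (P 1) (P 2) (P 4) \<noteq> 0" "det3 (P 1) (P 3) (P 4) \<noteq> 0" "det3 (P 2) (P 3) (P 4) \<noteq> 0"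
    "det3 (P 5) (P 6) (P 7) \<noteq> 0" "conic0 P (P 5) \<noteq> 0" "conic0 P (P 6) \<noteq> 0" "conic0 P (P 7) \<noteq> 0"
  obtains w1 w2 w3 where "\<And>x. F x = w1 * net P x $ 1 + w2 * net P x $ 2 + w3 * net P x $ 3"
proof -
  obtain L0 L1 where L: "\<And>x y. L0 (x + y) = L0 x + L0 y" "\<And>c x. L0 (c *s x) = c * L0 x"
    "\<And>x y. L1 (x + y) = L1 x + L1 y" "\<And>c x. L1 (c *s x) = c * L1 x"
    and FL: "\<And>x. F x = L1 x * conic0 P x - L0 x * conic1 P x"
    by (rule cubic_through_4[OF F(1) F(2) F(2) F(2) F(2) nz(1-4)]) (simp, simp, simp, simp, rule that)
  define D where "D = det3 (P 5) (P 6) (P 7)"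
  have D: "D \<noteq> 0" using nz D_def by simp
  define w5 w6 w7 where w: "w5 = L0 (P 5) / conic0 P (P 5)" "w6 = L0 (P 6) / conic0 P (P 6)" "w7 = L0 (P 7) / conic0 P (P 7)"
  have L0: "L0 (P 5) = conic0 P (P 5) * w5" "L0 (P 6) = conic0 P (P 6) * w6" "L0 (P 7) = conic0 P (P 7) * w7"
    using nz by (simp_all add: w)
  have L1: "L1 (P 5) = conic1 P (P 5) * w5" "L1 (P 6) = conic1 P (P 6) * w6" "L1 (P 7) = conic1 P (P 7) * w7"
    using FL[of "P 5"] FL[of "P 6"] FL[of "P 7"] F(2)[of 5] F(2)[of 6] F(2)[of 7] nz by (simp_all add: w field_simps)
  have lin: "D * L x = det3 x (P 6) (P 7) * L (P 5) + det3 (P 5) x (P 7) * L (P 6) + det3 (P 5) (P 6) x * L (P 7)"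
    if "\<And>x y. L (x + y) = L x + L y" "\<And>c x. L (c *s x) = c * L x" for L :: "pt \<Rightarrow> complex" and x
  proof -
    have "L (D *s x) = L (det3 x (P 6) (P 7) *s P 5 + det3 (P 5) x (P 7) *s P 6 + det3 (P 5) (P 6) x *s P 7)"
      unfolding D_def by (subst det3_cramer) (rule refl)
    then show ?thesis using that by simp
  qed
  show ?thesis
  proof (rule that[of "w5 / D" "w6 / D" "w7 / D"])
    fix x
    have "D * F x = (D * L1 x) * conic0 P x - (D * L0 x) * conic1 P x" unfolding FL by (simp add: algebra_simps)
    also have "\<dots> = w5 * net P x $ 1 + w6 * net P x $ 2 + w7 * net P x $ 3"
      unfolding lin[OF L(1,2)] lin[OF L(3,4)] L0 L1 net_def conic_thru_def by (simp add: algebra_simps)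
    finally show "F x = w5 / D * net P x $ 1 + w6 / D * net P x $ 2 + w7 / D * net P x $ 3"
      using D by (simp add: field_simps)
  qed
qed

text \<open>Zero if and only if a nontrivial combination of the components of \<open>net\<close>
  vanishes at P 8, P 9 and P 10; it takes the place of the 10 by 10 determinant of cubic
  monomials.\<close>

definition ten_det :: "cfg \<Rightarrow> complex" where
  "ten_det P = det3 (net P (P 8)) (net P (P 9)) (net P (P 10))"

text \<open>Cramer's rule for \<open>net P x\<close> in the images of P 8, P 9, P 10, followed by
  the linear functional that defines F and kills the image of P 8.\<close>

lemma cubic_thru_interpolate:
  assumes F: "is_cubic F" "\<And>i. i \<in> {1, 2, 3, 4, 5, 6, 7, 8} \<Longrightarrow> F (P i) = 0"
    and nz: "det3 (P 1) (P 2) (P 3) \<noteq> 0" "det3 (P 1) (P 2) (P 4) \<noteq> 0" "det3 (P 1) (P 3) (P 4) \<noteq> 0" "det3 (P 2) (P 3) (P 4) \<noteq> 0"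
    "det3 (P 5) (P 6) (P 7) \<noteq> 0" "conic0 P (P 5) \<noteq> 0" "conic0 P (P 6) \<noteq> 0" "conic0 P (P 7) \<noteq> 0"
  shows "ten_det P * F x = F (P 10) * cubic_thru P 9 x - F (P 9) * cubic_thru P 10 x"
proof -
  obtain w1 w2 w3 where w: "\<And>x. F x = w1 * net P x $ 1 + w2 * net P x $ 2 + w3 * net P x $ 3"
    by (rule net_span[OF F(1) F(2) nz]) (auto intro: that)
  have 0: "w1 * net P (P 8) $ 1 + w2 * net P (P 8) $ 2 + w3 * net P (P 8) $ 3 = 0" using F(2)[of 8] w by simp
  show ?thesis
    unfolding w ten_det_def cubic_thru_def det3_def using 0 by algebra
qed

lemma cubic_thru_zero: "cubic_thru P m (P 8) = 0" "cubic_thru P m (P m) = 0" "i \<in> {1, 2, 3, 4, 5, 6, 7} \<Longrightarrow> cubic_thru P m (P i) = 0"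
proof -
  show "cubic_thru P m (P 8) = 0" "cubic_thru P m (P m) = 0" by (simp_all add: cubic_thru_def)
  have self: "conic_thru P (P j) (P j) = 0" for j by simp
  assume "i \<in> {1, 2, 3, 4, 5, 6, 7}"
  then have "net P (P i) = 0" by (auto simp: net_def vec_eq_iff forall_3 simp del: One_nat_def)
  then show "cubic_thru P m (P i) = 0" by (simp add: cubic_thru_def)
qed

lemma det3_two_zero:
  assumes "det3 u v w \<noteq> 0" "det3 u v x = 0" "det3 u w x = 0"
  shows "\<exists>c. x = c *s u"
  using det3_coords[OF assms(1), of x] assms(2,3) by (auto simp: det3_swap(2)[of u w x])

section \<open>The ninth base point by way of the pencil of conics\<close>

definition conic_lin :: "cfg \<Rightarrow> nat \<Rightarrow> complex \<Rightarrow> complex \<Rightarrow> complex" where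
  "conic_lin P j q0 q1 = conic1 P (P j) * q0 - conic0 P (P j) * q1"

text \<open>The point x with net P x parallel to net P (P 8) for which (conic0 P x : conic1 P x) = (q0 : q1). Consistency is
a quintic equation for (q0 : q1), with the known roots coming from P 5, ..., P 8. The fifth root is the ninth base point;
it is read off from the two outermost coefficients of the quintic.\<close>
definition conic_param :: "cfg \<Rightarrow> complex \<Rightarrow> complex \<Rightarrow> pt" where
  "conic_param P q0 q1 = (net P (P 8) $ 1 * conic_lin P 6 q0 q1 * conic_lin P 7 q0 q1) *s P 5
     + (net P (P 8) $ 2 * conic_lin P 5 q0 q1 * conic_lin P 7 q0 q1) *s P 6
     + (net P (P 8) $ 3 * conic_lin P 5 q0 q1 * conic_lin P 6 q0 q1) *s P 7"

definition ninth_param0 :: "cfg \<Rightarrow> complex" where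
  "ninth_param0 P = conic0 P (conic_param P 0 1) * (conic1 P (P 5) * conic1 P (P 6) * conic1 P (P 7) * conic1 P (P 8))"

definition ninth_param1 :: "cfg \<Rightarrow> complex" where
  "ninth_param1 P = conic1 P (conic_param P 1 0) * (conic0 P (P 5) * conic0 P (P 6) * conic0 P (P 7) * conic0 P (P 8))"

definition ninth_point :: "cfg \<Rightarrow> pt" where
  "ninth_point P = conic_param P (ninth_param0 P) (ninth_param1 P)"

lemma conic_thru_conic_lin: "conic_thru P (P j) x = conic_lin P j (conic0 P x) (conic1 P x)"
  by (simp add: conic_thru_def conic_lin_def)

lemma con_smult: "conic0 P (c *s x) = c^2 * conic0 P x" "conic1 P (c *s x) = c^2 * conic1 P x"
  by (simp_all add: conic0_def conic1_def det3_smult power2_eq_square)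

lemma conic_param_smult: "conic_param P (c * q0) (c * q1) = c^2 *s conic_param P q0 q1"
  by (simp add: conic_param_def conic_lin_def vec_eq_iff algebra_simps power2_eq_square)

lemma conic_param_base:
  "\<exists>c. conic_param P (conic0 P (P 5)) (conic1 P (P 5)) = c *s P 5"
  "\<exists>c. conic_param P (conic0 P (P 6)) (conic1 P (P 6)) = c *s P 6"
  "\<exists>c. conic_param P (conic0 P (P 7)) (conic1 P (P 7)) = c *s P 7"
  "\<exists>c. conic_param P (conic0 P (P 8)) (conic1 P (P 8)) = c *s P 8"
proof -
  have d: "conic_lin P j (conic0 P (P j)) (conic1 P (P j)) = 0" for j by (simp add: conic_lin_def)
  show "\<exists>c. conic_param P (conic0 P (P 5)) (conic1 P (P 5)) = c *s P 5" "\<exists>c. conic_param P (conic0 P (P 6)) (conic1 P (P 6)) = c *s P 6"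
    "\<exists>c. conic_param P (conic0 P (P 7)) (conic1 P (P 7)) = c *s P 7"
    unfolding conic_param_def d by (auto simp: vec_eq_iff)
  define q0 q1 where q: "q0 = conic0 P (P 8)" "q1 = conic1 P (P 8)"
  define e where "e = conic_lin P 5 q0 q1 * conic_lin P 6 q0 q1 * conic_lin P 7 q0 q1"
  have "conic_param P q0 q1 = e *s (det3 (P 8) (P 6) (P 7) *s P 5 + det3 (P 5) (P 8) (P 7) *s P 6 + det3 (P 5) (P 6) (P 8) *s P 7)"
    unfolding conic_param_def net_def conic_thru_conic_lin q[symmetric] e_def by (simp add: vec_eq_iff algebra_simps)
  also have "\<dots> = e *s (det3 (P 5) (P 6) (P 7) *s P 8)"
    by (subst det3_cramer[symmetric]) (rule refl)
  finally show "\<exists>c. conic_param P (conic0 P (P 8)) (conic1 P (P 8)) = c *s P 8" unfolding q by auto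
qed

text \<open>\<open>conic_param\<close> is quadratic in (q0 : q1), so the difference is a quintic
  form. The pairwise independent linear factors from P 5, ..., P 8 are split off in turn, and the
  last factor is identified by the values at (1 : 0) and (0 : 1).\<close>

lemma conic_param_factor:
  assumes e: "\<And>i j. i \<in> {5, 6, 7, 8} \<Longrightarrow> j \<in> {5, 6, 7, 8} \<Longrightarrow> i \<noteq> j \<Longrightarrow> conic_lin P i (conic0 P (P j)) (conic1 P (P j)) \<noteq> 0"
    and q: "\<And>i. i \<in> {5, 6, 7, 8} \<Longrightarrow> conic0 P (P i) \<noteq> 0 \<and> conic1 P (P i) \<noteq> 0"
  obtains c where "c \<noteq> 0" "\<And>q0 q1. c * (conic1 P (conic_param P q0 q1) * q0 - conic0 P (conic_param P q0 q1) * q1)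
      = conic_lin P 5 q0 q1 * conic_lin P 6 q0 q1 * conic_lin P 7 q0 q1 * conic_lin P 8 q0 q1 * (ninth_param1 P * q0 - ninth_param0 P * q1)"
proof -
  define H where "H = (\<lambda>q0 q1. conic1 P (conic_param P q0 q1) * q0 - conic0 P (conic_param P q0 q1) * q1)"
  have conic_lin: "binary_form 1 (conic_lin P j)" for j
    unfolding conic_lin_def by (rule binary_form_linear')
  have l2: "binary_form 2 (\<lambda>q0 q1. det3 u v (conic_param P q0 q1))" for u v
    unfolding conic_param_def det3_add det3_smult
    by (intro binary_form_add binary_form_mult'[where k = 2 and m = 2 and n = 0] binary_form_mult'[where k = 2 and m = 1 and n = 1, OF binary_form_mult'[where k = 1 and m = 0 and n = 1]] binary_form_const conic_lin) simp_all
  have c4: "binary_form 4 (\<lambda>q0 q1. conic0 P (conic_param P q0 q1))" "binary_form 4 (\<lambda>q0 q1. conic1 P (conic_param P q0 q1))"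
    unfolding conic0_def conic1_def by (intro binary_form_mult'[OF l2 l2]; simp)+
  have X: "binary_form 1 (\<lambda>X Y. X)" "binary_form 1 (\<lambda>X Y. Y)" using binary_form_linear[of 1 0] binary_form_linear[of 0 1] by simp_all
  have H5: "binary_form 5 H" unfolding H_def
    by (intro binary_form_diff binary_form_mult'[OF c4(2) X(1)] binary_form_mult'[OF c4(1) X(2)]) simp_all
  have Hz: "H (conic0 P (P j)) (conic1 P (P j)) = 0" if j: "j \<in> {5, 6, 7, 8}" for j
  proof -
    obtain c where "conic_param P (conic0 P (P j)) (conic1 P (P j)) = c *s P j" using conic_param_base[of P] j by auto
    then show ?thesis unfolding H_def by (simp add: con_smult)
  qed
  have step: "\<exists>g. binary_form n g \<and> (\<forall>X Y. f X Y = conic_lin P j X Y * g X Y)"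
    if st: "binary_form (Suc n) f" "f (conic0 P (P j)) (conic1 P (P j)) = 0" "j \<in> {5, 6, 7, 8}" for n f j
  proof -
    obtain g where g: "binary_form n g" "\<And>X Y. f X Y = (conic0 P (P j) * Y - conic1 P (P j) * X) * g X Y"
      by (rule binary_form_div[OF st(1,2)]) (use q st(3) that in auto)
    then show ?thesis
      using binary_form_scale[OF g(1), of "-1"]
      by (intro exI[of _ "\<lambda>X Y. (-1) * g X Y"] conjI) (auto simp: g(2) conic_lin_def algebra_simps)
  qed
  have "binary_form (Suc 4) H" using H5 by simp
  from step[OF this Hz, of 5] obtain g1 where g1: "binary_form 4 g1" "\<And>X Y. H X Y = conic_lin P 5 X Y * g1 X Y" by auto
  have z1: "g1 (conic0 P (P j)) (conic1 P (P j)) = 0" if "j \<in> {6, 7, 8}" for j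
    using Hz[of j] g1(2) e[of 5 j] that by auto
  have "binary_form (Suc 3) g1" using g1 by simp
  from step[OF this z1, of 6] obtain g2 where g2: "binary_form 3 g2" "\<And>X Y. g1 X Y = conic_lin P 6 X Y * g2 X Y" by auto
  have z2: "g2 (conic0 P (P j)) (conic1 P (P j)) = 0" if "j \<in> {7, 8}" for j
    using z1[of j] g2(2) e[of 6 j] that by auto
  have "binary_form (Suc 2) g2" using g2 by simp
  from step[OF this z2, of 7] obtain g3 where g3: "binary_form 2 g3" "\<And>X Y. g2 X Y = conic_lin P 7 X Y * g3 X Y" by auto
  have z3: "g3 (conic0 P (P 8)) (conic1 P (P 8)) = 0"
    using z2[of 8] g3(2) e[of 7 8] by auto
  have "binary_form (Suc 1) g3" using g3 by (simp add: numeral_2_eq_2)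
  from step[OF this z3] obtain g4 where g4: "binary_form 1 g4" "\<And>X Y. g3 X Y = conic_lin P 8 X Y * g4 X Y" by auto
  obtain a b where ab: "\<And>X Y. g4 X Y = X * a + Y * b"
    using g4(1) unfolding One_nat_def by (auto elim!: binary_form_SucE binary_form_0E)
  have H: "H X Y = conic_lin P 5 X Y * conic_lin P 6 X Y * conic_lin P 7 X Y * conic_lin P 8 X Y * (X * a + Y * b)" for X Y
    by (simp add: g1(2) g2(2) g3(2) g4(2) ab)
  define p0 p1 where p: "p0 = conic0 P (P 5) * conic0 P (P 6) * conic0 P (P 7) * conic0 P (P 8)"
    "p1 = conic1 P (P 5) * conic1 P (P 6) * conic1 P (P 7) * conic1 P (P 8)"
  have "p0 \<noteq> 0" "p1 \<noteq> 0" using q by (simp_all add: p)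
  have "conic1 P (conic_param P 1 0) = p1 * a" using H[of 1 0] unfolding H_def p conic_lin_def by simp
  then have ninth_param1: "ninth_param1 P = p0 * p1 * a" unfolding ninth_param1_def p by simp
  have "- conic0 P (conic_param P 0 1) = p0 * b" using H[of 0 1] unfolding H_def p conic_lin_def by simp
  then have "conic0 P (conic_param P 0 1) = - (p0 * b)" by (metis minus_minus)
  then have ninth_param0: "ninth_param0 P = - (p0 * p1 * b)" unfolding ninth_param0_def p by simp
  show ?thesis
  proof (rule that[of "p0 * p1"])
    show "p0 * p1 \<noteq> 0" using \<open>p0 \<noteq> 0\<close> \<open>p1 \<noteq> 0\<close> by simp
    fix q0 q1
    have "p0 * p1 * H q0 q1 = conic_lin P 5 q0 q1 * conic_lin P 6 q0 q1 * conic_lin P 7 q0 q1 * conic_lin P 8 q0 q1 * (ninth_param1 P * q0 - ninth_param0 P * q1)"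
      unfolding H ninth_param0 ninth_param1 by (simp add: algebra_simps)
    then show "p0 * p1 * (conic1 P (conic_param P q0 q1) * q0 - conic0 P (conic_param P q0 q1) * q1)
      = conic_lin P 5 q0 q1 * conic_lin P 6 q0 q1 * conic_lin P 7 q0 q1 * conic_lin P 8 q0 q1 * (ninth_param1 P * q0 - ninth_param0 P * q1)"
      unfolding H_def .
  qed
qed

lemma parallel_pairs:
  fixes a b c d :: complex
  assumes "a * d = b * c" "(c, d) \<noteq> (0, 0)"
  obtains t where "a = t * c" "b = t * d"
proof (cases "c = 0")
  case True with assms have "d \<noteq> 0" by simp
  with True assms show ?thesis by (intro that[of "b / d"]) simp_all
next
  case False
  with assms show ?thesis by (intro that[of "a / c"]) (simp_all add: field_simps)
qed

locale eight_points =
  fixes P :: cfg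
  assumes gp: "\<And>i j k. i \<in> {1, 2, 3, 4, 5, 6, 7, 8} \<Longrightarrow> j \<in> {1, 2, 3, 4, 5, 6, 7, 8} \<Longrightarrow> k \<in> {1, 2, 3, 4, 5, 6, 7, 8} \<Longrightarrow>
        i \<noteq> j \<Longrightarrow> j \<noteq> k \<Longrightarrow> i \<noteq> k \<Longrightarrow> det3 (P i) (P j) (P k) \<noteq> 0"
    and ek: "\<And>i j. i \<in> {5, 6, 7, 8} \<Longrightarrow> j \<in> {5, 6, 7, 8} \<Longrightarrow> i \<noteq> j \<Longrightarrow> conic_thru P (P i) (P j) \<noteq> 0"
    and om: "ten_det P \<noteq> 0" and ninth_point: "ninth_point P \<noteq> 0"
begin

lemma con_nz: "i \<in> {5, 6, 7, 8} \<Longrightarrow> conic0 P (P i) \<noteq> 0 \<and> conic1 P (P i) \<noteq> 0"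
proof -
  assume i: "i \<in> {5, 6, 7, 8}"
  have "det3 (P 1) (P 2) (P i) \<noteq> 0" "det3 (P 3) (P 4) (P i) \<noteq> 0" "det3 (P 1) (P 3) (P i) \<noteq> 0" "det3 (P 2) (P 4) (P i) \<noteq> 0"
    by (intro gp; use i in auto)+
  then show ?thesis by (simp add: conic0_def conic1_def del: One_nat_def)
qed

lemma pencil_eq:
  assumes F: "is_cubic F" "\<And>i. i \<in> {1, 2, 3, 4, 5, 6, 7, 8} \<Longrightarrow> F (P i) = 0"
  shows "ten_det P * F x = F (P 10) * cubic_thru P 9 x - F (P 9) * cubic_thru P 10 x"
proof (rule cubic_thru_interpolate[OF F])
  show "conic0 P (P 5) \<noteq> 0" "conic0 P (P 6) \<noteq> 0" "conic0 P (P 7) \<noteq> 0" using con_nz by auto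
qed (assumption | (rule gp; simp))+

lemma h_nz: "(ninth_param0 P, ninth_param1 P) \<noteq> (0, 0)"
proof
  assume "(ninth_param0 P, ninth_param1 P) = (0, 0)"
  then have "ninth_point P = 0" by (simp add: ninth_point_def conic_param_def conic_lin_def vec_eq_iff)
  with ninth_point show False by simp
qed

text \<open>At the fifth root the conic values of the point are t times the parameters. So each
  component of \<open>net\<close> is a bracket containing two of d 5, d 6, d 7 times a conic value
  containing the third, and the net value is a multiple of that of P 8.\<close>

lemma ninth_point_zero: "cubic_thru P m (ninth_point P) = 0"
proof -
  obtain c where c: "c \<noteq> 0" "\<And>q0 q1. c * (conic1 P (conic_param P q0 q1) * q0 - conic0 P (conic_param P q0 q1) * q1)
      = conic_lin P 5 q0 q1 * conic_lin P 6 q0 q1 * conic_lin P 7 q0 q1 * conic_lin P 8 q0 q1 * (ninth_param1 P * q0 - ninth_param0 P * q1)"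
    by (rule conic_param_factor[of P]) (use ek con_nz in \<open>auto simp: conic_thru_conic_lin intro: that\<close>)
  have "conic0 P (ninth_point P) * ninth_param1 P = conic1 P (ninth_point P) * ninth_param0 P"
    using c(2)[of "ninth_param0 P" "ninth_param1 P"] c(1) unfolding ninth_point_def[symmetric] by (simp add: mult.commute)
  from parallel_pairs[OF this h_nz] obtain t where t: "conic0 P (ninth_point P) = t * ninth_param0 P" "conic1 P (ninth_point P) = t * ninth_param1 P" .
  define d where "d = (\<lambda>j. conic_lin P j (ninth_param0 P) (ninth_param1 P))"
  have K: "conic_thru P (P j) (ninth_point P) = t * d j" for j
    unfolding conic_thru_conic_lin t d_def conic_lin_def by (simp add: algebra_simps)
  have X: "det3 (ninth_point P) (P 6) (P 7) = net P (P 8) $ 1 * d 6 * d 7 * det3 (P 5) (P 6) (P 7)"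
    "det3 (P 5) (ninth_point P) (P 7) = net P (P 8) $ 2 * d 5 * d 7 * det3 (P 5) (P 6) (P 7)"
    "det3 (P 5) (P 6) (ninth_point P) = net P (P 8) $ 3 * d 5 * d 6 * det3 (P 5) (P 6) (P 7)"
    unfolding ninth_point_def conic_param_def d_def by (simp_all add: det3_add det3_smult)
  have "net P (ninth_point P) = (t * d 5 * d 6 * d 7 * det3 (P 5) (P 6) (P 7)) *s net P (P 8)"
    unfolding net_def[of P "ninth_point P"] K X by (simp add: vec_eq_iff forall_3 mult_ac)
  then show ?thesis unfolding cubic_thru_def by (simp add: det3_smult)
qed

text \<open>As \<open>ten_det\<close> is nonzero, a common zero has net value s times that of P 8.
  If both conics vanish, x is one of P 1, ..., P 4; if only s = 0, one of P 5, P 6, P 7; otherwise x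
  is \<open>conic_param\<close> of its own conic values up to a scalar, so their ratio is a root of
  the quintic.\<close>

lemma common_zeros:
  assumes x: "x \<noteq> 0" "cubic_thru P 9 x = 0" "cubic_thru P 10 x = 0"
  shows "(\<exists>i\<in>{1, 2, 3, 4, 5, 6, 7, 8}. \<exists>c. x = c *s P i) \<or> (\<exists>c. x = c *s ninth_point P)"
proof -
  define q0 q1 where q: "q0 = conic0 P x" "q1 = conic1 P x"
  define v where "v = net P (P 8)"
  define D where "D = det3 (P 5) (P 6) (P 7)"
  have D: "D \<noteq> 0" unfolding D_def by (intro gp) auto
  define s where "s = det3 (net P x) (net P (P 9)) (net P (P 10)) / ten_det P"
  have "ten_det P *s net P x = det3 (net P x) (net P (P 9)) (net P (P 10)) *s v + det3 v (net P x) (net P (P 10)) *s net P (P 9)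
      + det3 v (net P (P 9)) (net P x) *s net P (P 10)"
    unfolding ten_det_def v_def by (rule det3_cramer)
  moreover have "det3 v (net P x) (net P (P 10)) = 0" "det3 v (net P (P 9)) (net P x) = 0"
    using x(2,3) unfolding cubic_thru_def v_def by (simp_all add: det3_def algebra_simps)
  ultimately have "net P x = s *s v" using om by (simp add: s_def vec_eq_iff field_simps)
  then have n: "det3 x (P 6) (P 7) * conic_lin P 5 q0 q1 = s * v $ 1" "det3 (P 5) x (P 7) * conic_lin P 6 q0 q1 = s * v $ 2"
    "det3 (P 5) (P 6) x * conic_lin P 7 q0 q1 = s * v $ 3"
    unfolding net_def conic_thru_conic_lin q by (simp_all add: vec_eq_iff forall_3)
  have vnz: "v $ 1 \<noteq> 0" "v $ 2 \<noteq> 0" "v $ 3 \<noteq> 0"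
  proof -
    have "det3 (P 8) (P 6) (P 7) \<noteq> 0" "det3 (P 5) (P 8) (P 7) \<noteq> 0" "det3 (P 5) (P 6) (P 8) \<noteq> 0"
      by (intro gp; auto)+
    then show "v $ 1 \<noteq> 0" "v $ 2 \<noteq> 0" "v $ 3 \<noteq> 0" using ek[of 5 8] ek[of 6 8] ek[of 7 8] by (simp_all add: v_def net_def)
  qed
  have cram: "D *s x = det3 x (P 6) (P 7) *s P 5 + det3 (P 5) x (P 7) *s P 6 + det3 (P 5) (P 6) x *s P 7"
    unfolding D_def by (rule det3_cramer)
  have x1: "x = (det3 x (P 6) (P 7) / D) *s P 5 + (det3 (P 5) x (P 7) / D) *s P 6 + (det3 (P 5) (P 6) x / D) *s P 7"
    unfolding D_def by (rule det3_coords) (use D in \<open>simp add: D_def\<close>)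
  consider "q0 = 0" "q1 = 0" | "(q0, q1) \<noteq> (0, 0)" "s = 0" | "(q0, q1) \<noteq> (0, 0)" "s \<noteq> 0" by auto
  then show ?thesis
  proof cases
    case 1
    have D4: "det3 (P 1) (P 2) (P 3) \<noteq> 0" "det3 (P 2) (P 1) (P 4) \<noteq> 0" "det3 (P 3) (P 4) (P 1) \<noteq> 0" "det3 (P 4) (P 3) (P 2) \<noteq> 0"
      by (intro gp; auto)+
    from 1 have "det3 (P 1) (P 2) x = 0 \<and> det3 (P 1) (P 3) x = 0 \<or> det3 (P 2) (P 1) x = 0 \<and> det3 (P 2) (P 4) x = 0
      \<or> det3 (P 3) (P 4) x = 0 \<and> det3 (P 3) (P 1) x = 0 \<or> det3 (P 4) (P 3) x = 0 \<and> det3 (P 4) (P 2) x = 0"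
      unfolding q conic0_def conic1_def using det3_swap(1)[of "P 1" "P 2" x] det3_swap(1)[of "P 1" "P 3" x]
        det3_swap(1)[of "P 3" "P 4" x] det3_swap(1)[of "P 2" "P 4" x] by auto
    then have "(\<exists>c. x = c *s P 1) \<or> (\<exists>c. x = c *s P 2) \<or> (\<exists>c. x = c *s P 3) \<or> (\<exists>c. x = c *s P 4)"
      using det3_two_zero[OF D4(1)] det3_two_zero[OF D4(2)] det3_two_zero[OF D4(3)] det3_two_zero[OF D4(4)] by blast
    then show ?thesis by blast
  next
    case 2
    have two: "\<not> (conic_lin P i q0 q1 = 0 \<and> conic_lin P j q0 q1 = 0)" if "i \<in> {5, 6, 7}" "j \<in> {5, 6, 7}" "i \<noteq> j" for i j
    proof
      assume "conic_lin P i q0 q1 = 0 \<and> conic_lin P j q0 q1 = 0"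
      then have "conic_thru P (P i) (P j) * q0 = 0" "conic_thru P (P i) (P j) * q1 = 0"
        unfolding conic_lin_def conic_thru_def by algebra+
      then show False using ek[of i j] that 2 by auto
    qed
    have "(det3 x (P 6) (P 7) = 0 \<and> det3 (P 5) x (P 7) = 0) \<or> (det3 x (P 6) (P 7) = 0 \<and> det3 (P 5) (P 6) x = 0)
      \<or> (det3 (P 5) x (P 7) = 0 \<and> det3 (P 5) (P 6) x = 0)"
      using n 2 two[of 5 6] two[of 5 7] two[of 6 7] by auto
    then have "(\<exists>c. x = c *s P 5) \<or> (\<exists>c. x = c *s P 6) \<or> (\<exists>c. x = c *s P 7)"
      using x1 by auto
    then show ?thesis by blast
  next
    case 3
    define d where "d = (\<lambda>j. conic_lin P j q0 q1)"
    have dd: "conic_lin P j q0 q1 = d j" for j by (simp add: d_def)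
    have dnz: "d 5 \<noteq> 0" "d 6 \<noteq> 0" "d 7 \<noteq> 0" using n 3 vnz unfolding d_def by auto
    define k where "k = d 5 * d 6 * d 7 * D / s"
    have knz: "k \<noteq> 0" using dnz D 3 by (simp add: k_def)
    have v: "v $ 1 = det3 x (P 6) (P 7) * d 5 / s" "v $ 2 = det3 (P 5) x (P 7) * d 6 / s" "v $ 3 = det3 (P 5) (P 6) x * d 7 / s"
      using n 3 unfolding d_def by (simp_all add: field_simps)
    have "conic_param P q0 q1 = (d 5 * d 6 * d 7 / s) *s (D *s x)"
      unfolding cram conic_param_def v_def[symmetric] dd v by (simp add: vec_eq_iff algebra_simps)
    then have xqk: "conic_param P q0 q1 = k *s x" by (simp add: k_def)
    have conclude: ?thesis if "q0 = t * r0" "q1 = t * r1" "\<exists>c. conic_param P r0 r1 = c *s y" "y = ninth_point P \<or> (\<exists>i\<in>{1, 2, 3, 4, 5, 6, 7, 8}. y = P i)" for t r0 r1 y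
    proof -
      from that(3) obtain c where c: "conic_param P r0 r1 = c *s y" by blast
      have "k *s x = t^2 *s (c *s y)" unfolding xqk[symmetric] that(1,2) conic_param_smult c ..
      then have "x = (t^2 * c / k) *s y" using knz by (simp add: vec_eq_iff field_simps)
      then show ?thesis using that(4) by blast
    qed
    obtain c where c: "c \<noteq> 0" "\<And>q0 q1. c * (conic1 P (conic_param P q0 q1) * q0 - conic0 P (conic_param P q0 q1) * q1)
      = conic_lin P 5 q0 q1 * conic_lin P 6 q0 q1 * conic_lin P 7 q0 q1 * conic_lin P 8 q0 q1 * (ninth_param1 P * q0 - ninth_param0 P * q1)"
      by (rule conic_param_factor[of P]) (use ek con_nz in \<open>auto simp: conic_thru_conic_lin intro: that\<close>)
    have "conic1 P (conic_param P q0 q1) * q0 - conic0 P (conic_param P q0 q1) * q1 = 0"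
      unfolding xqk con_smult unfolding q by simp
    with c(2)[of q0 q1] have "d 5 * d 6 * d 7 * d 8 * (ninth_param1 P * q0 - ninth_param0 P * q1) = 0" unfolding d_def by simp
    \<comment> \<open>The roots of P 5, P 6, P 7 are excluded in this case, which leaves P 8 and the
      ninth point.\<close>
    then consider "d 8 = 0" | "ninth_param1 P * q0 - ninth_param0 P * q1 = 0" using dnz by auto
    then show ?thesis
    proof cases
      case 1
      then have "q0 * conic1 P (P 8) = q1 * conic0 P (P 8)" unfolding d_def conic_lin_def by (simp add: mult.commute)
      moreover have "(conic0 P (P 8), conic1 P (P 8)) \<noteq> (0, 0)" using con_nz[of 8] by auto
      ultimately obtain t where "q0 = t * conic0 P (P 8)" "q1 = t * conic1 P (P 8)" by (rule parallel_pairs)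
      from conclude[OF this conic_param_base(4)] show ?thesis by blast
    next
      case 2
      then have "q0 * ninth_param1 P = q1 * ninth_param0 P" by (simp add: mult.commute)
      from parallel_pairs[OF this h_nz] obtain t where "q0 = t * ninth_param0 P" "q1 = t * ninth_param1 P" .
      moreover have "\<exists>c. conic_param P (ninth_param0 P) (ninth_param1 P) = c *s ninth_point P"
        unfolding ninth_point_def by (rule exI[of _ 1]) simp
      ultimately show ?thesis using conclude by blast
    qed
  qed
qed

end

section \<open>Genericity\<close>

text \<open>Writing cubic_thru P 9 = L1 * conic0 P - L0 * conic1 P with linear forms L0 and L1, this is the
intersection point of the lines L0 = 0 and L1 = 0. Its chords with P 8 and with the ninth base point meet the curve again on
the conics through P 1, ..., P 4 and that point.\<close>
definition coresidual :: "cfg \<Rightarrow> pt" where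
  "coresidual P = (let v = net P (P 8); w = net P (P 9);
      w5 = v $ 2 * w $ 3 - v $ 3 * w $ 2; w6 = v $ 3 * w $ 1 - v $ 1 * w $ 3; w7 = v $ 1 * w $ 2 - v $ 2 * w $ 1 in
    (w6 * w7 * conic_thru P (P 7) (P 6)) *s P 5 + (w7 * w5 * conic_thru P (P 5) (P 7)) *s P 6 + (w5 * w6 * conic_thru P (P 6) (P 5)) *s P 7)"

text \<open>Condition (2) in terms of chords: those of P 8, P 9 and of the ninth point and
  \<open>bar8\<close> meet the cubic again in this point. \<open>chord10\<close> and
  \<open>barq\<close> do the same for condition (3).\<close>

definition chord9 :: "cfg \<Rightarrow> pt" where "chord9 P = third (cubic_thru P 9) (P 8) (P 9)"
definition chord10 :: "cfg \<Rightarrow> pt" where "chord10 P = third (cubic_thru P 10) (P 8) (P 10)"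
definition bar8 :: "cfg \<Rightarrow> pt" where "bar8 P = third (cubic_thru P 9) (ninth_point P) (chord9 P)"
definition barq :: "cfg \<Rightarrow> pt" where "barq P = third (cubic_thru P 10) (ninth_point P) (chord10 P)"
text \<open>Supplies \<open>x8\<close> of \<open>cremona_half\<close>: a point of the conic with
  chord point \<open>coresidual\<close>. The next definition serves the other half.\<close>

definition conic_residue :: "cfg \<Rightarrow> pt" where "conic_residue P = third (cubic_thru P 9) (P 8) (coresidual P)"
definition conic_residue9 :: "cfg \<Rightarrow> pt" where "conic_residue9 P = third (cubic_thru P 9) (ninth_point P) (coresidual P)"

definition pairs8 :: "(nat \<times> nat) list" where
  "pairs8 = [(1,2),(1,3),(1,4),(1,5),(1,6),(1,7),(1,8),(2,3),(2,4),(2,5),(2,6),(2,7),(2,8),(3,4),(3,5),(3,6),(3,7),(3,8),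
     (4,5),(4,6),(4,7),(4,8),(5,6),(5,7),(5,8),(6,7),(6,8),(7,8)]"

text \<open>What \<open>eight_points\<close> and the two instances of \<open>cremona_half\<close>
  ask for beyond general position, together with what makes chords reversible and the coresidual
  argument work. A list, so that each factor can be treated on its own.\<close>

definition generic_conditions :: "(cfg \<Rightarrow> complex) list" where
  "generic_conditions = [ten_det] @
   map (\<lambda>(i, j) P. conic_thru P (P i) (P j)) [(5,6),(5,7),(5,8),(6,7),(6,8),(7,8),(8,9),(8,10)] @
   map (\<lambda>(i, j) P. det3 (ninth_point P) (P i) (P j)) pairs8 @
   concat (map (\<lambda>V. (\<lambda>P. det3 (P 1) (P 2) (V P)) # map (\<lambda>i P. det3 (ninth_point P) (P i) (V P)) [1,2,3,4]) [bar8, barq]) @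
   map (\<lambda>V P. conic_thru P (ninth_point P) (V P)) [\<lambda>P. P 5, \<lambda>P. P 6, \<lambda>P. P 7, bar8, barq] @
   concat (map (\<lambda>j. concat (map (\<lambda>V. [\<lambda>P. det3 (P 8) (P j) (V P), \<lambda>P. det3 (ninth_point P) (P j) (V P)]) [coresidual, chord9, chord10])) [5,6,7]) @
   concat (map (\<lambda>V. map (\<lambda>i P. polar1 (cubic_thru P 10) (V P) (P i) * polar2 (cubic_thru P 9) (V P) (P i)
       - polar1 (cubic_thru P 9) (V P) (P i) * polar2 (cubic_thru P 10) (V P) (P i)) [1,2,3,4]) [\<lambda>P. P 8, ninth_point]) @
   concat (map (\<lambda>(V, X). [\<lambda>P. det3 (P 1) (P 2) (X P), \<lambda>P. det3 (P 3) (X P) (V P), \<lambda>P. det3 (P 4) (X P) (V P), \<lambda>P. cubic_thru P 10 (X P),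
       \<lambda>P. det3 (cubic_map P (V P) (P 5)) (cubic_map P (V P) (P 6)) (cubic_map P (V P) (P 7)), \<lambda>P. polar1 (cubic_thru P 9) (V P) (coresidual P), \<lambda>P. polar2 (cubic_thru P 9) (V P) (coresidual P)])
       [(\<lambda>P. P 8, conic_residue), (ninth_point, conic_residue9)]) @
   [\<lambda>P. polar1 (cubic_thru P 9) (ninth_point P) (chord9 P), \<lambda>P. polar1 (cubic_thru P 10) (ninth_point P) (chord10 P), \<lambda>P. cubic_thru P 10 (bar8 P), \<lambda>P. cubic_thru P 9 (barq P)]"

definition generic_poly :: "cfg \<Rightarrow> complex" where
  "generic_poly P = prod_list (map (\<lambda>c. c P) generic_conditions)"

section \<open>Polynomiality of the genericity conditions\<close>

definition poly_vec :: "(cfg \<Rightarrow> pt) \<Rightarrow> bool" where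
  "poly_vec V \<longleftrightarrow> (\<forall>l. (\<lambda>P. V P $ l) \<in> cfg_poly)"

lemma cfg_poly_diff: "f \<in> cfg_poly \<Longrightarrow> g \<in> cfg_poly \<Longrightarrow> (\<lambda>P. f P - g P) \<in> cfg_poly"
  using cfg_poly.add[OF _ cfg_poly.mult[OF cfg_poly.const[of "-1"]], of f g] by simp

lemma cfg_poly_half: "f \<in> cfg_poly \<Longrightarrow> (\<lambda>P. f P / 2) \<in> cfg_poly"
  using cfg_poly.mult[OF cfg_poly.const[of "1/2"], of f] by simp

lemmas cfg_poly_intros = cfg_poly.add cfg_poly.mult cfg_poly_diff cfg_poly_half

lemma poly_vec_comp: "poly_vec V \<Longrightarrow> (\<lambda>P. V P $ l) \<in> cfg_poly"
  by (simp add: poly_vec_def)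

lemma poly_vec_P: "i \<in> {1..10} \<Longrightarrow> poly_vec (\<lambda>P. P i)"
  unfolding poly_vec_def by (auto intro: cfg_poly.coord)

lemma poly_vec_add: "poly_vec V \<Longrightarrow> poly_vec W \<Longrightarrow> poly_vec (\<lambda>P. V P + W P)"
  unfolding poly_vec_def by (simp add: cfg_poly.add)

lemma poly_vec_diff: "poly_vec V \<Longrightarrow> poly_vec W \<Longrightarrow> poly_vec (\<lambda>P. V P - W P)"
  unfolding poly_vec_def by (simp add: cfg_poly_diff)

lemma poly_vec_smult: "c \<in> cfg_poly \<Longrightarrow> poly_vec W \<Longrightarrow> poly_vec (\<lambda>P. c P *s W P)"
  unfolding poly_vec_def by (simp add: cfg_poly.mult)

lemma poly_vec_vector: "f \<in> cfg_poly \<Longrightarrow> g \<in> cfg_poly \<Longrightarrow> h \<in> cfg_poly \<Longrightarrow> poly_vec (\<lambda>P. vector [f P, g P, h P])"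
  unfolding poly_vec_def by (simp add: forall_3)

lemma cfg_poly_det3: "poly_vec U \<Longrightarrow> poly_vec V \<Longrightarrow> poly_vec W \<Longrightarrow> (\<lambda>P. det3 (U P) (V P) (W P)) \<in> cfg_poly"
  unfolding det3_def by (intro cfg_poly_intros poly_vec_comp)

lemma cfg_poly_con:
  assumes "poly_vec U" shows "(\<lambda>P. conic0 P (U P)) \<in> cfg_poly" "(\<lambda>P. conic1 P (U P)) \<in> cfg_poly"
  unfolding conic0_def conic1_def by (intro cfg_poly_intros cfg_poly_det3 poly_vec_P assms; simp)+

lemma cfg_poly_conic_thru: "poly_vec U \<Longrightarrow> poly_vec V \<Longrightarrow> (\<lambda>P. conic_thru P (U P) (V P)) \<in> cfg_poly"
  unfolding conic_thru_def by (intro cfg_poly_intros cfg_poly_con)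

lemma poly_vec_cubic_map: "poly_vec U \<Longrightarrow> poly_vec V \<Longrightarrow> poly_vec (\<lambda>P. cubic_map P (U P) (V P))"
  unfolding cubic_map_def by (intro poly_vec_vector cfg_poly_intros cfg_poly_det3 cfg_poly_conic_thru poly_vec_P; simp)

lemma poly_vec_net: "poly_vec U \<Longrightarrow> poly_vec (\<lambda>P. net P (U P))"
  unfolding net_def by (intro poly_vec_vector cfg_poly_intros cfg_poly_det3 cfg_poly_conic_thru poly_vec_P; simp)

lemma cfg_poly_cubic_thru: "poly_vec U \<Longrightarrow> m \<in> {1..10} \<Longrightarrow> (\<lambda>P. cubic_thru P m (U P)) \<in> cfg_poly"
  unfolding cubic_thru_def by (intro cfg_poly_det3 poly_vec_net poly_vec_P; simp)

lemma cfg_poly_polar1: "poly_vec U \<Longrightarrow> poly_vec V \<Longrightarrow> m \<in> {1..10} \<Longrightarrow> (\<lambda>P. polar1 (cubic_thru P m) (U P) (V P)) \<in> cfg_poly"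
  unfolding polar1_def by (intro cfg_poly_intros cfg_poly_cubic_thru poly_vec_add poly_vec_diff)

lemma cfg_poly_polar2: "poly_vec U \<Longrightarrow> poly_vec V \<Longrightarrow> m \<in> {1..10} \<Longrightarrow> (\<lambda>P. polar2 (cubic_thru P m) (U P) (V P)) \<in> cfg_poly"
  unfolding polar2_def by (intro cfg_poly_intros cfg_poly_cubic_thru poly_vec_add poly_vec_diff)

lemma poly_vec_third: "poly_vec U \<Longrightarrow> poly_vec V \<Longrightarrow> m \<in> {1..10} \<Longrightarrow> poly_vec (\<lambda>P. third (cubic_thru P m) (U P) (V P))"
  unfolding third_def by (intro poly_vec_diff poly_vec_smult cfg_poly_polar1 cfg_poly_polar2)

lemma cfg_poly_conic_lin: "q0 \<in> cfg_poly \<Longrightarrow> q1 \<in> cfg_poly \<Longrightarrow> j \<in> {1..10} \<Longrightarrow> (\<lambda>P. conic_lin P j (q0 P) (q1 P)) \<in> cfg_poly"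
  unfolding conic_lin_def by (intro cfg_poly_intros cfg_poly_con poly_vec_P)

lemma poly_vec_conic_param: "q0 \<in> cfg_poly \<Longrightarrow> q1 \<in> cfg_poly \<Longrightarrow> poly_vec (\<lambda>P. conic_param P (q0 P) (q1 P))"
  unfolding conic_param_def by (intro poly_vec_add poly_vec_smult cfg_poly_intros cfg_poly_conic_lin poly_vec_P poly_vec_comp poly_vec_net; simp)

lemma cfg_poly_h: "ninth_param0 \<in> cfg_poly" "ninth_param1 \<in> cfg_poly"
proof -
  have "(\<lambda>P. conic0 P (conic_param P 0 1) * (conic1 P (P 5) * conic1 P (P 6) * conic1 P (P 7) * conic1 P (P 8))) \<in> cfg_poly"
    "(\<lambda>P. conic1 P (conic_param P 1 0) * (conic0 P (P 5) * conic0 P (P 6) * conic0 P (P 7) * conic0 P (P 8))) \<in> cfg_poly"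
    by (intro cfg_poly.mult cfg_poly_con poly_vec_conic_param poly_vec_P cfg_poly.const; simp)+
  then show "ninth_param0 \<in> cfg_poly" "ninth_param1 \<in> cfg_poly" by (simp_all add: ninth_param0_def[abs_def] ninth_param1_def[abs_def])
qed

lemma poly_vec_ninth_point: "poly_vec ninth_point"
  unfolding ninth_point_def[abs_def] by (intro poly_vec_conic_param cfg_poly_h)

lemma poly_vec_coresidual: "poly_vec coresidual"
  unfolding coresidual_def[abs_def] Let_def
  by (intro poly_vec_add poly_vec_smult cfg_poly_intros cfg_poly_conic_thru poly_vec_P poly_vec_comp poly_vec_net; simp)

lemma poly_vec_data: "poly_vec chord9" "poly_vec chord10" "poly_vec bar8" "poly_vec barq" "poly_vec conic_residue" "poly_vec conic_residue9"
proof -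
  show 1: "poly_vec chord9" "poly_vec chord10" unfolding chord9_def[abs_def] chord10_def[abs_def] by (intro poly_vec_third poly_vec_P; simp)+
  show "poly_vec bar8" "poly_vec barq" unfolding bar8_def[abs_def] barq_def[abs_def] by (intro poly_vec_third poly_vec_ninth_point 1; simp)+
  show "poly_vec conic_residue" "poly_vec conic_residue9" unfolding conic_residue_def[abs_def] conic_residue9_def[abs_def] by (intro poly_vec_third poly_vec_P poly_vec_ninth_point poly_vec_coresidual; simp)+
qed

lemma generic_conditions_poly: "c \<in> set generic_conditions \<Longrightarrow> c \<in> cfg_poly"
proof -
  have ten_det: "ten_det \<in> cfg_poly" unfolding ten_det_def[abs_def] by (intro cfg_poly_det3 poly_vec_net poly_vec_P; simp)
  have "list_all (\<lambda>c. c \<in> cfg_poly) generic_conditions"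
    unfolding generic_conditions_def pairs8_def list.map concat.simps append.simps list.pred_inject prod.case
    by (intro conjI TrueI ten_det cfg_poly_intros cfg_poly_conic_thru cfg_poly_det3 cfg_poly_cubic_thru cfg_poly_polar1 cfg_poly_polar2 poly_vec_cubic_map
      poly_vec_ninth_point poly_vec_coresidual poly_vec_data poly_vec_P; simp)
  then show "c \<in> set generic_conditions \<Longrightarrow> c \<in> cfg_poly" by (simp add: list_all_iff)
qed

lemma generic_poly_poly: "generic_poly \<in> cfg_poly"
proof -
  have "(\<And>c. c \<in> set cs \<Longrightarrow> c \<in> cfg_poly) \<Longrightarrow> (\<lambda>P. prod_list (map (\<lambda>c. c P) cs)) \<in> cfg_poly" for cs
    by (induction cs) (auto intro: cfg_poly.const cfg_poly.mult)
  from this[OF generic_conditions_poly] show ?thesis unfolding generic_poly_def[abs_def] .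
qed

lemma generic_poly_nz: "generic_poly P \<noteq> 0 \<longleftrightarrow> (\<forall>c\<in>set generic_conditions. c P \<noteq> 0)"
  unfolding generic_poly_def by (auto simp: prod_list_zero_iff)

section \<open>Scaling, symmetry and uniqueness of third points\<close>

lemma is_cubic_smult: "is_cubic F \<Longrightarrow> F (c *s x) = c ^ 3 * F x"
  unfolding is_cubic_def by (auto simp: cubic_eval_expand algebra_simps power2_eq_square power3_eq_cube)

lemma third_smult2:
  assumes F: "is_cubic F" "F p = 0" "F q = 0"
  shows "third F (c *s p) (d *s q) = (c^2 * d^2) *s third F p q" "polar1 F (c *s p) (d *s q) = c^2 * d * polar1 F p q"
    "polar2 F (c *s p) (d *s q) = c * d^2 * polar2 F p q"
proof -
  have L: "F (s *s (c *s p) + t *s (d *s q)) = s * t * ((c^2 * d * polar1 F p q) * s + (c * d^2 * polar2 F p q) * t)" for s t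
    using line_expand[OF F, of "s * c" "t * d"] by (simp add: algebra_simps power2_eq_square)
  note e = polar_line[OF L]
  show "polar1 F (c *s p) (d *s q) = c^2 * d * polar1 F p q" "polar2 F (c *s p) (d *s q) = c * d^2 * polar2 F p q" by (rule e)+
  show "third F (c *s p) (d *s q) = (c^2 * d^2) *s third F p q"
    unfolding third_def e by (simp add: vec_eq_iff algebra_simps power2_eq_square)
qed

lemma third_swap:
  assumes "is_cubic F" "F p = 0" "F q = 0"
  shows "third F q p = - third F p q" "polar1 F q p = polar2 F p q" "polar2 F q p = polar1 F p q"
proof -
  have L: "F (s *s q + t *s p) = s * t * (polar2 F p q * s + polar1 F p q * t)" for s t
    using line_expand[OF assms, of t s] by (simp add: algebra_simps)
  note e = polar_line[OF L]
  show "polar1 F q p = polar2 F p q" "polar2 F q p = polar1 F p q" by (rule e)+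
  show "third F q p = - third F p q" unfolding third_def e by simp
qed

text \<open>Drawing the chord from p twice returns to q. A vanishing \<open>polar1\<close> would
  make the third point a multiple of p.\<close>

lemma third_back:
  assumes F: "is_cubic F" "F p = 0" "F q = 0" and a: "polar1 F p q \<noteq> 0"
  shows "third F p (third F p q) = (- (polar1 F p q ^ 3)) *s q"
proof -
  have "third F q p = (-1) *s third F p q" using third_swap(1)[OF F] by simp
  from third_rot[OF F(1,3,2) _ this] a show ?thesis by (simp add: third_swap(3)[OF F])
qed

lemma smult_eqD:
  fixes x y :: pt
  assumes "c *s x = d *s y" "c \<noteq> 0" shows "x = (d / c) *s y"
proof -
  have "x = inverse c *s (c *s x)" using assms(2) by (simp add: vector_smult_assoc)
  then show ?thesis unfolding assms(1) by (simp add: vector_smult_assoc divide_inverse mult.commute)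
qed

text \<open>Solves conditions (2) and (3) for the unknown point p: once the third point y of its
  chord with b is known, p is the third point on the line b y. The bracket condition keeps y from
  being a multiple of b.\<close>

lemma third_unique:
  assumes F: "is_cubic F" "F p = 0" "F b = 0" and p: "p \<noteq> 0" and k: "k \<noteq> 0" and c: "c \<noteq> 0"
    and t: "third F p (k *s b) = c *s y" and d: "det3 b u y \<noteq> 0"
  shows "proj_eq (third F b y) p"
proof -
  have q: "F (k *s b) = 0" using F by (simp add: is_cubic_smult)
  have "F (c *s y) = 0" using third_F[OF F(1,2) q] t by simp
  then have y: "F y = 0" using F(1) c by (simp add: is_cubic_smult)
  have polar2: "polar2 F p (k *s b) \<noteq> 0"
  proof
    assume "polar2 F p (k *s b) = 0"
    then have e: "(- polar1 F p (k *s b) * k) *s b = c *s y" using t by (simp add: third_def)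
    have "c * det3 b u y = det3 b u (c *s y)" by (simp add: det3_smult)
    also have "\<dots> = 0" unfolding e[symmetric] by (simp only: det3_smult det3_same mult_zero_right)
    finally show False using c d by simp
  qed
  have "k^2 *s third F b y = (- (polar2 F p (k *s b) ^ 3 / c ^ 2)) *s p"
    using third_rot[OF F(1,2) q polar2 t c] third_smult2(1)[OF F(1,3) y, of k 1] by simp
  then have "third F b y = (- (polar2 F p (k *s b) ^ 3 / c ^ 2) / k^2) *s p"
    by (rule smult_eqD) (use k in simp)
  moreover have "- (polar2 F p (k *s b) ^ 3 / c ^ 2) / k^2 \<noteq> 0" using polar2 c k by simp
  ultimately show ?thesis using p proj_eq_smult by metis
qed

text \<open>The coefficients \<alpha>, \<beta> in the relation are unique, namely the two polars, so
  the relation becomes a function up to scaling.\<close>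

lemma third_point_iff:
  "third_point c p q r \<longleftrightarrow> p \<noteq> 0 \<and> q \<noteq> 0 \<and> \<not> proj_eq p q \<and> cubic_eval c p = 0 \<and> cubic_eval c q = 0 \<and>
     proj_eq r (third (cubic_eval c) p q)"
proof
  assume "third_point c p q r"
  then obtain \<alpha> \<beta> where h: "p \<noteq> 0" "q \<noteq> 0" "\<not> proj_eq p q"
    "\<And>s t. cubic_eval c (s *s p + t *s q) = s * t * (\<alpha> * s + \<beta> * t)" "proj_eq r (\<beta> *s p - \<alpha> *s q)"
    unfolding third_point_def by blast
  have "cubic_eval c p = 0" "cubic_eval c q = 0" using h(4)[of 1 0] h(4)[of 0 1] by simp_all
  with h polar_line[OF h(4)] show "p \<noteq> 0 \<and> q \<noteq> 0 \<and> \<not> proj_eq p q \<and> cubic_eval c p = 0 \<and> cubic_eval c q = 0 \<and>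
     proj_eq r (third (cubic_eval c) p q)" by (simp add: third_def)
next
  assume h: "p \<noteq> 0 \<and> q \<noteq> 0 \<and> \<not> proj_eq p q \<and> cubic_eval c p = 0 \<and> cubic_eval c q = 0 \<and>
     proj_eq r (third (cubic_eval c) p q)"
  have L: "cubic_eval c (s *s p + t *s q) = s * t * (polar1 (cubic_eval c) p q * s + polar2 (cubic_eval c) p q * t)" for s t
    by (rule line_expand) (use h in \<open>auto simp: is_cubic_def\<close>)
  have "third (cubic_eval c) p q \<noteq> 0" using h by (auto simp: proj_eq_def)
  then have "(polar1 (cubic_eval c) p q, polar2 (cubic_eval c) p q) \<noteq> (0, 0)" by (auto simp: third_def)
  then have "\<exists>\<alpha> \<beta>. (\<alpha>, \<beta>) \<noteq> (0, 0) \<and> (\<forall>s t. cubic_eval c (s *s p + t *s q) = s * t * (\<alpha> * s + \<beta> * t)) \<and>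
      proj_eq r (\<beta> *s p - \<alpha> *s q)"
    by (rule exI[of _ "polar1 (cubic_eval c) p q", OF exI[of _ "polar2 (cubic_eval c) p q"], OF conjI])
      (use h L in \<open>simp add: third_def\<close>)
  with h show "third_point c p q r" unfolding third_point_def by blast
qed

lemma third_scale: "third (\<lambda>x. k * F x) p q = k *s third F p q"
  by (simp add: third_def polar1_def polar2_def vec_eq_iff field_simps)

lemma proj_eq_trans: "proj_eq u v \<Longrightarrow> proj_eq v w \<Longrightarrow> proj_eq u w"
  unfolding proj_eq_def by (auto simp: vector_smult_assoc)

text \<open>Ten points with coordinates 0, 1, -1 suffice to determine the ten coefficients.\<close>

lemma cubic_eval_zero:
  assumes "\<And>x. cubic_eval c x = 0" and "m \<in> mons3"
  shows "c m = 0"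
proof -
  note e = assms(1)[unfolded cubic_eval_expand]
  note v = e[of "vector [X, Y, Z]" for X Y Z, simplified]
  have 1: "c (3,0,0) = 0" "c (0,3,0) = 0" "c (0,0,3) = 0" using v[of 1 0 0] v[of 0 1 0] v[of 0 0 1] by simp_all
  have 2: "c (2,1,0) + c (1,2,0) = 0" "c (1,2,0) - c (2,1,0) = 0 \<or> c (2,1,0) - c (1,2,0) = 0"
    "c (2,0,1) + c (1,0,2) = 0" "c (1,0,2) - c (2,0,1) = 0 \<or> c (2,0,1) - c (1,0,2) = 0"
    "c (0,2,1) + c (0,1,2) = 0" "c (0,1,2) - c (0,2,1) = 0 \<or> c (0,2,1) - c (0,1,2) = 0"
    using v[of 1 1 0] v[of 1 "-1" 0] v[of 1 0 1] v[of 1 0 "-1"] v[of 0 1 1] v[of 0 1 "-1"] 1 by (simp_all add: algebra_simps)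
  have z: "a = 0 \<and> b = 0" if "a + b = 0" "b - a = 0 \<or> a - b = 0" for a b :: complex
    using that by (auto simp: add_eq_0_iff)
  note z2 = z[OF 2(1,2)] z[OF 2(3,4)] z[OF 2(5,6)]
  have "c (1,1,1) = 0" using v[of 1 1 1] 1 z2 by simp
  with 1 z2 assms(2) show ?thesis unfolding mons3_eq by auto
qed

lemma generic_poly_facts:
  assumes "generic_poly P \<noteq> 0"
  shows "ten_det P \<noteq> 0"
   "\<And>i j. (i, j) \<in> set [(5,6),(5,7),(5,8),(6,7),(6,8),(7,8),(8,9),(8,10)] \<Longrightarrow> conic_thru P (P i) (P j) \<noteq> 0"
   "\<And>i j. (i, j) \<in> set pairs8 \<Longrightarrow> det3 (ninth_point P) (P i) (P j) \<noteq> 0"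
   "\<And>V i. V \<in> {bar8, barq} \<Longrightarrow> det3 (P 1) (P 2) (V P) \<noteq> 0"
   "\<And>V i. V \<in> {bar8, barq} \<Longrightarrow> i \<in> {1, 2, 3, 4} \<Longrightarrow> det3 (ninth_point P) (P i) (V P) \<noteq> 0"
   "\<And>i. i \<in> {5, 6, 7} \<Longrightarrow> conic_thru P (ninth_point P) (P i) \<noteq> 0" "conic_thru P (ninth_point P) (bar8 P) \<noteq> 0" "conic_thru P (ninth_point P) (barq P) \<noteq> 0"
   "\<And>V j. V \<in> {coresidual, chord9, chord10} \<Longrightarrow> j \<in> {5, 6, 7} \<Longrightarrow> det3 (P 8) (P j) (V P) \<noteq> 0"
   "\<And>V j. V \<in> {coresidual, chord9, chord10} \<Longrightarrow> j \<in> {5, 6, 7} \<Longrightarrow> det3 (ninth_point P) (P j) (V P) \<noteq> 0"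
   "\<And>V i. V \<in> {\<lambda>P. P 8, ninth_point} \<Longrightarrow> i \<in> {1, 2, 3, 4} \<Longrightarrow> polar1 (cubic_thru P 10) (V P) (P i) * polar2 (cubic_thru P 9) (V P) (P i)
       - polar1 (cubic_thru P 9) (V P) (P i) * polar2 (cubic_thru P 10) (V P) (P i) \<noteq> 0"
   "\<And>V X. (V, X) \<in> {(\<lambda>P. P 8, conic_residue), (ninth_point, conic_residue9)} \<Longrightarrow> det3 (P 1) (P 2) (X P) \<noteq> 0 \<and> det3 (P 3) (X P) (V P) \<noteq> 0
       \<and> det3 (P 4) (X P) (V P) \<noteq> 0 \<and> cubic_thru P 10 (X P) \<noteq> 0 \<and> det3 (cubic_map P (V P) (P 5)) (cubic_map P (V P) (P 6)) (cubic_map P (V P) (P 7)) \<noteq> 0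
       \<and> polar1 (cubic_thru P 9) (V P) (coresidual P) \<noteq> 0 \<and> polar2 (cubic_thru P 9) (V P) (coresidual P) \<noteq> 0"
   "polar1 (cubic_thru P 9) (ninth_point P) (chord9 P) \<noteq> 0" "polar1 (cubic_thru P 10) (ninth_point P) (chord10 P) \<noteq> 0" "cubic_thru P 10 (bar8 P) \<noteq> 0" "cubic_thru P 9 (barq P) \<noteq> 0"
proof -
  note c = assms[unfolded generic_poly_nz generic_conditions_def set_append ball_Un set_map set_concat ball_simps]
  show "ten_det P \<noteq> 0" using c by simp
  from c have "\<forall>x\<in>set [(5,6),(5,7),(5,8),(6,7),(6,8),(7,8),(8,9),(8,10)]. (case x of (i, j) \<Rightarrow> \<lambda>P. conic_thru P (P i) (P j)) P \<noteq> 0" by (elim conjE)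
  then show "\<And>i j. (i, j) \<in> set [(5,6),(5,7),(5,8),(6,7),(6,8),(7,8),(8,9),(8,10)] \<Longrightarrow> conic_thru P (P i) (P j) \<noteq> 0" by fast
  from c have "\<forall>x\<in>set pairs8. (case x of (i, j) \<Rightarrow> \<lambda>P. det3 (ninth_point P) (P i) (P j)) P \<noteq> 0" by (elim conjE)
  then show "\<And>i j. (i, j) \<in> set pairs8 \<Longrightarrow> det3 (ninth_point P) (P i) (P j) \<noteq> 0" by fast
  show "\<And>V i. V \<in> {bar8, barq} \<Longrightarrow> det3 (P 1) (P 2) (V P) \<noteq> 0"
   "\<And>V i. V \<in> {bar8, barq} \<Longrightarrow> i \<in> {1, 2, 3, 4} \<Longrightarrow> det3 (ninth_point P) (P i) (V P) \<noteq> 0"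
   "\<And>i. i \<in> {5, 6, 7} \<Longrightarrow> conic_thru P (ninth_point P) (P i) \<noteq> 0" "conic_thru P (ninth_point P) (bar8 P) \<noteq> 0" "conic_thru P (ninth_point P) (barq P) \<noteq> 0"
   "\<And>V j. V \<in> {coresidual, chord9, chord10} \<Longrightarrow> j \<in> {5, 6, 7} \<Longrightarrow> det3 (P 8) (P j) (V P) \<noteq> 0"
   "\<And>V j. V \<in> {coresidual, chord9, chord10} \<Longrightarrow> j \<in> {5, 6, 7} \<Longrightarrow> det3 (ninth_point P) (P j) (V P) \<noteq> 0"
   "\<And>V i. V \<in> {\<lambda>P. P 8, ninth_point} \<Longrightarrow> i \<in> {1, 2, 3, 4} \<Longrightarrow> polar1 (cubic_thru P 10) (V P) (P i) * polar2 (cubic_thru P 9) (V P) (P i)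
       - polar1 (cubic_thru P 9) (V P) (P i) * polar2 (cubic_thru P 10) (V P) (P i) \<noteq> 0"
   "\<And>V X. (V, X) \<in> {(\<lambda>P. P 8, conic_residue), (ninth_point, conic_residue9)} \<Longrightarrow> det3 (P 1) (P 2) (X P) \<noteq> 0 \<and> det3 (P 3) (X P) (V P) \<noteq> 0
       \<and> det3 (P 4) (X P) (V P) \<noteq> 0 \<and> cubic_thru P 10 (X P) \<noteq> 0 \<and> det3 (cubic_map P (V P) (P 5)) (cubic_map P (V P) (P 6)) (cubic_map P (V P) (P 7)) \<noteq> 0
       \<and> polar1 (cubic_thru P 9) (V P) (coresidual P) \<noteq> 0 \<and> polar2 (cubic_thru P 9) (V P) (coresidual P) \<noteq> 0"
   "polar1 (cubic_thru P 9) (ninth_point P) (chord9 P) \<noteq> 0" "polar1 (cubic_thru P 10) (ninth_point P) (chord10 P) \<noteq> 0" "cubic_thru P 10 (bar8 P) \<noteq> 0" "cubic_thru P 9 (barq P) \<noteq> 0"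
    using c by (auto simp del: One_nat_def)
qed

section \<open>The theorem for generic configurations\<close>

lemma conic_thru_swap: "conic_thru P x y = - conic_thru P y x"
  by (simp add: conic_thru_def)

text \<open>On the line through a and the coresidual, the linear forms L0, L1 of the cubic scale
  with the coordinate s of a alone, and at a they are proportional to the two conics. So the cubic
  restricted to this line is s times \<open>conic_thru P a\<close> up to a constant, and its third
  point lies on that conic.\<close>

lemma coresidual_conic:
  assumes F: "is_cubic (cubic_thru P 9)" and a: "cubic_thru P 9 a = 0" and c: "conic1 P a \<noteq> 0" and polar2: "polar2 (cubic_thru P 9) a (coresidual P) \<noteq> 0"
  shows "cubic_thru P 9 (coresidual P) = 0" "conic_thru P a (third (cubic_thru P 9) a (coresidual P)) = 0"
proof -
  define v w where vw: "v = net P (P 8)" "w = net P (P 9)"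
  define w5 w6 w7 where ww: "w5 = v $ 2 * w $ 3 - v $ 3 * w $ 2" "w6 = v $ 3 * w $ 1 - v $ 1 * w $ 3" "w7 = v $ 1 * w $ 2 - v $ 2 * w $ 1"
  define L0 where "L0 = (\<lambda>x. w5 * conic0 P (P 5) * det3 x (P 6) (P 7) + w6 * conic0 P (P 6) * det3 (P 5) x (P 7) + w7 * conic0 P (P 7) * det3 (P 5) (P 6) x)"
  define L1 where "L1 = (\<lambda>x. w5 * conic1 P (P 5) * det3 x (P 6) (P 7) + w6 * conic1 P (P 6) * det3 (P 5) x (P 7) + w7 * conic1 P (P 7) * det3 (P 5) (P 6) x)"
  have FL: "cubic_thru P 9 x = L1 x * conic0 P x - L0 x * conic1 P x" for x
    unfolding cubic_thru_def vw[symmetric] det3_def[of "net P x" v w] L0_def L1_def ww unfolding net_def[of P x] conic_thru_def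
    by (simp add: algebra_simps)
  define n where "n = coresidual P"
  have n: "n = (w6 * w7 * conic_thru P (P 7) (P 6)) *s P 5 + (w7 * w5 * conic_thru P (P 5) (P 7)) *s P 6 + (w5 * w6 * conic_thru P (P 6) (P 5)) *s P 7"
    unfolding n_def coresidual_def Let_def vw[symmetric] ww ..
  have L: "L0 n = 0" "L1 n = 0"
    unfolding L0_def L1_def n det3_add det3_smult conic_thru_def by (simp_all add: algebra_simps)
  show Fn: "cubic_thru P 9 (coresidual P) = 0" using L FL[of n] unfolding n_def by simp
  have lin: "L0 (s *s a + t *s n) = s * L0 a" "L1 (s *s a + t *s n) = s * L1 a" for s t
  proof -
    have "L0 (s *s a + t *s n) = s * L0 a + t * L0 n" "L1 (s *s a + t *s n) = s * L1 a + t * L1 n"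
      unfolding L0_def L1_def det3_add det3_smult by (simp_all add: algebra_simps)
    then show "L0 (s *s a + t *s n) = s * L0 a" "L1 (s *s a + t *s n) = s * L1 a" using L by simp_all
  qed
  have K: "conic1 P a * cubic_thru P 9 (s *s a + t *s n) = s * L1 a * conic_thru P a (s *s a + t *s n)" for s t
  proof -
    have "conic1 P a * L0 a = L1 a * conic0 P a" using FL[of a] a by (simp add: mult.commute)
    then show ?thesis unfolding FL lin conic_thru_def by algebra
  qed
  have x: "third (cubic_thru P 9) a n = polar2 (cubic_thru P 9) a n *s a + (- polar1 (cubic_thru P 9) a n) *s n" by (simp add: third_def)
  \<comment> \<open>Otherwise the whole line would lie on the cubic, against the nonzero
    \<open>polar2\<close>.\<close>
  have "L1 a \<noteq> 0"
  proof
    assume "L1 a = 0"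
    then have z: "cubic_thru P 9 (s *s a + t *s n) = 0" for s t using K[of s t] c by simp
    have "polar2 (cubic_thru P 9) a n = 0" unfolding polar2_def using z[of 1 1] z[of 1 "-1"] by simp
    with polar2 show False unfolding n_def by simp
  qed
  moreover have "cubic_thru P 9 (third (cubic_thru P 9) a n) = 0" using third_F[OF F a Fn] unfolding n_def .
  ultimately show "conic_thru P a (third (cubic_thru P 9) a (coresidual P)) = 0"
    using K[of "polar2 (cubic_thru P 9) a n" "- polar1 (cubic_thru P 9) a n", folded x] polar2 unfolding n_def by simp
qed

text \<open>Existence is shown by \<open>bar8\<close>, \<open>ninth_point\<close> and
  \<open>barq\<close>. Conversely every solution of the three conditions agrees with them
  projectively, so the conclusions proved for them carry over.\<close>

lemma theorem6_generic:
  assumes gp10: "gen_pos 10 P" and f: "generic_poly P \<noteq> 0" and C0: "smooth_cubic C0" and C: "smooth_cubic C"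
    and on0: "\<And>i. i \<in> {1..9} \<Longrightarrow> on_curve C0 (P i)" and on1: "\<And>i. i \<in> {1..8} \<Longrightarrow> on_curve C (P i)" "on_curve C (P 10)"
  shows "\<exists>p8' p9' q'. on_curve C0 p8' \<and> on_curve C0 p9' \<and> on_curve C q' \<and>
          pencil_base_points [P 1, P 2, P 3, P 4, P 5, P 6, P 7, P 8, p9'] \<and>
          cubic_sum_eq C0 p8' p9' (P 8) (P 9) \<and> cubic_sum_eq C p9' q' (P 8) (P 10)" (is ?ex)
    and "on_curve C0 p8' \<Longrightarrow> on_curve C0 p9' \<Longrightarrow> on_curve C q' \<Longrightarrow>
          pencil_base_points [P 1, P 2, P 3, P 4, P 5, P 6, P 7, P 8, p9'] \<Longrightarrow>
          cubic_sum_eq C0 p8' p9' (P 8) (P 9) \<Longrightarrow> cubic_sum_eq C p9' q' (P 8) (P 10)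
        \<Longrightarrow> T89_rel P (\<lambda>m. if m = 8 then p8' else if m = 9 then p9' else if m = 10 then q' else P m) \<and>
          (\<forall>x. (on_curve C0 x \<and> on_curve C x) \<longleftrightarrow> ((\<exists>i\<in>{1..8}. proj_eq x (P i)) \<or> proj_eq x p9'))"
proof -
  note ff = generic_poly_facts[OF f]
  have set8: "{1..8::nat} = {1, 2, 3, 4, 5, 6, 7, 8}" by (simp add: atLeastAtMost_upt set_upt[symmetric] upt_rec del: set_upt) auto
  have set9: "{1..9::nat} = {1, 2, 3, 4, 5, 6, 7, 8, 9}" by (simp add: atLeastAtMost_upt set_upt[symmetric] upt_rec del: set_upt) auto
  define b where "b = ninth_point P"
  define F where "F = cubic_thru P 9"
  define G where "G = cubic_thru P 10"
  have gpt: "det3 (P i) (P j) (P k) \<noteq> 0" if "i \<in> {1..10}" "j \<in> {1..10}" "k \<in> {1..10}" "i \<noteq> j" "j \<noteq> k" "i \<noteq> k" for i j k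
    using gp10 that unfolding gen_pos_def by blast
  have gp8: "det3 (P i) (P j) (P k) \<noteq> 0" if "i \<in> {1, 2, 3, 4, 5, 6, 7, 8}" "j \<in> {1, 2, 3, 4, 5, 6, 7, 8}" "k \<in> {1, 2, 3, 4, 5, 6, 7, 8}" "i \<noteq> j" "j \<noteq> k" "i \<noteq> k" for i j k
  proof -
    have s: "{1, 2, 3, 4, 5, 6, 7, 8} \<subseteq> {1..10::nat}" by simp
    show ?thesis by (rule gpt[OF subsetD[OF s that(1)] subsetD[OF s that(2)] subsetD[OF s that(3)] that(4-6)])
  qed
  have gb: "det3 b (P i) (P j) \<noteq> 0" if "i \<in> {1, 2, 3, 4, 5, 6, 7, 8}" "j \<in> {1, 2, 3, 4, 5, 6, 7, 8}" "i \<noteq> j" for i j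
  proof -
    have "\<forall>i\<in>{1, 2, 3, 4, 5, 6, 7, 8}. \<forall>j\<in>{1, 2, 3, 4, 5, 6, 7, 8}. i \<noteq> j \<longrightarrow> (i, j) \<in> set pairs8 \<or> (j, i) \<in> set pairs8"
      by (simp add: pairs8_def)
    with that have "(i, j) \<in> set pairs8 \<or> (j, i) \<in> set pairs8" by blast
    then show ?thesis using ff(3)[of i j] ff(3)[of j i] det3_nz_perm[of b] unfolding b_def by blast
  qed
  have ek: "conic_thru P (P i) (P j) \<noteq> 0" if "i \<in> {5, 6, 7, 8}" "j \<in> {5, 6, 7, 8}" "i \<noteq> j" for i j
  proof -
    have "conic_thru P (P i) (P j) \<noteq> 0 \<or> conic_thru P (P j) (P i) \<noteq> 0" using that ff(2)[of i j] ff(2)[of j i] by auto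
    then show ?thesis using conic_thru_swap[of P "P i" "P j"] by auto
  qed
  have bnz: "b \<noteq> 0" using gb[of 1 2] by auto
  have Pnz: "P i \<noteq> 0" if "i \<in> {1..10}" for i
  proof -
    consider "i = 1" | "i = 2" | "i \<noteq> 1" "i \<noteq> 2" by blast
    then show ?thesis
    proof cases
      case 1 show ?thesis using gpt[of 1 2 3] unfolding 1 by auto
    next
      case 2 show ?thesis using gpt[of 2 1 3] unfolding 2 by auto
    next
      case 3 show ?thesis using gpt[of i 1 2] that 3 by auto
    qed
  qed
  interpret eight_points P
    by standard (use gp8 ek ff(1) bnz in \<open>auto simp: b_def\<close>)
  have FG: "F (P 10) = ten_det P" "G (P 9) = - ten_det P"
    unfolding F_def G_def cubic_thru_def ten_det_def by (simp_all add: det3_def algebra_simps)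
  \<comment> \<open>C0 vanishes at P 1, ..., P 9, so \<open>pencil_eq\<close> makes it a multiple of
    F; it is not the zero form, so the factor is nonzero.\<close>
  obtain k0 where k0: "k0 \<noteq> 0" "cubic_eval C0 = (\<lambda>x. k0 * F x)"
  proof -
    have z: "cubic_eval C0 (P i) = 0" if "i \<in> {1, 2, 3, 4, 5, 6, 7, 8, 9}" for i
      using on0[of i] that unfolding set9 on_curve_def by blast
    have i: "ten_det P * cubic_eval C0 x = cubic_eval C0 (P 10) * F x" for x
      using pencil_eq[of "cubic_eval C0" x] z[of 9] z unfolding F_def by (auto simp: is_cubic_def)
    define k where "k = cubic_eval C0 (P 10) / ten_det P"
    have e: "cubic_eval C0 = (\<lambda>x. k * F x)" using i om by (intro ext) (simp add: k_def field_simps)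
    have "k \<noteq> 0"
    proof
      assume "k = 0"
      then have "cubic_eval C0 x = 0" for x using e by simp
      then show False using cubic_eval_zero[of C0] C0 unfolding smooth_cubic_def by blast
    qed
    with e show ?thesis by (rule that[rotated])
  qed
  obtain k1 where k1: "k1 \<noteq> 0" "cubic_eval C = (\<lambda>x. k1 * G x)"
  proof -
    have z: "cubic_eval C (P i) = 0" if "i \<in> {1, 2, 3, 4, 5, 6, 7, 8}" for i
      using on1(1)[of i] that unfolding set8 on_curve_def by blast
    have z10: "cubic_eval C (P 10) = 0" using on1(2) unfolding on_curve_def by blast
    have i: "ten_det P * cubic_eval C x = - cubic_eval C (P 9) * G x" for x
      using pencil_eq[of "cubic_eval C" x] z10 z unfolding G_def by (auto simp: is_cubic_def)
    define k where "k = - cubic_eval C (P 9) / ten_det P"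
    have e: "cubic_eval C = (\<lambda>x. k * G x)" using i om by (intro ext) (simp add: k_def field_simps)
    have "k \<noteq> 0"
    proof
      assume "k = 0"
      then have "cubic_eval C x = 0" for x using e by simp
      then show False using cubic_eval_zero[of C] C unfolding smooth_cubic_def by blast
    qed
    with e show ?thesis by (rule that[rotated])
  qed
  \<comment> \<open>F and G are given as determinants; that they are cubic forms is inherited from
    C0 and C.\<close>
  have scale: "is_cubic H" if "k \<noteq> 0" "cubic_eval c = (\<lambda>x. k * H x)" for k c H
  proof -
    have "H x = cubic_eval (\<lambda>m. c m / k) x" for x
    proof -
      have "k * cubic_eval (\<lambda>m. c m / k) x = cubic_eval c x"
        using that(1) unfolding cubic_eval_expand by (simp add: algebra_simps)
      then show ?thesis using that by simp
    qed
    then show ?thesis unfolding is_cubic_def by blast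
  qed
  have cF: "is_cubic F" and cG: "is_cubic G" using scale k0 k1 by blast+
  have z: "F (P i) = 0 \<and> G (P i) = 0" if "i \<in> {1, 2, 3, 4, 5, 6, 7, 8}" for i
    using that cubic_thru_zero(1)[of P] cubic_thru_zero(3)[of _ P] unfolding F_def G_def by auto
  have zb: "F b = 0" "G b = 0" unfolding F_def G_def b_def by (rule ninth_point_zero)+
  have z9: "F (P 9) = 0" "G (P 10) = 0" unfolding F_def G_def by (rule cubic_thru_zero)+
  define y9 where "y9 = chord9 P"
  define y10 where "y10 = chord10 P"
  define n where "n = coresidual P"
  define e8 where "e8 = bar8 P"
  define q where "q = barq P"
  define x8 where "x8 = conic_residue P"
  define x8' where "x8' = conic_residue9 P"
  have t: "third F (P 8) (P 9) = y9" "third G (P 8) (P 10) = y10" "third F b y9 = e8" "third G b y10 = q"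
    "third F (P 8) n = x8" "third F b n = x8'"
    unfolding F_def G_def y9_def y10_def e8_def q_def x8_def x8'_def n_def b_def
    by (simp_all add: chord9_def chord10_def bar8_def barq_def conic_residue_def conic_residue9_def)
  have z8: "F (P 8) = 0" "G (P 8) = 0" using z[of 8] by auto
  have zy: "F y9 = 0" "G y10 = 0" using third_F[OF cF z8(1) z9(1)] third_F[OF cG z8(2) z9(2)] t by simp_all
  have ze: "F e8 = 0" "G q = 0" using third_F[OF cF zb(1) zy(1)] third_F[OF cG zb(2) zy(2)] t by simp_all
  have con1a: "conic1 P (P 8) \<noteq> 0" using con_nz[of 8] by simp
  have con1b: "conic1 P b \<noteq> 0"
    using gb[of 1 3] gb[of 2 4] det3_nz_perm[of b "P 1" "P 3"] det3_nz_perm[of b "P 2" "P 4"] by (simp add: conic1_def)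
  note x8a = ff(12)[of "\<lambda>P. P 8" conic_residue, simplified, folded F_def G_def n_def x8_def, unfolded One_nat_def[symmetric]]
  note x8b = ff(12)[of ninth_point conic_residue9, simplified, folded F_def G_def n_def x8'_def b_def, unfolded One_nat_def[symmetric]]
  have n8: "F n = 0" "conic_thru P (P 8) x8 = 0"
    using coresidual_conic[of P "P 8", folded F_def n_def, OF cF z8(1) con1a] x8a t by simp_all
  have nb8: "conic_thru P b x8' = 0"
    using coresidual_conic(2)[of P b, folded F_def n_def, OF cF zb(1) con1b] x8b t by simp
  have zx: "F x8 = 0" "F x8' = 0" using third_F[OF cF z8(1) n8(1)] third_F[OF cF zb(1) n8(1)] t by simp_all
  \<comment> \<open>Reversing the chords gives the same chord point n from P 8 and from b, as
    \<open>T89_halves\<close> requires.\<close>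
  have back8: "third F (P 8) x8 = (- (polar1 F (P 8) n ^ 3)) *s n" "third F b x8' = (- (polar1 F b n ^ 3)) *s n"
    using third_back[OF cF z8(1) n8(1)] third_back[OF cF zb(1) n8(1)] x8a x8b t by simp_all
  have back9: "third F b e8 = (- (polar1 F b y9 ^ 3)) *s y9" "third G b q = (- (polar1 G b y10 ^ 3)) *s y10"
    using third_back[OF cF zb(1) zy(1)] third_back[OF cG zb(2) zy(2)] ff(13,14) t
    unfolding F_def G_def b_def y9_def y10_def by simp_all
  have panz: "polar1 F (P 8) n \<noteq> 0" "polar1 F b n \<noteq> 0" "polar1 F b y9 \<noteq> 0" "polar1 G b y10 \<noteq> 0"
    using x8a x8b ff(13,14) unfolding F_def G_def b_def y9_def y10_def by simp_all
  have gyn: "det3 (P 8) (P j) y \<noteq> 0 \<and> det3 b (P j) y \<noteq> 0" if "j \<in> {5, 6, 7}" "y \<in> {n, y9, y10}" for j y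
    using that ff(9)[of _ j] ff(10)[of _ j] unfolding n_def y9_def y10_def b_def by auto
  have gbe: "det3 b (P i) y \<noteq> 0" if "i \<in> {1, 2, 3, 4}" "y \<in> {e8, q}" for i y
    using that ff(5)[of bar8 i] ff(5)[of barq i] unfolding b_def e8_def q_def by auto
  \<comment> \<open>The end configuration before the exchange of 8 and 9, so b stands in the eighth
    place.\<close>
  define P' where "P' = (\<lambda>m. if m = 8 then b else if m = 9 then e8 else if m = 10 then q else P m)"
  have P'low: "P' i = P i" if "i \<in> {1, 2, 3, 4, 5, 6, 7}" for i using that by (auto simp: P'_def)
  have P'8: "P' i = P i" if "i \<in> {1, 2, 3, 4, 5, 6, 7, 8}" "i \<noteq> 8" for i using that by (intro P'low) blast
  have P'v: "P' 1 = P 1" "P' 2 = P 2" "P' 3 = P 3" "P' 4 = P 4" "P' 5 = P 5" "P' 6 = P 6" "P' 7 = P 7" "P' 8 = b" "P' 9 = e8" "P' 10 = q"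
    by (simp_all add: P'_def)
  \<comment> \<open>The conics and the cubic map involve only P 1, ..., P 4 of the configuration,
    which both ends share.\<close>
  have conic_thru': "conic_thru P' = conic_thru P" "cubic_map P' = cubic_map P"
    by (intro ext; simp add: conic_thru_def conic0_def conic1_def cubic_map_def P'v del: One_nat_def)+
  have half1: "cremona_half P b F G x8 n y9 y10"
  proof (standard, goal_cases)
    case 1 show ?case by (rule cF)
  next
    case 2 show ?case by (rule cG)
  next
    case (3 i) then show ?case by (rule z)
  next
    case 4 show ?case by (rule zb)
  next
    case 5 show ?case by (rule zb)
  next
    case 6 show ?case by (rule z9)
  next
    case 7 show ?case using FG om by simp
  next
    case 8 show ?case by (rule z9)
  next
    case 9 show ?case using FG om by simp
  next
    case (10 i j k) then show ?case by (rule gp8)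
  next
    case (11 i j) then show ?case by (rule gb)
  next
    case (12 m)
    then have m: "m = 9 \<or> m = 10" by simp
    show ?case
    proof (intro conjI ballI)
      show "det3 (P 1) (P 2) (P m) \<noteq> 0" by (rule gpt) (use m in auto)
      fix i :: nat assume "i \<in> {1, 2, 3, 4}"
      then show "det3 (P 8) (P i) (P m) \<noteq> 0" by (intro gpt) (use m in auto)
    qed
  next
    case (13 m)
    then consider "m \<in> {5, 6, 7}" | "m = 9" | "m = 10" by auto
    then show ?case using ek[of 8 m] ff(2)[of 8 9] ff(2)[of 8 10] by cases auto
  next
    case 14 show ?case using x8a by blast
  next
    case (15 i) then show ?case using ff(11)[of "\<lambda>P. P 8" i] unfolding F_def G_def by blast
  next
    case 16 show ?case by (rule zx)
  next
    case 17 show ?case using x8a by blast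
  next
    case 18 show ?case by (rule n8)
  next
    case 19 show ?case using x8a by blast
  next
    case 20 show ?case using x8a by blast
  next
    case 21 show ?case using x8a by blast
  next
    case 22 show ?case using panz by (intro exI[of _ "- (polar1 F (P 8) n ^ 3)"] conjI back8) simp
  next
    case 23 show ?case by (intro exI[of _ 1]) (simp add: t)
  next
    case 24 show ?case by (intro exI[of _ 1]) (simp add: t)
  next
    case (25 j y) then show ?case by (rule gyn)
  qed
  have half2: "cremona_half P' (P 8) F G x8' n y9 y10"
  proof (standard, goal_cases)
    case 1 show ?case by (rule cF)
  next
    case 2 show ?case by (rule cG)
  next
    case (3 i) then show ?case using z[of i] zb by (auto simp: P'_def)
  next
    case 4 show ?case by (rule z8)
  next
    case 5 show ?case by (rule z8)
  next
    case 6 show ?case unfolding P'v by (rule ze)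
  next
    case 7 show ?case using ff(15) unfolding P'v G_def e8_def .
  next
    case 8 show ?case unfolding P'v by (rule ze)
  next
    case 9 show ?case using ff(16) unfolding P'v F_def q_def .
  next
    case (10 i j k)
    then consider "i \<noteq> 8" "j \<noteq> 8" "k \<noteq> 8" | "i = 8" "j \<noteq> 8" "k \<noteq> 8" | "i \<noteq> 8" "j = 8" "k \<noteq> 8" | "i \<noteq> 8" "j \<noteq> 8" "k = 8" by blast
    then show ?case
    proof cases
      case 1 show ?thesis
        unfolding P'8[OF 10(1) 1(1)] P'8[OF 10(2) 1(2)] P'8[OF 10(3) 1(3)] by (rule gp8[OF 10])
    next
      case 2 show ?thesis
        unfolding 2(1) P'v(8) P'8[OF 10(2) 2(2)] P'8[OF 10(3) 2(3)] by (rule gb[OF 10(2,3,5)])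
    next
      case 3
      have "det3 b (P i) (P k) \<noteq> 0" by (rule gb[OF 10(1,3,6)])
      then show ?thesis
        unfolding 3(2) P'v(8) P'8[OF 10(1) 3(1)] P'8[OF 10(3) 3(3)] using det3_nz_perm by blast
    next
      case 4
      have "det3 b (P i) (P j) \<noteq> 0" by (rule gb[OF 10(1,2,4)])
      then show ?thesis
        unfolding 4(3) P'v(8) P'8[OF 10(1) 4(1)] P'8[OF 10(2) 4(2)] using det3_nz_perm by blast
    qed
  next
    case (11 i j)
    have e: "(8::nat) \<in> {1, 2, 3, 4, 5, 6, 7, 8}" by simp
    from 11 consider "i \<noteq> 8" "j \<noteq> 8" | "i = 8" "j \<noteq> 8" | "i \<noteq> 8" "j = 8" by blast
    then show ?case
    proof cases
      case 1 show ?thesis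
        unfolding P'8[OF 11(1) 1(1)] P'8[OF 11(2) 1(2)] by (rule gp8[OF e 11(1,2) _ 11(3)]) (use 1 in simp_all)
    next
      case 2
      have "det3 b (P 8) (P j) \<noteq> 0" by (rule gb[OF e 11(2)]) (use 2 in simp)
      then show ?thesis unfolding 2(1) P'v(8) P'8[OF 11(2) 2(2)] using det3_nz_perm by blast
    next
      case 3
      have "det3 b (P 8) (P i) \<noteq> 0" by (rule gb[OF e 11(1)]) (use 3 in simp)
      then show ?thesis unfolding 3(2) P'v(8) P'8[OF 11(1) 3(1)] using det3_nz_perm by blast
    qed
  next
    case (12 m)
    have d: "det3 (P 1) (P 2) e8 \<noteq> 0" "det3 (P 1) (P 2) q \<noteq> 0" using ff(4) unfolding e8_def q_def by blast+
    have i: "det3 b (P' i) e8 \<noteq> 0 \<and> det3 b (P' i) q \<noteq> 0" if "i \<in> {1, 2, 3, 4}" for i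
    proof -
      have "P' i = P i" by (rule P'low) (use that in blast)
      then show ?thesis using gbe[OF that] by simp
    qed
    from 12 consider "m = 9" | "m = 10" by blast
    then show ?case
    proof cases
      case 1 then show ?thesis unfolding 1 P'v using d i by blast
    next
      case 2 then show ?thesis unfolding 2 P'v using d i by blast
    qed
  next
    case (13 m)
    then consider "m \<in> {5, 6, 7}" | "m = 9" | "m = 10" by blast
    then show ?case
    proof cases
      case 1
      have "P' m = P m" by (rule P'low) (use 1 in blast)
      then show ?thesis using ff(6)[OF 1] unfolding conic_thru' P'v b_def by simp
    next
      case 2 show ?thesis using ff(7) unfolding 2 conic_thru' P'v b_def e8_def .
    next
      case 3 show ?thesis using ff(8) unfolding 3 conic_thru' P'v b_def q_def .
    qed
  next
    case 14 show ?case using x8b unfolding conic_thru' P'v by blast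
  next
    case (15 i) then have "P' i = P i" using P'low by auto
    then show ?case using ff(11)[of ninth_point i] 15 unfolding F_def G_def P'v b_def by simp
  next
    case 16 show ?case by (rule zx)
  next
    case 17 show ?case using x8b by blast
  next
    case 18 show ?case unfolding conic_thru' P'v by (rule nb8)
  next
    case 19 show ?case using x8b unfolding P'v by blast
  next
    case 20 show ?case using x8b unfolding P'v by blast
  next
    case 21 show ?case using x8b unfolding P'v by blast
  next
    case 22 show ?case unfolding P'v using panz by (intro exI[of _ "- (polar1 F b n ^ 3)"] conjI back8) simp
  next
    case 23 show ?case unfolding P'v using panz by (intro exI[of _ "- (polar1 F b y9 ^ 3)"] conjI back9) simp
  next
    case 24 show ?case unfolding P'v using panz by (intro exI[of _ "- (polar1 G b y10 ^ 3)"] conjI back9) simp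
  next
    case (25 j y) then show ?case using gyn[of j y] P'low unfolding P'v by auto
  qed
  have zeros: "cubic_eval C0 x = 0 \<and> cubic_eval C x = 0 \<longleftrightarrow> (\<exists>i\<in>{1..8}. proj_eq x (P i)) \<or> proj_eq x b" if x: "x \<noteq> 0" for x
  proof
    assume "cubic_eval C0 x = 0 \<and> cubic_eval C x = 0"
    then have "F x = 0" "G x = 0" using k0 k1 by simp_all
    with common_zeros[OF x] have c: "(\<exists>i\<in>{1, 2, 3, 4, 5, 6, 7, 8}. \<exists>c. x = c *s P i) \<or> (\<exists>c. x = c *s b)"
      unfolding F_def G_def b_def by blast
    have pe: "proj_eq x v" if "x = c *s v" for c v
      using that x by (auto simp: proj_eq_def)
    show "(\<exists>i\<in>{1..8}. proj_eq x (P i)) \<or> proj_eq x b" using c pe unfolding set8 by blast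
  next
    assume "(\<exists>i\<in>{1..8}. proj_eq x (P i)) \<or> proj_eq x b"
    then obtain v c where v: "x = c *s v" "F v = 0" "G v = 0" unfolding set8 proj_eq_def using z zb by blast
    then have "F x = 0" "G x = 0" using is_cubic_smult[OF cF] is_cubic_smult[OF cG] by simp_all
    then show "cubic_eval C0 x = 0 \<and> cubic_eval C x = 0" using k0 k1 by simp
  qed
  have list: "(\<exists>p\<in>set [P 1, P 2, P 3, P 4, P 5, P 6, P 7, P 8, p]. R p) \<longleftrightarrow> (\<exists>i\<in>{1..8}. R (P i)) \<or> R p" for R p
    unfolding set8 by auto
  have e8nz: "e8 \<noteq> 0" and qnz: "q \<noteq> 0" using gbe[of 1 e8] gbe[of 1 q] by auto
  have ynz: "y9 \<noteq> 0" "y10 \<noteq> 0" using gyn[of 5 y9] gyn[of 5 y10] by auto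
  have npe: "\<not> proj_eq u v" if "det3 u w v \<noteq> 0" for u v w
  proof
    assume "proj_eq u v"
    then obtain c where "u = c *s v" unfolding proj_eq_def by blast
    then show False using that by (simp add: det3_smult)
  qed
  have nbe: "\<not> proj_eq b e8" "\<not> proj_eq b q" "\<not> proj_eq e8 b"
    using npe[of b "P 1" e8] npe[of b "P 1" q] gbe[of 1 e8] gbe[of 1 q] proj_eq_sym by blast+
  have n89: "\<not> proj_eq (P 8) (P 9)" "\<not> proj_eq (P 8) (P 10)"
    by (rule npe[of _ "P 1"], rule gpt; simp)+
  have th0: "third (cubic_eval C0) u v = k0 *s third F u v" and th1: "third (cubic_eval C) u v = k1 *s third G u v" for u v
    unfolding k0(2) k1(2) by (rule third_scale)+
  have tp0: "third_point C0 u v r \<longleftrightarrow> u \<noteq> 0 \<and> v \<noteq> 0 \<and> \<not> proj_eq u v \<and> F u = 0 \<and> F v = 0 \<and> proj_eq r (k0 *s third F u v)" for u v r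
    unfolding third_point_iff th0 using k0 by simp
  have tp1: "third_point C u v r \<longleftrightarrow> u \<noteq> 0 \<and> v \<noteq> 0 \<and> \<not> proj_eq u v \<and> G u = 0 \<and> G v = 0 \<and> proj_eq r (k1 *s third G u v)" for u v r
    unfolding third_point_iff th1 using k1 by simp
  have P8910: "P 8 \<noteq> 0" "P 9 \<noteq> 0" "P 10 \<noteq> 0" using Pnz by simp_all
  have oc: "on_curve C0 u \<longleftrightarrow> u \<noteq> 0 \<and> F u = 0" "on_curve C u \<longleftrightarrow> u \<noteq> 0 \<and> G u = 0" for u
    unfolding on_curve_def using k0 k1 by simp_all
  have sw: "third F e8 b = (polar1 F b y9 ^ 3) *s y9"
    using third_swap(1)[OF cF zb(1) ze(1)] back9(1) by simp
  have pes: "proj_eq u (c *s u)" if "c \<noteq> 0" "u \<noteq> 0" for c u using proj_eq_sym[OF proj_eq_smult[OF that]] .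
  show ?ex
  proof (rule exI[of _ e8], rule exI[of _ b], rule exI[of _ q], intro conjI)
    show "on_curve C0 e8" "on_curve C0 b" "on_curve C q" unfolding oc using e8nz bnz qnz ze zb by simp_all
    show "pencil_base_points [P 1, P 2, P 3, P 4, P 5, P 6, P 7, P 8, b]"
      unfolding pencil_base_points_def
    proof (rule exI[of _ C0], rule exI[of _ C], intro conjI allI impI)
      fix a c assume h: "\<forall>m\<in>mons3. a * C0 m + c * C m = 0"
      have "a * cubic_eval C0 x + c * cubic_eval C x = 0" for x
      proof -
        have "a * cubic_eval C0 x + c * cubic_eval C x = cubic_eval (\<lambda>m. a * C0 m + c * C m) x"
          unfolding cubic_eval_expand by (simp add: algebra_simps)
        also have "\<dots> = 0" unfolding cubic_eval_def by (rule sum.neutral) (use h in auto)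
        finally show ?thesis .
      qed
      \<comment> \<open>Only C survives at P 9 and only C0 at P 10.\<close>
      from this[of "P 9"] this[of "P 10"] show "a = 0" "c = 0" unfolding k0(2) k1(2) using z9 FG om k0(1) k1(1) by simp_all
    next
      fix x :: pt assume "x \<noteq> 0"
      then show "(cubic_eval C0 x = 0 \<and> cubic_eval C x = 0) = (\<exists>p\<in>set [P 1, P 2, P 3, P 4, P 5, P 6, P 7, P 8, b]. proj_eq x p)"
        unfolding list by (rule zeros)
    qed
    show "cubic_sum_eq C0 e8 b (P 8) (P 9)"
      unfolding cubic_sum_eq_def tp0 sw t
      by (rule exI[of _ y9]) (use e8nz bnz nbe ze zb n89 z8 z9 P8910 k0 panz ynz pes in \<open>simp add: vector_smult_assoc\<close>)
    show "cubic_sum_eq C b q (P 8) (P 10)"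
      unfolding cubic_sum_eq_def tp1 back9 t
      by (rule exI[of _ y10]) (use qnz bnz nbe ze zb n89 z8 z9 P8910 k1 panz ynz pes[of "- (k1 * polar1 G b y10 ^ 3)" y10] pes in \<open>simp add: vector_smult_assoc\<close>)
  qed
  assume u: "on_curve C0 p8'" "on_curve C0 p9'" "on_curve C q'"
    "pencil_base_points [P 1, P 2, P 3, P 4, P 5, P 6, P 7, P 8, p9']"
    "cubic_sum_eq C0 p8' p9' (P 8) (P 9)" "cubic_sum_eq C p9' q' (P 8) (P 10)"
  \<comment> \<open>Generators of the given pencil vanish at P 1, ..., P 8, hence are combinations
    of F and G and vanish at b. So b is one of the listed base points, and it is none of P 1, ..., P
    8.\<close>
  have pb9: "proj_eq b p9'"
  proof -
    from u(4) obtain g h where gh: "\<And>x. x \<noteq> 0 \<Longrightarrow> (cubic_eval g x = 0 \<and> cubic_eval h x = 0) \<longleftrightarrow> ((\<exists>i\<in>{1..8}. proj_eq x (P i)) \<or> proj_eq x p9')"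
      unfolding pencil_base_points_def list by blast
    have zz: "cubic_eval g (P i) = 0 \<and> cubic_eval h (P i) = 0" if "i \<in> {1, 2, 3, 4, 5, 6, 7, 8}" for i
    proof -
      have "i \<in> {1..8}" "P i \<noteq> 0" using that Pnz unfolding set8 by auto
      then show ?thesis using gh[of "P i"] proj_eq_refl[of "P i"] by blast
    qed
    have "ten_det P * cubic_eval g b = 0" "ten_det P * cubic_eval h b = 0"
      using pencil_eq[of "cubic_eval g" b] pencil_eq[of "cubic_eval h" b] zz zb unfolding F_def G_def by (auto simp: is_cubic_def)
    then have "(\<exists>i\<in>{1..8}. proj_eq b (P i)) \<or> proj_eq b p9'" using gh[OF bnz] om by simp
    moreover have "\<not> proj_eq b (P i)" if "i \<in> {1..8}" for i
    proof -
      obtain j where "j \<in> {1, 2::nat}" "j \<noteq> i" by (cases "i = 1") auto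
      then have "det3 b (P j) (P i) \<noteq> 0" using that unfolding set8 by (intro gb) auto
      then show ?thesis by (rule npe)
    qed
    ultimately show ?thesis by blast
  qed
  obtain kb where kb: "kb \<noteq> 0" "p9' = kb *s b" using proj_eq_sym[OF pb9] unfolding proj_eq_def by blast
  have p8e: "proj_eq e8 p8'"
  proof -
    from u(5) obtain r where r: "p8' \<noteq> 0" "F p8' = 0" "F p9' = 0" "proj_eq r (k0 *s third F p8' p9')" "proj_eq r (k0 *s y9)"
      unfolding cubic_sum_eq_def tp0 t by blast
    have "proj_eq (k0 *s third F p8' p9') (k0 *s y9)" using r(4,5) proj_eq_sym proj_eq_trans by blast
    then obtain c where c: "c \<noteq> 0" "k0 *s third F p8' p9' = c *s (k0 *s y9)" unfolding proj_eq_def by blast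
    have "third F p8' (kb *s b) = c *s y9" using smult_eqD[of k0 "third F p8' p9'" "c * k0" y9] c k0 kb by simp
    from third_unique[OF cF r(2) zb(1) r(1) kb(1) c(1) this] gyn[of 5 y9] show ?thesis unfolding t by blast
  qed
  have qe: "proj_eq q q'"
  proof -
    from u(6) obtain r where r: "q' \<noteq> 0" "G q' = 0" "G p9' = 0" "proj_eq r (k1 *s third G p9' q')" "proj_eq r (k1 *s y10)"
      unfolding cubic_sum_eq_def tp1 t by blast
    have "proj_eq (k1 *s third G p9' q') (k1 *s y10)" using r(4,5) proj_eq_sym proj_eq_trans by blast
    then obtain c where c: "c \<noteq> 0" "k1 *s third G p9' q' = c *s (k1 *s y10)" unfolding proj_eq_def by blast
    have "third G p9' q' = c *s y10" using smult_eqD[of k1 "third G p9' q'" "c * k1" y10] c k1 by simp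
    then have "third G q' (kb *s b) = (- c) *s y10" using third_swap(1)[OF cG r(3,2)] kb by simp
    from third_unique[OF cG r(2) zb(2) r(1) kb(1) _ this] c(1) gyn[of 5 y10] show ?thesis unfolding t neg_equal_0_iff_equal by blast
  qed
  show "T89_rel P (\<lambda>m. if m = 8 then p8' else if m = 9 then p9' else if m = 10 then q' else P m) \<and>
          (\<forall>x. (on_curve C0 x \<and> on_curve C x) \<longleftrightarrow> ((\<exists>i\<in>{1..8}. proj_eq x (P i)) \<or> proj_eq x p9'))"
  proof (intro conjI allI)
    show "T89_rel P (\<lambda>m. if m = 8 then p8' else if m = 9 then p9' else if m = 10 then q' else P m)"
    proof (rule T89_halves[OF half1 half2 P'v(8) P'low])
      fix i :: nat assume i: "i \<in> {1, 2, 3, 4, 5, 6, 7}"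
      then have "P i \<noteq> 0" by (intro Pnz) auto
      then show "proj_eq (P i) (if i = 8 then p8' else if i = 9 then p9' else if i = 10 then q' else P i)"
        using i proj_eq_refl by auto
    qed (use p8e pb9 qe in \<open>simp_all add: P'v\<close>)
    fix x
    have "proj_eq x b \<longleftrightarrow> proj_eq x p9'" using pb9 proj_eq_sym proj_eq_trans by blast
    moreover have "x \<noteq> 0" if "proj_eq x v" for v using that unfolding proj_eq_def by blast
    ultimately show "(on_curve C0 x \<and> on_curve C x) \<longleftrightarrow> ((\<exists>i\<in>{1..8}. proj_eq x (P i)) \<or> proj_eq x p9')"
      using zeros[of x] unfolding on_curve_def by blast
  qed
qed

section \<open>A generic configuration\<close>

text \<open>Found by a computer search for small coordinates of the derived points.\<close>
definition witness :: cfg where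
  "witness m = (if m = 1 then vector [1, 0, 0] else if m = 2 then vector [0, 1, 0] else if m = 3 then vector [0, 0, 1]
     else if m = 4 then vector [1, 1, 1] else if m = 5 then vector [4, 3, -5] else if m = 6 then vector [3, 5, -3]
     else if m = 7 then vector [5, 4, 2] else if m = 8 then vector [3, 4, -2] else if m = 9 then vector [2, 1, -4]
     else vector [2, 4, -1])"

lemma witness_simps:
  "witness 1 = vector [1, 0, 0]" "witness (Suc 0) = vector [1, 0, 0]" "witness 2 = vector [0, 1, 0]" "witness 3 = vector [0, 0, 1]" "witness 4 = vector [1, 1, 1]"
  "witness 5 = vector [4, 3, -5]" "witness 6 = vector [3, 5, -3]" "witness 7 = vector [5, 4, 2]" "witness 8 = vector [3, 4, -2]"
  "witness 9 = vector [2, 1, -4]" "witness 10 = vector [2, 4, -1]"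
  by (simp_all add: witness_def)

text \<open>\<open>cubic_thru witness 9\<close> without the common factor 1451520 of its
  coefficients. No pure cubes occur because the coordinate points lie on it.\<close>

definition witness_cubic9 :: "pt \<Rightarrow> complex" where
  "witness_cubic9 v = (202) * v$1^2 * v$2 + (-3350) * v$1^2 * v$3 + (84) * v$1 * v$2^2 + (5045) * v$1 * v$2 * v$3 + (-925) * v$1 * v$3^2 + (-1614) * v$2^2 * v$3 + (558) * v$2 * v$3^2"

definition witness_cubic10 :: "pt \<Rightarrow> complex" where
  "witness_cubic10 v = (208) * v$1^2 * v$2 + (-1324) * v$1^2 * v$3 + (-84) * v$1 * v$2^2 + (1802) * v$1 * v$2 * v$3 + (-674) * v$1 * v$3^2 + (-477) * v$2^2 * v$3 + (549) * v$2 * v$3^2"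

lemma witness_cubic_is_cubic: "is_cubic witness_cubic9" "is_cubic witness_cubic10"
proof -
  have "witness_cubic9 = cubic_eval (\<lambda>m. if m = (0, 2, 1) then -1614 else if m = (0, 1, 2) then 558 else if m = (2, 1, 0) then 202 else if m = (1, 2, 0) then 84 else if m = (2, 0, 1) then -3350 else if m = (1, 1, 1) then 5045 else if m = (1, 0, 2) then -925 else 0)"
    by (rule ext) (simp add: cubic_eval_expand witness_cubic9_def)
  then show "is_cubic witness_cubic9" unfolding is_cubic_def by blast
  have "witness_cubic10 = cubic_eval (\<lambda>m. if m = (0, 2, 1) then -477 else if m = (0, 1, 2) then 549 else if m = (2, 1, 0) then 208 else if m = (1, 2, 0) then -84 else if m = (2, 0, 1) then -1324 else if m = (1, 1, 1) then 1802 else if m = (1, 0, 2) then -674 else 0)"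
    by (rule ext) (simp add: cubic_eval_expand witness_cubic10_def)
  then show "is_cubic witness_cubic10" unfolding is_cubic_def by blast
qed

lemma con_witness: "conic0 witness v = v $ 3 * (v $ 2 - v $ 1)" "conic1 witness v = v $ 2 * (v $ 3 - v $ 1)"
  unfolding conic0_def conic1_def witness_simps det3_def by (simp_all add: algebra_simps)

lemma net_witness: "net witness (witness 8) = vector [1232, -3360, -224]" "net witness (witness 9) = vector [-5850, 2340, 900]" "net witness (witness 10) = vector [-3078, -972, 0]"
  unfolding net_def conic_thru_def con_witness witness_simps det3_def by (simp_all add: vec_eq_iff forall_3)

lemma cubic_thru_witness: "cubic_thru witness 9 = (\<lambda>v. 1451520 * witness_cubic9 v)" "cubic_thru witness 10 = (\<lambda>v. 2177280 * witness_cubic10 v)"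
proof -
  show "cubic_thru witness 9 = (\<lambda>v. 1451520 * witness_cubic9 v)"
    unfolding cubic_thru_def net_witness by (rule ext) (simp add: net_def conic_thru_def con_witness witness_simps det3_def witness_cubic9_def, simp add: algebra_simps power2_eq_square)
  show "cubic_thru witness 10 = (\<lambda>v. 2177280 * witness_cubic10 v)"
    unfolding cubic_thru_def net_witness by (rule ext) (simp add: net_def conic_thru_def con_witness witness_simps det3_def witness_cubic10_def, simp add: algebra_simps power2_eq_square)
qed

lemma polar1_scale: "polar1 (\<lambda>v. k * F v) p q = k * polar1 F p q" "polar2 (\<lambda>v. k * F v) p q = k * polar2 F p q"
  by (simp_all add: polar1_def polar2_def field_simps)

text \<open>Integer representatives of the derived points. The polynomial formulas produce them with
  large nonzero factors, which do not affect whether a condition vanishes.\<close>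

abbreviation "base_w \<equiv> (vector [-162, -495, -88] :: pt)"

abbreviation "chord9_w \<equiv> (vector [-6010, -16625, -9772] :: pt)"

abbreviation "chord10_w \<equiv> (vector [453, 1300, -128] :: pt)"

abbreviation "bar8_w \<equiv> (vector [4631, 6835, 29891] :: pt)"

abbreviation "barq_w \<equiv> (vector [195, 248, -1440] :: pt)"

abbreviation "coresidual_w \<equiv> (vector [4917, 8020, -4542] :: pt)"

abbreviation "residue_w \<equiv> (vector [-260226, -121695, -21014] :: pt)"

abbreviation "residue9_w \<equiv> (vector [-11685, -5371, 24890] :: pt)"

lemma witness_cubic_zero:
  "witness_cubic9 (witness 8) = 0" "witness_cubic10 (witness 8) = 0" "witness_cubic9 (witness 9) = 0" "witness_cubic10 (witness 10) = 0" "witness_cubic9 base_w = 0" "witness_cubic10 base_w = 0"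
  "witness_cubic9 chord9_w = 0" "witness_cubic10 chord10_w = 0" "witness_cubic9 coresidual_w = 0"
  by (simp_all add: witness_cubic9_def witness_cubic10_def witness_simps)

lemma ninth_point_witness: "\<exists>c. c \<noteq> 0 \<and> ninth_point witness = c *s base_w"
proof -
  have d: "conic_lin witness 5 q0 q1 = (-27) * q0 - 5 * q1" "conic_lin witness 6 q0 q1 = (-30) * q0 + 6 * q1" "conic_lin witness 7 q0 q1 = (-12) * q0 + 2 * q1" for q0 q1
    unfolding conic_lin_def con_witness witness_simps by simp_all
  have h: "ninth_param0 witness = -1432699011072000" "ninth_param1 witness = 1790873763840000"
    unfolding ninth_param0_def ninth_param1_def conic_param_def d con_witness net_witness unfolding witness_simps by simp_all
  show ?thesis
    unfolding ninth_point_def conic_param_def d h net_witness unfolding witness_simps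
    \<comment> \<open>The parameters reduce to (-4 : 5), the ratio of the two conics at
      \<open>base_w\<close>; the constant is the common factor that the polynomial formula
      adds.\<close>
    by (rule exI[of _ "15517856009829752046134231040000000"]) (simp add: vec_eq_iff forall_3)
qed

lemma coresidual_witness: "\<exists>c. c \<noteq> 0 \<and> coresidual witness = c *s coresidual_w"
  unfolding coresidual_def net_witness Let_def conic_thru_def con_witness unfolding witness_simps
  by (rule exI[of _ "3043314892800"]) (simp add: vec_eq_iff forall_3)

lemma third_witness:
  "third witness_cubic9 (witness 8) (witness 9) = (4) *s chord9_w"
  "third witness_cubic10 (witness 8) (witness 10) = (2) *s chord10_w"
  "third witness_cubic9 base_w chord9_w = (68688025280) *s bar8_w"
  "third witness_cubic10 base_w chord10_w = (1545451500) *s barq_w"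
  "third witness_cubic9 (witness 8) coresidual_w = (39936) *s residue_w"
  "third witness_cubic9 base_w coresidual_w = (167994937500) *s residue9_w"
  by (simp_all add: third_def polar1_def polar2_def witness_cubic9_def witness_cubic10_def witness_simps vec_eq_iff forall_3)

text \<open>Each construction is homogeneous in its arguments, so passing to representatives only
  changes a scalar, of which only the nonvanishing is kept.\<close>

lemma witness_data:
  obtains cb cn cy9 cy10 ce cq cx cx' where
    "ninth_point witness = cb *s base_w" "cb \<noteq> 0" "coresidual witness = cn *s coresidual_w" "cn \<noteq> 0" "chord9 witness = cy9 *s chord9_w" "cy9 \<noteq> 0"
    "chord10 witness = cy10 *s chord10_w" "cy10 \<noteq> 0" "bar8 witness = ce *s bar8_w" "ce \<noteq> 0" "barq witness = cq *s barq_w" "cq \<noteq> 0"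
    "conic_residue witness = cx *s residue_w" "cx \<noteq> 0" "conic_residue9 witness = cx' *s residue9_w" "cx' \<noteq> 0"
proof -
  obtain cb where cb: "ninth_point witness = cb *s base_w" "cb \<noteq> 0" using ninth_point_witness by blast
  obtain cn where cn: "coresidual witness = cn *s coresidual_w" "cn \<noteq> 0" using coresidual_witness by blast
  have y9: "chord9 witness = 5806080 *s chord9_w" unfolding chord9_def cubic_thru_witness third_scale third_witness vector_smult_assoc by simp
  have y10: "chord10 witness = 4354560 *s chord10_w" unfolding chord10_def cubic_thru_witness third_scale third_witness vector_smult_assoc by simp
  have sc: "\<exists>k. k \<noteq> 0 \<and> third (\<lambda>v. K * F v) (c *s p) (d *s q) = k *s r"
    if "is_cubic F" "F p = 0" "F q = 0" "third F p q = e *s r" "K \<noteq> 0" "c \<noteq> 0" "d \<noteq> 0" "e \<noteq> 0" for F K c d e p q r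
    unfolding third_scale third_smult2[OF that(1-3)] that(4) vector_smult_assoc
    by (rule exI[of _ "K * (c\<^sup>2 * d\<^sup>2 * e)"]) (use that in simp)
  have one: "witness 8 = 1 *s witness 8" by simp
  have "\<exists>k. k \<noteq> 0 \<and> bar8 witness = k *s bar8_w"
    unfolding bar8_def cubic_thru_witness cb y9 by (rule sc[OF witness_cubic_is_cubic(1) witness_cubic_zero(5,7) third_witness(3)]) (use cb in simp_all)
  then obtain ce where ce: "bar8 witness = ce *s bar8_w" "ce \<noteq> 0" by blast
  have "\<exists>k. k \<noteq> 0 \<and> barq witness = k *s barq_w"
    unfolding barq_def cubic_thru_witness cb y10 by (rule sc[OF witness_cubic_is_cubic(2) witness_cubic_zero(6,8) third_witness(4)]) (use cb in simp_all)
  then obtain cq where cq: "barq witness = cq *s barq_w" "cq \<noteq> 0" by blast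
  have "\<exists>k. k \<noteq> 0 \<and> conic_residue witness = k *s residue_w"
    unfolding conic_residue_def cubic_thru_witness cn by (subst one, rule sc[OF witness_cubic_is_cubic(1) witness_cubic_zero(1,9) third_witness(5)]) (use cn in simp_all)
  then obtain cx where cx: "conic_residue witness = cx *s residue_w" "cx \<noteq> 0" by blast
  have "\<exists>k. k \<noteq> 0 \<and> conic_residue9 witness = k *s residue9_w"
    unfolding conic_residue9_def cubic_thru_witness cb cn by (rule sc[OF witness_cubic_is_cubic(1) witness_cubic_zero(5,9) third_witness(6)]) (use cb cn in simp_all)
  then obtain cx' where cx': "conic_residue9 witness = cx' *s residue9_w" "cx' \<noteq> 0" by blast
  show ?thesis by (rule that[OF cb cn y9 _ y10 _ ce cq cx cx']) simp_all
qed

lemma conic_thru_smult: "conic_thru P (c *s a) x = c^2 * conic_thru P a x" "conic_thru P a (c *s x) = c^2 * conic_thru P a x"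
  by (simp_all add: conic_thru_def con_smult algebra_simps)

text \<open>As functions of a the three components are homogeneous of degrees 3, 3 and 2.\<close>

lemma cubic_map_smult: "det3 (cubic_map P (c *s a) x) (cubic_map P (c *s a) y) (cubic_map P (c *s a) z) = c ^ 8 * det3 (cubic_map P a x) (cubic_map P a y) (cubic_map P a z)"
proof -
  have r: "cubic_map P (c *s a) v $ 1 = c^3 * cubic_map P a v $ 1" "cubic_map P (c *s a) v $ 2 = c^3 * cubic_map P a v $ 2" "cubic_map P (c *s a) v $ 3 = c^2 * cubic_map P a v $ 3" for v
    by (simp_all add: cubic_map_def conic_thru_smult det3_smult power2_eq_square power3_eq_cube)
  show ?thesis unfolding det3_def r by algebra
qed

lemma conic_thru_witness: "conic_thru witness a x = a $ 2 * (a $ 3 - a $ 1) * (x $ 3 * (x $ 2 - x $ 1)) - a $ 3 * (a $ 2 - a $ 1) * (x $ 2 * (x $ 3 - x $ 1))"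
  by (simp add: conic_thru_def con_witness)

lemma polar1_witness:
  assumes "F p = 0" "F (witness i) = 0" "is_cubic F"
  shows "polar1 F (c *s p) (witness i) = c^2 * polar1 F p (witness i)" "polar2 F (c *s p) (witness i) = c * polar2 F p (witness i)"
  using third_smult2[OF assms(3,1,2), of c 1] by simp_all

text \<open>Every condition is homogeneous in each derived point, so after nonzero scalars are taken
  out only integer evaluations remain.\<close>

lemma generic_poly_witness: "generic_poly witness \<noteq> 0"
proof -
  obtain cb cn cy9 cy10 ce cq cx cx' where
    d: "ninth_point witness = cb *s base_w" "cb \<noteq> 0" "coresidual witness = cn *s coresidual_w" "cn \<noteq> 0" "chord9 witness = cy9 *s chord9_w" "cy9 \<noteq> 0"
    "chord10 witness = cy10 *s chord10_w" "cy10 \<noteq> 0" "bar8 witness = ce *s bar8_w" "ce \<noteq> 0" "barq witness = cq *s barq_w" "cq \<noteq> 0"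
    "conic_residue witness = cx *s residue_w" "cx \<noteq> 0" "conic_residue9 witness = cx' *s residue9_w" "cx' \<noteq> 0"
    by (rule witness_data) (rule that)
  have ten_det: "ten_det witness \<noteq> 0" unfolding ten_det_def net_witness by (simp add: det3_def)
  have G: "witness_cubic9 (witness i) = 0" "witness_cubic10 (witness i) = 0" if "i \<in> {1, 2, 3, 4}" for i
    using that by (auto simp: witness_cubic9_def witness_cubic10_def witness_simps simp del: One_nat_def)
  have A: "polar1 (cubic_thru witness 10) (cb *s base_w) (witness i) * polar2 (cubic_thru witness 9) (cb *s base_w) (witness i)
       - polar1 (cubic_thru witness 9) (cb *s base_w) (witness i) * polar2 (cubic_thru witness 10) (cb *s base_w) (witness i)
     = (2177280 * 1451520 * cb^3) * (polar1 witness_cubic10 base_w (witness i) * polar2 witness_cubic9 base_w (witness i) - polar1 witness_cubic9 base_w (witness i) * polar2 witness_cubic10 base_w (witness i))"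
    if "i \<in> {1, 2, 3, 4}" for i
    unfolding cubic_thru_witness polar1_scale polar1_witness[OF witness_cubic_zero(5) G(1)[OF that] witness_cubic_is_cubic(1)] polar1_witness[OF witness_cubic_zero(6) G(2)[OF that] witness_cubic_is_cubic(2)]
    by (simp add: algebra_simps power2_eq_square power3_eq_cube)
  have nz: "polar1 witness_cubic10 base_w (witness i) * polar2 witness_cubic9 base_w (witness i) - polar1 witness_cubic9 base_w (witness i) * polar2 witness_cubic10 base_w (witness i) \<noteq> 0" if "i \<in> {1, 2, 3, 4}" for i
    using that by (elim insertE emptyE) (simp_all add: witness_simps polar1_def polar2_def witness_cubic9_def witness_cubic10_def)
  have nz8: "polar1 (cubic_thru witness 10) (witness 8) (witness i) * polar2 (cubic_thru witness 9) (witness 8) (witness i)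
       - polar1 (cubic_thru witness 9) (witness 8) (witness i) * polar2 (cubic_thru witness 10) (witness 8) (witness i) \<noteq> 0" if "i \<in> {1, 2, 3, 4}" for i
    using that unfolding cubic_thru_witness by (elim insertE emptyE) (simp_all add: witness_simps polar1_def polar2_def witness_cubic9_def witness_cubic10_def)
  have p: "polar1 (cubic_thru witness 9) (witness 8) (cn *s coresidual_w) \<noteq> 0" "polar2 (cubic_thru witness 9) (witness 8) (cn *s coresidual_w) \<noteq> 0"
    unfolding cubic_thru_witness polar1_scale using third_smult2(2,3)[OF witness_cubic_is_cubic(1) witness_cubic_zero(1,9), of 1 cn] d(4)
    by (simp_all add: witness_simps polar1_def polar2_def witness_cubic9_def)
  have p': "polar1 (cubic_thru witness 9) (cb *s base_w) (cn *s coresidual_w) \<noteq> 0" "polar2 (cubic_thru witness 9) (cb *s base_w) (cn *s coresidual_w) \<noteq> 0"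
    "polar1 (cubic_thru witness 9) (cb *s base_w) (cy9 *s chord9_w) \<noteq> 0" "polar1 (cubic_thru witness 10) (cb *s base_w) (cy10 *s chord10_w) \<noteq> 0"
    unfolding cubic_thru_witness polar1_scale third_smult2[OF witness_cubic_is_cubic(1) witness_cubic_zero(5,9)] third_smult2[OF witness_cubic_is_cubic(1) witness_cubic_zero(5,7)] third_smult2[OF witness_cubic_is_cubic(2) witness_cubic_zero(6,8)]
    using d by (simp_all add: polar1_def polar2_def witness_cubic9_def witness_cubic10_def)
  have g: "cubic_thru witness 10 (c *s bar8_w) \<noteq> 0" "cubic_thru witness 9 (c *s barq_w) \<noteq> 0" "cubic_thru witness 10 (c *s residue_w) \<noteq> 0" "cubic_thru witness 10 (c *s residue9_w) \<noteq> 0" if "c \<noteq> 0" for c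
    unfolding cubic_thru_witness is_cubic_smult[OF witness_cubic_is_cubic(1)] is_cubic_smult[OF witness_cubic_is_cubic(2)] using that by (simp_all add: witness_cubic9_def witness_cubic10_def)
  have R: "det3 (cubic_map witness (witness 8) (witness 5)) (cubic_map witness (witness 8) (witness 6)) (cubic_map witness (witness 8) (witness 7)) \<noteq> 0"
    "det3 (cubic_map witness base_w (witness 5)) (cubic_map witness base_w (witness 6)) (cubic_map witness base_w (witness 7)) \<noteq> 0"
    unfolding cubic_map_def conic_thru_witness witness_simps by (simp_all add: det3_def)
  have Anz: "polar1 (cubic_thru witness 10) (cb *s base_w) (witness i) * polar2 (cubic_thru witness 9) (cb *s base_w) (witness i)
       - polar1 (cubic_thru witness 9) (cb *s base_w) (witness i) * polar2 (cubic_thru witness 10) (cb *s base_w) (witness i) \<noteq> 0" if "i \<in> {1, 2, 3, 4}" for i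
    unfolding A[OF that] using nz[OF that] d by simp
  have R': "det3 (cubic_map witness (cb *s base_w) (witness 5)) (cubic_map witness (cb *s base_w) (witness 6)) (cubic_map witness (cb *s base_w) (witness 7)) \<noteq> 0"
    unfolding cubic_map_smult using R d by simp
  have "list_all (\<lambda>c. c witness \<noteq> 0) generic_conditions"
    unfolding generic_conditions_def pairs8_def list.map concat.simps append.simps list.pred_inject prod.case d
    by (intro conjI TrueI ten_det p p' g Anz nz8 R(1) R' d)
       (simp_all add: det3_smult conic_thru_smult conic_thru_witness witness_simps det3_def d)
  then show ?thesis unfolding generic_poly_nz by (simp add: list_all_iff)
qed

text \<open>Solvability of (1) to (3) is asserted next to the consequences, so that these are not
  vacuous; the polynomial is \<open>generic_poly\<close>.\<close>

theorem theorem6: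
  "\<exists>f\<in>cfg_poly. (\<exists>P. f P \<noteq> 0) \<and>
    (\<forall>P C0 C. gen_pos 10 P \<and> f P \<noteq> 0 \<and> smooth_cubic C0 \<and> smooth_cubic C \<and>
       (\<forall>i\<in>{1..9}. on_curve C0 (P i)) \<and> (\<forall>i\<in>{1..8}. on_curve C (P i)) \<and> on_curve C (P 10)
     \<longrightarrow>
       (\<exists>p8' p9' q'. on_curve C0 p8' \<and> on_curve C0 p9' \<and> on_curve C q' \<and>
          pencil_base_points [P 1, P 2, P 3, P 4, P 5, P 6, P 7, P 8, p9'] \<and>
          cubic_sum_eq C0 p8' p9' (P 8) (P 9) \<and> cubic_sum_eq C p9' q' (P 8) (P 10)) \<and>
       (\<forall>p8' p9' q'. on_curve C0 p8' \<and> on_curve C0 p9' \<and> on_curve C q' \<and>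
          pencil_base_points [P 1, P 2, P 3, P 4, P 5, P 6, P 7, P 8, p9'] \<and>
          cubic_sum_eq C0 p8' p9' (P 8) (P 9) \<and> cubic_sum_eq C p9' q' (P 8) (P 10)
        \<longrightarrow>
          T89_rel P (\<lambda>m. if m = 8 then p8' else if m = 9 then p9' else if m = 10 then q' else P m) \<and>
          (\<forall>x. (on_curve C0 x \<and> on_curve C x) \<longleftrightarrow> ((\<exists>i\<in>{1..8}. proj_eq x (P i)) \<or> proj_eq x p9'))))"
proof (rule bexI[OF _ generic_poly_poly], intro conjI exI[of _ witness] generic_poly_witness allI impI)
  fix P C0 C
  assume h: "gen_pos 10 P \<and> generic_poly P \<noteq> 0 \<and> smooth_cubic C0 \<and> smooth_cubic C \<and>
    (\<forall>i\<in>{1..9}. on_curve C0 (P i)) \<and> (\<forall>i\<in>{1..8}. on_curve C (P i)) \<and> on_curve C (P 10)"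
  note g = theorem6_generic[of P C0 C]
  show "\<exists>p8' p9' q'. on_curve C0 p8' \<and> on_curve C0 p9' \<and> on_curve C q' \<and>
          pencil_base_points [P 1, P 2, P 3, P 4, P 5, P 6, P 7, P 8, p9'] \<and>
          cubic_sum_eq C0 p8' p9' (P 8) (P 9) \<and> cubic_sum_eq C p9' q' (P 8) (P 10)"
    by (rule g(1)) (use h in blast)+
  fix p8' p9' q'
  assume u: "on_curve C0 p8' \<and> on_curve C0 p9' \<and> on_curve C q' \<and>
          pencil_base_points [P 1, P 2, P 3, P 4, P 5, P 6, P 7, P 8, p9'] \<and>
          cubic_sum_eq C0 p8' p9' (P 8) (P 9) \<and> cubic_sum_eq C p9' q' (P 8) (P 10)"
  have a: "T89_rel P (\<lambda>m. if m = 8 then p8' else if m = 9 then p9' else if m = 10 then q' else P m) \<and>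
          (\<forall>x. (on_curve C0 x \<and> on_curve C x) \<longleftrightarrow> ((\<exists>i\<in>{1..8}. proj_eq x (P i)) \<or> proj_eq x p9'))"
    by (rule g(2)) (use h u in blast)+
  show "T89_rel P (\<lambda>m. if m = 8 then p8' else if m = 9 then p9' else if m = 10 then q' else P m)"
    using a by (rule conjunct1)
  show "(on_curve C0 x \<and> on_curve C x) = ((\<exists>i\<in>{1..8}. proj_eq x (P i)) \<or> proj_eq x p9')" for x
    using a by blast
qed

end
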